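(* Let $r \in \{1,\infty\}$ and $N \in \{0,2,3,4,\ldots\}$. Every nontrivial normed (respectively subnormed) topological pseudovector group $(G,+,*,\|\cdot\|_G)$ such that $(G,+,\|\cdot\|_G) \in \mathfrak{G}_r(N)$ may be enlarged to a normed (respectively subnormed) topological pseudovector group $(\tilde{G},+,*,\|\cdot\|)$ such that the valued groups $(\tilde{G},+,\|\cdot\|)$ and $\mathbb{G}_r(N)$ are isometrically group isomorphic.
   Context: All groups are Abelian. A value on $G$ is $p\colon G\to[0,\infty)$ with $p(x)=0\iff x=0$, $p(-x)=p(x)$, $p(x+y)\leqslant p(x)+p(y)$; it induces the metric $p(x-y)$. Class $\mathcal{O}_0$: $\lim_n p(na)/n=0$ for all $a$. $\mathfrak{G}_r(N)$ ($r\in\{1,\infty\}$, $N\in\{0,2,3,\ldots\}$): separable valued Abelian groups of class $\mathcal{O}_0$ with $p\leqslant r$ (vacuous if $r=\infty$) and of exponent $N$ if $N\neq0$. $\mathbb{G}_r(N)$ is the valued Abelian group, unique up to isometric group isomorphism, which (G1) is complete and in $\mathfrak{G}_r(N)$; (G2) for every finite valued Abelian group $(H,+,q)$ (of exponent $N$ if $N\neq0$) with $q\leqslant r$, subgroup $K$ and isometric homomorphism $\varphi\colon K\to\mathbb{G}_r(N)$, and every $\varepsilon\in(0,1)$, there is a homomorphism $\varphi_\varepsilon\colon H\to\mathbb{G}_r(N)$ with $p(\varphi(x)-\varphi_\varepsilon(x))\leqslant\varepsilon$ on $K$ and $(1-\varepsilon)q\leqslant p\circ\varphi_\varepsilon\leqslant(1+\varepsilon)q$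 on $H$; (G3) if $N=0$, finite-order elements are dense. A pseudovector group is a triple $(G,+,* )$ where $(G,+)$ is an Abelian group and $*\colon[0,\infty)\times G\to G$ is an action with $0*x=0$, $1*x=x$, $(st)*x=s*(t*x)$, and $x\mapsto t*x$ a group homomorphism for each $t\geqslant0$. A value $\|\cdot\|$ on it is a norm if $\|t*x\|=t\|x\|$ for all $t\geqslant0$, $x\in G$, and a subnorm if $\|x\|\leqslant\|s*x\|\leqslant s\|x\|$ for all $s\geqslant1$, $x\in G$. A (sub)normed topological pseudovector group is $(G,+,*,\|\cdot\|)$ with $\|\cdot\|$ a (sub)norm such that $*$ is continuous from $[0,\infty)\times G$ to $G$ in the topology induced by $\|\cdot\|$. Enlarging means $G\subseteq\tilde{G}$ and the addition, action and (sub)norm of $\tilde{G}$ extend those of $G$. *)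

theory Defs
  imports Complex_Main "HOL-Library.Countable_Set" "HOL-Library.Extended_Real"
begin

definition ab_grp :: "'a set \<Rightarrow> ('a \<Rightarrow> 'a \<Rightarrow> 'a) \<Rightarrow> bool" where
  "ab_grp G f \<longleftrightarrow>
     (\<forall>x\<in>G. \<forall>y\<in>G. f x y \<in> G) \<and>
     (\<forall>x\<in>G. \<forall>y\<in>G. \<forall>z\<in>G. f (f x y) z = f x (f y z)) \<and>
     (\<forall>x\<in>G. \<forall>y\<in>G. f x y = f y x) \<and>
     (\<exists>e\<in>G. (\<forall>x\<in>G. f e x = x) \<and> (\<forall>x\<in>G. \<exists>y\<in>G. f x y = e))"

definition gzero :: "'a set \<Rightarrow> ('a \<Rightarrow> 'a \<Rightarrow> 'a) \<Rightarrow> 'a" where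
  "gzero G f = (THE e. e \<in> G \<and> (\<forall>x\<in>G. f e x = x))"

definition gneg :: "'a set \<Rightarrow> ('a \<Rightarrow> 'a \<Rightarrow> 'a) \<Rightarrow> 'a \<Rightarrow> 'a" where
  "gneg G f x = (THE y. y \<in> G \<and> f x y = gzero G f)"

definition gsub :: "'a set \<Rightarrow> ('a \<Rightarrow> 'a \<Rightarrow> 'a) \<Rightarrow> 'a \<Rightarrow> 'a \<Rightarrow> 'a" where
  "gsub G f x y = f x (gneg G f y)"

fun gmult :: "'a set \<Rightarrow> ('a \<Rightarrow> 'a \<Rightarrow> 'a) \<Rightarrow> nat \<Rightarrow> 'a \<Rightarrow> 'a" where
  "gmult G f 0 x = gzero G f"
| "gmult G f (Suc n) x = f x (gmult G f n x)"

definition subgrp :: "'a set \<Rightarrow> 'a set \<Rightarrow> ('a \<Rightarrow> 'a \<Rightarrow> 'a) \<Rightarrow> bool" where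
  "subgrp K G f \<longleftrightarrow> K \<subseteq> G \<and> K \<noteq> {} \<and> (\<forall>x\<in>K. \<forall>y\<in>K. gsub G f x y \<in> K)"

definition grp_hom :: "'a set \<Rightarrow> ('a \<Rightarrow> 'a \<Rightarrow> 'a) \<Rightarrow> 'b set \<Rightarrow> ('b \<Rightarrow> 'b \<Rightarrow> 'b) \<Rightarrow> ('a \<Rightarrow> 'b) \<Rightarrow> bool" where
  "grp_hom G f H g \<phi> \<longleftrightarrow> (\<forall>x\<in>G. \<phi> x \<in> H) \<and> (\<forall>x\<in>G. \<forall>y\<in>G. \<phi> (f x y) = g (\<phi> x) (\<phi> y))"

definition has_exponent :: "'a set \<Rightarrow> ('a \<Rightarrow> 'a \<Rightarrow> 'a) \<Rightarrow> nat \<Rightarrow> bool" where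
  "has_exponent G f N \<longleftrightarrow> (\<forall>x\<in>G. gmult G f N x = gzero G f)"

definition is_value :: "'a set \<Rightarrow> ('a \<Rightarrow> 'a \<Rightarrow> 'a) \<Rightarrow> ('a \<Rightarrow> real) \<Rightarrow> bool" where
  "is_value G f p \<longleftrightarrow>
     (\<forall>x\<in>G. p x \<ge> 0) \<and>
     (\<forall>x\<in>G. p x = 0 \<longleftrightarrow> x = gzero G f) \<and>
     (\<forall>x\<in>G. p (gneg G f x) = p x) \<and>
     (\<forall>x\<in>G. \<forall>y\<in>G. p (f x y) \<le> p x + p y)"

definition valued_grp :: "'a set \<Rightarrow> ('a \<Rightarrow> 'a \<Rightarrow> 'a) \<Rightarrow> ('a \<Rightarrow> real) \<Rightarrow> bool" where
  "valued_grp G f p \<longleftrightarrow> ab_grp G f \<and> is_value G f p"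

definition vg_separable :: "'a set \<Rightarrow> ('a \<Rightarrow> 'a \<Rightarrow> 'a) \<Rightarrow> ('a \<Rightarrow> real) \<Rightarrow> bool" where
  "vg_separable G f p \<longleftrightarrow>
     (\<exists>D\<subseteq>G. countable D \<and> (\<forall>x\<in>G. \<forall>\<epsilon>>0. \<exists>d\<in>D. p (gsub G f x d) < \<epsilon>))"

definition vg_complete :: "'a set \<Rightarrow> ('a \<Rightarrow> 'a \<Rightarrow> 'a) \<Rightarrow> ('a \<Rightarrow> real) \<Rightarrow> bool" where
  "vg_complete G f p \<longleftrightarrow>
     (\<forall>X. (\<forall>n. X n \<in> G) \<and> (\<forall>\<epsilon>>0. \<exists>M. \<forall>m\<ge>M. \<forall>n\<ge>M. p (gsub G f (X m) (X n)) < \<epsilon>)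
        \<longrightarrow> (\<exists>x\<in>G. (\<lambda>n. p (gsub G f (X n) x)) \<longlonglongrightarrow> 0))"

definition class_O0 :: "'a set \<Rightarrow> ('a \<Rightarrow> 'a \<Rightarrow> 'a) \<Rightarrow> ('a \<Rightarrow> real) \<Rightarrow> bool" where
  "class_O0 G f p \<longleftrightarrow> (\<forall>a\<in>G. (\<lambda>n. p (gmult G f n a) / real n) \<longlonglongrightarrow> 0)"

definition frakG :: "ereal \<Rightarrow> nat \<Rightarrow> 'a set \<Rightarrow> ('a \<Rightarrow> 'a \<Rightarrow> 'a) \<Rightarrow> ('a \<Rightarrow> real) \<Rightarrow> bool" where
  "frakG r N G f p \<longleftrightarrow>
     valued_grp G f p \<and> vg_separable G f p \<and> class_O0 G f p \<and>
     (\<forall>x\<in>G. ereal (p x) \<le> r) \<and> (N \<noteq> 0 \<longrightarrow> has_exponent G f N)"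

text \<open>Property (G2).  Finite valued groups H are taken with carriers inside nat
  (every finite group is isomorphic to one of these).\<close>
definition prop_G2 :: "ereal \<Rightarrow> nat \<Rightarrow> 'a set \<Rightarrow> ('a \<Rightarrow> 'a \<Rightarrow> 'a) \<Rightarrow> ('a \<Rightarrow> real) \<Rightarrow> bool" where
  "prop_G2 r N U a p \<longleftrightarrow>
     (\<forall>(H::nat set) h q K \<phi> \<epsilon>.
        finite H \<and> valued_grp H h q \<and> (N \<noteq> 0 \<longrightarrow> has_exponent H h N) \<and>
        (\<forall>x\<in>H. ereal (q x) \<le> r) \<and> subgrp K H h \<and>
        grp_hom K h U a \<phi> \<and> (\<forall>x\<in>K. p (\<phi> x) = q x) \<and> 0 < \<epsilon> \<and> \<epsilon> < 1
        \<longrightarrow> (\<exists>\<psi>. grp_hom H h U a \<psi> \<and>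
                 (\<forall>x\<in>K. p (gsub U a (\<phi> x) (\<psi> x)) \<le> \<epsilon>) \<and>
                 (\<forall>x\<in>H. (1 - \<epsilon>) * q x \<le> p (\<psi> x) \<and> p (\<psi> x) \<le> (1 + \<epsilon>) * q x)))"

definition prop_G3 :: "nat \<Rightarrow> 'a set \<Rightarrow> ('a \<Rightarrow> 'a \<Rightarrow> 'a) \<Rightarrow> ('a \<Rightarrow> real) \<Rightarrow> bool" where
  "prop_G3 N U a p \<longleftrightarrow>
     (N = 0 \<longrightarrow> (\<forall>x\<in>U. \<forall>\<epsilon>>0. \<exists>y\<in>U. (\<exists>n>0. gmult U a n y = gzero U a) \<and> p (gsub U a x y) < \<epsilon>))"

text \<open>(U, a, p) satisfies (G1)-(G3), i.e. is (an isometric copy of) the group G_r(N).\<close>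
definition is_GrN :: "ereal \<Rightarrow> nat \<Rightarrow> 'a set \<Rightarrow> ('a \<Rightarrow> 'a \<Rightarrow> 'a) \<Rightarrow> ('a \<Rightarrow> real) \<Rightarrow> bool" where
  "is_GrN r N U a p \<longleftrightarrow>
     vg_complete U a p \<and> frakG r N U a p \<and> prop_G2 r N U a p \<and> prop_G3 N U a p"

definition pvg :: "'a set \<Rightarrow> ('a \<Rightarrow> 'a \<Rightarrow> 'a) \<Rightarrow> (real \<Rightarrow> 'a \<Rightarrow> 'a) \<Rightarrow> bool" where
  "pvg G f act \<longleftrightarrow>
     ab_grp G f \<and>
     (\<forall>t\<ge>0. \<forall>x\<in>G. act t x \<in> G) \<and>
     (\<forall>x\<in>G. act 0 x = gzero G f) \<and>
     (\<forall>x\<in>G. act 1 x = x) \<and>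
     (\<forall>s\<ge>0. \<forall>t\<ge>0. \<forall>x\<in>G. act (s * t) x = act s (act t x)) \<and>
     (\<forall>t\<ge>0. \<forall>x\<in>G. \<forall>y\<in>G. act t (f x y) = f (act t x) (act t y))"

definition is_pv_norm :: "'a set \<Rightarrow> (real \<Rightarrow> 'a \<Rightarrow> 'a) \<Rightarrow> ('a \<Rightarrow> real) \<Rightarrow> bool" where
  "is_pv_norm G act n \<longleftrightarrow> (\<forall>t\<ge>0. \<forall>x\<in>G. n (act t x) = t * n x)"

definition is_pv_subnorm :: "'a set \<Rightarrow> (real \<Rightarrow> 'a \<Rightarrow> 'a) \<Rightarrow> ('a \<Rightarrow> real) \<Rightarrow> bool" where
  "is_pv_subnorm G act n \<longleftrightarrow> (\<forall>s\<ge>1. \<forall>x\<in>G. n x \<le> n (act s x) \<and> n (act s x) \<le> s * n x)"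

definition act_continuous :: "'a set \<Rightarrow> ('a \<Rightarrow> 'a \<Rightarrow> 'a) \<Rightarrow> (real \<Rightarrow> 'a \<Rightarrow> 'a) \<Rightarrow> ('a \<Rightarrow> real) \<Rightarrow> bool" where
  "act_continuous G f act n \<longleftrightarrow>
     (\<forall>t\<ge>0. \<forall>x\<in>G. \<forall>\<epsilon>>0. \<exists>\<delta>>0. \<forall>s\<ge>0. \<forall>y\<in>G.
        \<bar>s - t\<bar> < \<delta> \<and> n (gsub G f y x) < \<delta> \<longrightarrow> n (gsub G f (act s y) (act t x)) < \<epsilon>)"

definition top_pvg :: "bool \<Rightarrow> 'a set \<Rightarrow> ('a \<Rightarrow> 'a \<Rightarrow> 'a) \<Rightarrow> (real \<Rightarrow> 'a \<Rightarrow> 'a) \<Rightarrow> ('a \<Rightarrow> real) \<Rightarrow> bool" where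
  "top_pvg sub G f act n \<longleftrightarrow>
     pvg G f act \<and> is_value G f n \<and>
     (if sub then is_pv_subnorm G act n else is_pv_norm G act n) \<and>
     act_continuous G f act n"

end

theory Submission
  imports Defs "HOL-Algebra.Free_Abelian_Groups" "HOL-Library.Function_Algebras" "HOL-Analysis.Abstract_Topology_2"
begin

text \<open>
  The group \<open>G\<close> is enlarged by countably many rounds of one-step extensions and then completed.
  A round adjoins the pseudovector group freely generated by a group \<open>H\<close>, amalgamated with what is
  already there along a subgroup on which a homomorphism is prescribed. The naive amalgam has a
  discontinuous action, since the translates \<open>t * h\<close> of a free generator are far apart. It is
  therefore averaged: for \<open>v \<in> [0, 1)\<close> the multiplicative time of each translate is rounded down to the
  grid \<open>exp ((j - v) a)\<close>, \<open>j\<close> an integer, the amalgam seminorm is evaluated there, and an upper mean over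
  \<open>v\<close> is taken. Moving a translate a little changes its rounding only for a small proportion of the \<open>v\<close>, so the
  action becomes continuous, while the seminorm on the old group is unchanged and the one on \<open>H\<close> is
  distorted by a factor at most \<open>exp a\<close>. A separable completion can be reached because each instance of
  (G2) and (G3) in the completion follows from finitely many rational inequalities about the new
  generators; there are only countably many such tasks, and every round adopts the next one if some
  extension satisfies it. That an extension does satisfy it is seen by amalgamating over the
  completion of the whole tower. For the density of torsion elements, class \<open>\<O>\<^sub>0\<close> provides \<open>k\<close> with
  \<open>k x\<close> of norm at most \<open>\<epsilon> k\<close>, which allows an element of order \<open>k\<close> at distance about \<open>\<epsilon>\<close> from \<open>x\<close>.
\<close>

text \<open>Groups are handled as seminormed free groups: an equation is imposed by giving a
  difference seminorm 0, and null classes are identified only once, after the completion. So the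
  tower can live in one group fixed from the start, and a round changes nothing but the seminorm.
  Scalars are written as exp of a real time. This makes positive scalars a flow of invertible maps
  and turns continuity at the scalar 0 into decay at time -infinity. Times are rounded down so that
  the grid time of a generator never exceeds its own time; upper bounds on prices then survive
  rounding, and for the generator at time 0 the way back from the grid costs at most exp a, also for
  subnorms. The mesh \<open>a\<close> is chosen anew for each task. The prescribed images in (G2)
  lie in the completion, whereas tasks must be drawn from a countable supply; points of a countable
  dense set and rational slack bridge this gap. A separable group has at most continuum many
  elements, so one copy of the reals beside the copy of \<open>G\<close> is enough for the carrier.
  The case r = 1 concerns subnorms only, since a nonzero norm is unbounded.\<close>

abbreviation lk :: "('k \<Rightarrow>\<^sub>0 'x::zero) \<Rightarrow> 'k \<Rightarrow> 'x" where "lk \<equiv> Poly_Mapping.lookup"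
abbreviation sg :: "'k \<Rightarrow> 'x \<Rightarrow> 'k \<Rightarrow>\<^sub>0 'x::zero" where "sg \<equiv> Poly_Mapping.single"
abbreviation ks :: "('k \<Rightarrow>\<^sub>0 'x::zero) \<Rightarrow> 'k set" where "ks \<equiv> Poly_Mapping.keys"

section \<open>Seminorms and flows on Abelian groups\<close>

primrec mul :: "nat \<Rightarrow> 'b::ab_group_add \<Rightarrow> 'b" where
  "mul 0 x = 0"
| "mul (Suc n) x = x + mul n x"

lemma additive_mul: "additive (mul n)"
proof
  show "mul n (x + y) = mul n x + mul n y" for x y :: 'a
    by (induction n) (simp_all add: algebra_simps)
qed

lemma mul_additive: "additive F \<Longrightarrow> F (mul n x) = mul n (F x)"
  by (induction n) (simp_all add: additive.zero additive.add)

lemma mul_mul: "mul m (mul n x) = mul (m * n) x"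
proof -
  have "mul (m + n) x = mul m x + mul n x" for m n
    by (induction m) (simp_all add: algebra_simps)
  then show ?thesis
    by (induction m) simp_all
qed

lemma mul_add_left: "mul (m + n) x = mul m x + mul n x"
  by (induction m) (simp_all add: algebra_simps)

text \<open>Time is additive: \<open>V s\<close> is the action of the scalar \<open>exp s\<close>.\<close>

definition flow :: "(real \<Rightarrow> 'b::ab_group_add \<Rightarrow> 'b) \<Rightarrow> bool" where
  "flow V \<longleftrightarrow> (\<forall>s. additive (V s)) \<and> (\<forall>x. V 0 x = x) \<and> (\<forall>s t x. V (s + t) x = V s (V t x))"

lemma flowD:
  assumes "flow V"
  shows "additive (V s)" "V 0 x = x" "V (s + t) x = V s (V t x)" "V s (x + y) = V s x + V s y"
    "V s 0 = 0" "V s (- x) = - V s x" "V s (x - y) = V s x - V s y"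
proof -
  show *: "additive (V s)" for s
    using assms by (auto simp: flow_def)
  show "V 0 x = x" "V (s + t) x = V s (V t x)"
    using assms by (auto simp: flow_def)
  show "V s (x + y) = V s x + V s y" "V s 0 = 0" "V s (- x) = - V s x" "V s (x - y) = V s x - V s y"
    using * by (auto simp: additive.add additive.zero additive.minus additive.diff)
qed

text \<open>Vanishing on nonzero elements is allowed, because relations are imposed by seminorm 0.
  The set \<open>B\<close> is explicit because Cauchy sequences form only a subset of their function
  type. On a subgroup nonnegativity follows from 0 = p 0 <= p x + p (- x).\<close>

definition seminorm_on :: "'b::ab_group_add set \<Rightarrow> ('b \<Rightarrow> real) \<Rightarrow> bool" where
  "seminorm_on B p \<longleftrightarrow>
     p 0 = 0 \<and> (\<forall>x\<in>B. p (- x) = p x) \<and> (\<forall>x\<in>B. \<forall>y\<in>B. p (x + y) \<le> p x + p y)"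

definition flow_subgroup :: "(real \<Rightarrow> 'b::ab_group_add \<Rightarrow> 'b) \<Rightarrow> 'b set \<Rightarrow> bool" where
  "flow_subgroup V B \<longleftrightarrow>
     0 \<in> B \<and> (\<forall>x\<in>B. - x \<in> B) \<and> (\<forall>x\<in>B. \<forall>y\<in>B. x + y \<in> B) \<and> (\<forall>s. \<forall>x\<in>B. V s x \<in> B)"

lemma flow_subgroupD:
  assumes "flow_subgroup V B"
  shows "0 \<in> B" "x \<in> B \<Longrightarrow> - x \<in> B" "x \<in> B \<Longrightarrow> y \<in> B \<Longrightarrow> x + y \<in> B"
    "x \<in> B \<Longrightarrow> y \<in> B \<Longrightarrow> x - y \<in> B" "x \<in> B \<Longrightarrow> V s x \<in> B" "x \<in> B \<Longrightarrow> mul n x \<in> B"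
proof -
  show "x \<in> B \<Longrightarrow> y \<in> B \<Longrightarrow> x - y \<in> B"
    using assms unfolding flow_subgroup_def by (metis add_uminus_conv_diff)
  show "x \<in> B \<Longrightarrow> mul n x \<in> B"
    using assms unfolding flow_subgroup_def by (induction n) auto
qed (use assms in \<open>auto simp: flow_subgroup_def\<close>)

lemma flow_subgroup_UNIV [simp]: "flow_subgroup V UNIV"
  by (simp add: flow_subgroup_def)

lemma seminorm_onD:
  assumes "seminorm_on B p" "flow_subgroup V B"
  shows "p 0 = 0" "x \<in> B \<Longrightarrow> p (- x) = p x" "x \<in> B \<Longrightarrow> y \<in> B \<Longrightarrow> p (x + y) \<le> p x + p y"
    "x \<in> B \<Longrightarrow> y \<in> B \<Longrightarrow> p (x - y) \<le> p x + p y" "x \<in> B \<Longrightarrow> 0 \<le> p x"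
    "x \<in> B \<Longrightarrow> y \<in> B \<Longrightarrow> p (x - y) = p (y - x)"
    "x \<in> B \<Longrightarrow> y \<in> B \<Longrightarrow> p x \<le> p y + p (x - y)"
    "x \<in> B \<Longrightarrow> y \<in> B \<Longrightarrow> \<bar>p x - p y\<bar> \<le> p (x - y)"
    "x \<in> B \<Longrightarrow> y \<in> B \<Longrightarrow> z \<in> B \<Longrightarrow> p (x - z) \<le> p (x - y) + p (y - z)"
proof -
  note B = flow_subgroupD[OF assms(2)]
  show 0: "p 0 = 0" and neg: "\<And>x. x \<in> B \<Longrightarrow> p (- x) = p x"
    and tri: "\<And>x y. x \<in> B \<Longrightarrow> y \<in> B \<Longrightarrow> p (x + y) \<le> p x + p y"
    using assms by (auto simp: seminorm_on_def)
  show "x \<in> B \<Longrightarrow> y \<in> B \<Longrightarrow> p (x - y) \<le> p x + p y"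
    using tri[of x "- y"] neg[of y] B(2)[of y] by simp
  show "x \<in> B \<Longrightarrow> 0 \<le> p x"
    using tri[of x "- x"] neg[of x] B(2)[of x] 0 by simp
  show sym: "x \<in> B \<Longrightarrow> y \<in> B \<Longrightarrow> p (x - y) = p (y - x)" for x y
    using neg[of "x - y"] B(4)[of x y] by simp
  show le: "x \<in> B \<Longrightarrow> y \<in> B \<Longrightarrow> p x \<le> p y + p (x - y)" for x y
    using tri[of y "x - y"] B(4)[of x y] by simp
  show "x \<in> B \<Longrightarrow> y \<in> B \<Longrightarrow> \<bar>p x - p y\<bar> \<le> p (x - y)"
    using le[of x y] le[of y x] sym[of x y] by simp
  show "x \<in> B \<Longrightarrow> y \<in> B \<Longrightarrow> z \<in> B \<Longrightarrow> p (x - z) \<le> p (x - y) + p (y - z)"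
    using tri[of "x - y" "y - z"] B(4) by simp
qed

lemma seminorm_sum_le:
  assumes "seminorm_on UNIV p"
  shows "p (sum g A) \<le> (\<Sum>i\<in>A. p (g i))"
proof (induction A rule: infinite_finite_induct)
  case (insert x F)
  then show ?case
    using seminorm_onD(3)[OF assms flow_subgroup_UNIV, of "g x" "sum g F"] by simp
qed (use assms in \<open>auto simp: seminorm_on_def\<close>)

lemma seminorm_mul_le:
  assumes "seminorm_on B p" "flow_subgroup V B" "x \<in> B"
  shows "p (mul n x) \<le> real n * p x"
proof (induction n)
  case (Suc n)
  then show ?case
    using seminorm_onD(3)[OF assms(1,2), of x "mul n x"] flow_subgroupD(6)[OF assms(2,3)] assms(3)
    by (simp add: algebra_simps)
qed (use seminorm_onD(1)[OF assms(1,2)] in simp)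

section \<open>Admissible seminorms\<close>

text \<open>\<open>sub\<close> selects subnorms instead of norms, and \<open>cap\<close> stands for
  r = 1. \<open>cap_sub\<close> reflects that a nonzero norm is unbounded along the action and so
  cannot stay below a constant.\<close>

locale value_class =
  fixes sub cap :: bool and N :: nat
  assumes cap_sub: "cap \<Longrightarrow> sub"
begin

text \<open>The Lipschitz constant of the scalar exp s. For a norm it is attained; a subnorm does
  not increase under scalars below 1, whence the maximum. Used at s and at - s, this single bound
  gives back all defining (in)equalities of a norm or subnorm.\<close>

definition scale :: "real \<Rightarrow> real" where
  "scale s = (if sub then max 1 (exp s) else exp s)"

lemma scale_pos: "0 < scale s"
  by (simp add: scale_def less_max_iff_disj)

lemma scale_0 [simp]: "scale 0 = 1"
  by (simp add: scale_def)

lemma exp_le_scale: "exp s \<le> scale s"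
  by (simp add: scale_def)

lemma scale_le_1: "s \<le> 0 \<Longrightarrow> scale s \<le> 1"
  by (simp add: scale_def)

lemma scale_mono: "s \<le> t \<Longrightarrow> scale s \<le> scale t"
  by (auto simp: scale_def max_def)

lemma scale_ge_1: "cap \<Longrightarrow> 1 \<le> scale s"
  unfolding scale_def by (simp add: cap_sub)

lemma scale_inverse: "s \<le> 0 \<Longrightarrow> scale (- s) = exp (- s)"
  by (simp add: scale_def)

text \<open>Both limits along the flow are continuity statements: times near 0 give continuity at
  positive scalars, times near -infinity give continuity at the scalar 0. Pointwise limits suffice
  because the \<open>scale\<close> bound makes the flow locally equicontinuous.\<close>

definition good :: "(real \<Rightarrow> 'b::ab_group_add \<Rightarrow> 'b) \<Rightarrow> 'b set \<Rightarrow> ('b \<Rightarrow> real) \<Rightarrow> bool" where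
  "good V B p \<longleftrightarrow> seminorm_on B p \<and>
     (\<forall>s. \<forall>x\<in>B. p (V s x) \<le> scale s * p x) \<and>
     (\<forall>x\<in>B. ((\<lambda>s. p (V s x - x)) \<longlongrightarrow> 0) (at 0)) \<and>
     (\<forall>x\<in>B. ((\<lambda>s. p (V s x)) \<longlongrightarrow> 0) at_bot) \<and>
     (\<forall>x\<in>B. (\<lambda>n. p (mul n x) / real n) \<longlonglongrightarrow> 0) \<and>
     (N \<noteq> 0 \<longrightarrow> (\<forall>x\<in>B. p (mul N x) = 0)) \<and>
     (cap \<longrightarrow> (\<forall>x\<in>B. p x \<le> 1))"

lemma goodD:
  assumes "good V B p"
  shows "seminorm_on B p" "x \<in> B \<Longrightarrow> p (V s x) \<le> scale s * p x"
    "x \<in> B \<Longrightarrow> ((\<lambda>s. p (V s x - x)) \<longlongrightarrow> 0) (at 0)"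
    "x \<in> B \<Longrightarrow> ((\<lambda>s. p (V s x)) \<longlongrightarrow> 0) at_bot"
    "x \<in> B \<Longrightarrow> (\<lambda>n. p (mul n x) / real n) \<longlonglongrightarrow> 0"
    "N \<noteq> 0 \<Longrightarrow> x \<in> B \<Longrightarrow> p (mul N x) = 0"
    "cap \<Longrightarrow> x \<in> B \<Longrightarrow> p x \<le> 1"
  using assms unfolding good_def by auto

lemma good_pullback:
  assumes p: "good W B p" and g: "additive g" "\<And>x. g x \<in> B" "\<And>s x. g (V s x) = W s (g x)"
  shows "good V UNIV (\<lambda>x. p (g x))"
  using p g(2) unfolding good_def seminorm_on_def
  by (auto simp: g(3) additive.zero[OF g(1)] additive.minus[OF g(1)] additive.add[OF g(1)]
      additive.diff[OF g(1)] mul_additive[OF g(1)])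

end

section \<open>An upper mean\<close>

text \<open>Averages over n equidistant points of a unit interval, bounded for all large n and
  uniformly in the starting point \<open>s\<close>. The uniformity makes the upper mean translation
  invariant, and sampling avoids any question of measurability for functions of \<open>v\<close>
  that are infima over a whole group.\<close>

definition mean_bound :: "(real \<Rightarrow> real) \<Rightarrow> real \<Rightarrow> bool" where
  "mean_bound f C \<longleftrightarrow> (\<exists>N. \<forall>n\<ge>N. \<forall>s. (\<Sum>i<n. f (s + real i / real n)) \<le> real n * C)"

definition mean :: "(real \<Rightarrow> real) \<Rightarrow> real" where
  "mean f = Inf {C. mean_bound f C}"

definition bdd_fun :: "(real \<Rightarrow> real) \<Rightarrow> bool" where
  "bdd_fun f \<longleftrightarrow> (\<forall>v. 0 \<le> f v) \<and> (\<exists>C. \<forall>v. f v \<le> C)"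

lemma mean_bound_const: "(\<And>v. f v \<le> C) \<Longrightarrow> mean_bound f C"
  unfolding mean_bound_def
  by (metis (no_types, lifting) card_lessThan sum_bounded_above)

lemma mean_bound_ge:
  assumes "\<And>v. c \<le> f v" "mean_bound f C"
  shows "c \<le> C"
proof -
  obtain N where N: "\<And>n s. n \<ge> N \<Longrightarrow> (\<Sum>i<n. f (s + real i / real n)) \<le> real n * C"
    using assms(2) by (auto simp: mean_bound_def)
  have "real (Suc N) * c \<le> (\<Sum>i<Suc N. f (0 + real i / real (Suc N)))"
    using sum_bounded_below[of "{..<Suc N}" c "\<lambda>i. f (0 + real i / real (Suc N))"] assms(1) by simp
  also have "\<dots> \<le> real (Suc N) * C"
    by (rule N) simp
  finally show ?thesis
    by (simp del: of_nat_Suc)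
qed

lemma mean_le:
  assumes "\<And>v. 0 \<le> f v" "mean_bound f C"
  shows "mean f \<le> C"
  unfolding mean_def
proof (rule cInf_lower)
  show "bdd_below {C. mean_bound f C}"
    using mean_bound_ge[OF assms(1)] by (intro bdd_belowI[of _ 0]) auto
qed (use assms in auto)

lemma mean_le_const: "(\<And>v. 0 \<le> f v) \<Longrightarrow> (\<And>v. f v \<le> C) \<Longrightarrow> mean f \<le> C"
  by (intro mean_le mean_bound_const)

lemma mean_ge:
  assumes "bdd_fun f" "\<And>v. c \<le> f v"
  shows "c \<le> mean f"
  unfolding mean_def
proof (rule cInf_greatest)
  show "{C. mean_bound f C} \<noteq> {}"
    using assms(1) mean_bound_const by (auto simp: bdd_fun_def)
qed (use mean_bound_ge[OF assms(2)] in auto)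

lemma mean_approx:
  assumes "bdd_fun f" "0 < e"
  obtains C where "mean_bound f C" "C < mean f + e"
proof -
  have "\<exists>C\<in>{C. mean_bound f C}. C < mean f + e"
    unfolding mean_def
  proof (rule cInf_lessD)
    show "{C. mean_bound f C} \<noteq> {}"
      using assms(1) mean_bound_const by (auto simp: bdd_fun_def)
  qed (use assms in auto)
  then show ?thesis
    using that by auto
qed

lemma mean_add_le:
  assumes f: "bdd_fun f" and g: "bdd_fun g" and h: "\<And>v. 0 \<le> h v" "\<And>v. h v \<le> f v + g v"
  shows "mean h \<le> mean f + mean g"
proof (rule field_le_epsilon)
  fix e :: real
  assume "e > 0"
  then obtain C D where C: "mean_bound f C" "C < mean f + e / 2" and D: "mean_bound g D" "D < mean g + e / 2"
    using mean_approx[OF f, of "e/2"] mean_approx[OF g, of "e/2"] by (metis half_gt_zero)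
  obtain N M where N: "\<And>n s. n \<ge> N \<Longrightarrow> (\<Sum>i<n. f (s + real i / real n)) \<le> real n * C"
    and M: "\<And>n s. n \<ge> M \<Longrightarrow> (\<Sum>i<n. g (s + real i / real n)) \<le> real n * D"
    using C(1) D(1) unfolding mean_bound_def by metis
  have "(\<Sum>i<n. h (s + real i / real n)) \<le> real n * (C + D)" if "n \<ge> max N M" for n s
  proof -
    have "(\<Sum>i<n. h (s + real i / real n)) \<le> (\<Sum>i<n. f (s + real i / real n) + g (s + real i / real n))"
      by (intro sum_mono h)
    then show ?thesis
      using N[of n s] M[of n s] that by (simp add: sum.distrib algebra_simps)
  qed
  then have "mean h \<le> C + D"
    unfolding mean_bound_def by (intro mean_le h) (metis mean_bound_def)
  then show "mean h \<le> mean f + mean g + e"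
    using C D by simp
qed

text \<open>A mean bound for \<open>f\<close> is valid from every starting point, hence also from
  \<open>s + d\<close>. The shift is what the flow does to the grid offset, the factor what it does
  to the seminorm.\<close>

lemma mean_scale_le:
  assumes f: "bdd_fun f" and h: "\<And>v. 0 \<le> h v" "\<And>v. h v \<le> k * f (v + d)" and k: "0 < k"
  shows "mean h \<le> k * mean f"
proof -
  have "mean h / k \<le> mean f"
  proof (rule field_le_epsilon)
    fix e :: real
    assume "e > 0"
    then obtain C where C: "mean_bound f C" "C < mean f + e"
      using mean_approx[OF f] by metis
    obtain N where N: "\<And>n s. n \<ge> N \<Longrightarrow> (\<Sum>i<n. f (s + real i / real n)) \<le> real n * C"
      using C(1) by (auto simp: mean_bound_def)
    have "(\<Sum>i<n. h (s + real i / real n)) \<le> real n * (k * C)" if "n \<ge> N" for n s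
    proof -
      have "(\<Sum>i<n. h (s + real i / real n)) \<le> (\<Sum>i<n. k * f (s + real i / real n + d))"
        by (intro sum_mono h)
      also have "\<dots> = k * (\<Sum>i<n. f ((s + d) + real i / real n))"
        by (simp add: sum_distrib_left algebra_simps)
      also have "\<dots> \<le> k * (real n * C)"
        using N[OF that] k by (intro mult_left_mono) auto
      finally show ?thesis
        by (simp add: algebra_simps)
    qed
    then have "mean h \<le> k * C"
      by (intro mean_le h) (auto simp: mean_bound_def)
    then have "mean h / k \<le> C"
      using k by (simp add: field_simps)
    then show "mean h / k \<le> mean f + e"
      using C by simp
  qed
  then show ?thesis
    using k by (simp add: field_simps)
qed

text \<open>Moving the samples by one step drops one floor and appends the floor a full unit later,
  which is larger by exactly 1.\<close>

lemma sum_floor_shift: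
  assumes "n > 0"
  shows "(\<Sum>i<n. \<lfloor>y + real (i + k) / real n\<rfloor>) = (\<Sum>i<n. \<lfloor>y + real i / real n\<rfloor>) + int k"
proof (induction k)
  case (Suc k)
  have "(\<Sum>i<n. \<lfloor>y + real (i + Suc k) / real n\<rfloor>) + \<lfloor>y + real k / real n\<rfloor>
      = (\<Sum>i<Suc n. \<lfloor>y + real (i + k) / real n\<rfloor>)"
    by (simp only: sum.lessThan_Suc_shift) simp
  also have "\<dots> = (\<Sum>i<n. \<lfloor>y + real (i + k) / real n\<rfloor>) + \<lfloor>y + real (n + k) / real n\<rfloor>"
    by simp
  also have "y + real (n + k) / real n = (y + real k / real n) + 1"
    using assms by (simp add: field_simps)
  finally show ?case
    using Suc by simp
qed simp

text \<open>The integer \<open>\<lfloor>y + v\<rfloor>\<close> jumps once per unit of \<open>v\<close>, so a translation by \<open>s\<close> is noticed with density \<open>s\<close>.\<close>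

lemma mean_jump_le:
  assumes s: "0 \<le> s" and C: "0 \<le> C" and f: "\<And>v. 0 \<le> f v"
    "\<And>v. f v \<le> C * real_of_int (\<lfloor>y + s + v\<rfloor> - \<lfloor>y + v\<rfloor>)"
  shows "mean f \<le> C * s"
proof -
  have "mean f \<le> C * (s + e)" if e: "e > 0" for e
  proof (rule mean_le[OF f(1)])
    obtain N where N: "real N > 1 / e"
      using reals_Archimedean2 by blast
    have "(\<Sum>i<n. f (t + real i / real n)) \<le> real n * (C * (s + e))" if n: "n \<ge> max 1 N" for n t
    proof -
      \<comment> \<open>Rounding \<open>s\<close> up to k / n turns the translation into one by
        whole sample steps; the excess 1 / n is at most \<open>e\<close> by the choice of
        \<open>N\<close>.\<close>
      define k where "k = nat \<lceil>real n * s\<rceil>"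
      have n0: "n > 0" "real n > 0"
        using n by auto
      have k: "real n * s \<le> real k" "real k \<le> real n * s + 1"
        unfolding k_def using s by (auto simp: real_nat_ceiling_ge of_nat_nat of_int_ceiling_le_add_one)
      have "(\<Sum>i<n. \<lfloor>y + s + (t + real i / real n)\<rfloor>) \<le> (\<Sum>i<n. \<lfloor>(y + t) + real (i + k) / real n\<rfloor>)"
        using k n0 by (intro sum_mono floor_mono) (auto simp: field_simps)
      also have "\<dots> = (\<Sum>i<n. \<lfloor>y + (t + real i / real n)\<rfloor>) + int k"
        by (subst sum_floor_shift) (use n0 in \<open>auto simp: algebra_simps\<close>)
      finally have *: "(\<Sum>i<n. \<lfloor>y + s + (t + real i / real n)\<rfloor> - \<lfloor>y + (t + real i / real n)\<rfloor>) \<le> int k"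
        by (simp add: sum_subtractf)
      have "(\<Sum>i<n. f (t + real i / real n))
          \<le> (\<Sum>i<n. C * real_of_int (\<lfloor>y + s + (t + real i / real n)\<rfloor> - \<lfloor>y + (t + real i / real n)\<rfloor>))"
        by (intro sum_mono f)
      also have "\<dots> = C * real_of_int (\<Sum>i<n. \<lfloor>y + s + (t + real i / real n)\<rfloor> - \<lfloor>y + (t + real i / real n)\<rfloor>)"
        by (simp add: sum_distrib_left)
      also have "\<dots> \<le> C * real k"
        using * C by (intro mult_left_mono) (auto simp flip: of_int_of_nat_eq simp only: of_int_le_iff)
      also have "\<dots> \<le> C * (real n * (s + e))"
      proof (intro mult_left_mono C)
        have "1 \<le> real n * e"
          using N n e by (simp add: field_simps) (smt (verit) mult_left_mono of_nat_le_iff)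
        then show "real k \<le> real n * (s + e)"
          using k by (simp add: algebra_simps)
      qed
      finally show ?thesis
        by (simp add: algebra_simps)
    qed
    then show "mean_bound f (C * (s + e))"
      unfolding mean_bound_def by blast
  qed
  then have "mean f \<le> C * s + e" if e: "e > 0" for e
    using that C
  proof -
    \<comment> \<open>Dividing by \<open>C + 1\<close> rather than \<open>C\<close> covers C =
      0.\<close>
    have "mean f \<le> C * (s + e / (C + 1))"
      using C e \<open>\<And>e. 0 < e \<Longrightarrow> mean f \<le> C * (s + e)\<close> by simp
    also have "\<dots> \<le> C * s + e"
      using C e by (simp add: field_simps)
    finally show ?thesis .
  qed
  then show ?thesis
    by (rule field_le_epsilon)
qed

section \<open>Finitely supported families\<close>

definition pm_sum :: "('k \<Rightarrow> 'x::zero \<Rightarrow> 'y::comm_monoid_add) \<Rightarrow> ('k \<Rightarrow>\<^sub>0 'x) \<Rightarrow> 'y" where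
  "pm_sum f z = (\<Sum>j\<in>ks z. f j (lk z j))"

lemma pm_sum_superset:
  assumes "finite A" "ks z \<subseteq> A" "\<And>j. f j 0 = 0"
  shows "pm_sum f z = (\<Sum>j\<in>A. f j (lk z j))"
  unfolding pm_sum_def
  by (rule sum.mono_neutral_left) (use assms in \<open>auto simp: in_keys_iff\<close>)

lemma pm_sum_single [simp]: "(\<And>j. f j 0 = 0) \<Longrightarrow> pm_sum f (sg j x) = f j x"
  by (subst pm_sum_superset[of "{j}"]) auto

lemma additive_pm_sum:
  fixes f :: "'k \<Rightarrow> 'x::ab_group_add \<Rightarrow> 'y::ab_group_add"
  assumes f: "\<And>j. additive (f j)"
  shows "additive (pm_sum f)"
proof
  fix x y :: "'k \<Rightarrow>\<^sub>0 'x"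
  have 0: "f j 0 = 0" for j
    using additive.zero[OF f] .
  have *: "finite (ks x \<union> ks y)" "ks (x + y) \<subseteq> ks x \<union> ks y" "ks x \<subseteq> ks x \<union> ks y" "ks y \<subseteq> ks x \<union> ks y"
    by (simp_all add: Poly_Mapping.keys_add)
  show "pm_sum f (x + y) = pm_sum f x + pm_sum f y"
    by (simp add: pm_sum_superset[where f = f, OF *(1) *(2) 0] pm_sum_superset[where f = f, OF *(1) *(3) 0]
        pm_sum_superset[where f = f, OF *(1) *(4) 0] lookup_add additive.add[OF f] sum.distrib)
qed

lemma pm_eq_sum_single: "z = (\<Sum>j\<in>ks z. sg j (lk z j))"
proof (rule poly_mapping_eqI)
  fix k
  have "(\<Sum>j\<in>ks z. lk (sg j (lk z j)) k) = (\<Sum>j\<in>ks z. if j = k then lk z k else 0)"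
    by (intro sum.cong) (auto simp: lookup_single when_def)
  then show "lk z k = lk (\<Sum>j\<in>ks z. sg j (lk z j)) k"
    by (simp add: lookup_sum in_keys_iff)
qed

lemma pm_additive_eqI:
  fixes F H :: "('k \<Rightarrow>\<^sub>0 'x::ab_group_add) \<Rightarrow> 'y::ab_group_add"
  assumes "additive F" "additive H" "\<And>j x. F (sg j x) = H (sg j x)"
  shows "F z = H z"
  using assms(3)
  by (subst (1 2) pm_eq_sum_single) (simp add: additive.sum[OF assms(1)] additive.sum[OF assms(2)])

definition shift :: "real \<Rightarrow> (real \<Rightarrow>\<^sub>0 'x::zero) \<Rightarrow> (real \<Rightarrow>\<^sub>0 'x)" where
  "shift s = Poly_Mapping.map_key (\<lambda>w. w - s)"

lemma lookup_shift [simp]: "lk (shift s y) w = lk y (w - s)"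
  unfolding shift_def by (subst Poly_Mapping.map_key.rep_eq) (auto simp: inj_on_def)

lemma shift_single [simp]: "shift s (sg w h) = sg (w + s) h"
  by (rule poly_mapping_eqI) (auto simp: lookup_single when_def)

lemma flow_shift: "flow (shift :: real \<Rightarrow> (real \<Rightarrow>\<^sub>0 'x::ab_group_add) \<Rightarrow> _)"
  unfolding flow_def additive_def
  by (auto intro!: poly_mapping_eqI simp: lookup_add algebra_simps)

definition pm_map :: "('x::zero \<Rightarrow> 'y::comm_monoid_add) \<Rightarrow> ('k \<Rightarrow>\<^sub>0 'x) \<Rightarrow> ('k \<Rightarrow>\<^sub>0 'y)" where
  "pm_map g = pm_sum (\<lambda>j x. sg j (g x))"

lemma additive_single: "additive (sg j :: 'x::ab_group_add \<Rightarrow> _)"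
  by standard (rule single_add)

lemma additive_comp: "additive f \<Longrightarrow> additive g \<Longrightarrow> additive (\<lambda>x. f (g x))"
  by (simp add: additive_def)

lemma additive_lookup: "additive (\<lambda>z. lk z j)"
  by standard (rule lookup_add)

lemma additive_pm_map: "additive g \<Longrightarrow> additive (pm_map g)"
  unfolding pm_map_def by (intro additive_pm_sum additive_comp[OF additive_single])

lemma pm_map_single: "g 0 = 0 \<Longrightarrow> pm_map g (sg j x) = sg j (g x)"
  unfolding pm_map_def by (rule pm_sum_single) simp

lemma lookup_pm_map: "additive g \<Longrightarrow> lk (pm_map g z) j = g (lk z j)"
  by (rule pm_additive_eqI[of "\<lambda>z. lk (pm_map g z) j" "\<lambda>z. g (lk z j)"])
    (auto intro!: additive_comp[OF additive_lookup] additive_comp[of g] additive_lookup additive_pm_map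
      simp: pm_map_single additive.zero lookup_single when_def)

section \<open>The smoothed amalgam\<close>

text \<open>The old group carries \<open>V\<close> and \<open>S\<close>, the new one is
  \<open>'h\<close> with \<open>Q\<close>. The amalgamated subgroup is the image of
  \<open>\<theta>\<close>, parametrised by \<open>'h\<close> itself: \<open>\<theta> w\<close> is to
  become \<open>\<psi> w\<close>. \<open>\<rho> \<tau>\<close> is the price per unit of
  \<open>Q\<close> of a translate by time \<open>\<tau>\<close>; by \<open>dom\<close>, replacing a
  translate by its prescribed image never costs more than this price, which protects the old
  seminorm. \<open>small\<close> is the source of class O_0 for the new generators.\<close>

locale amalgam = value_class +
  fixes V :: "real \<Rightarrow> 'c::ab_group_add \<Rightarrow> 'c" and S :: "'c \<Rightarrow> real"
    and Q :: "'h::ab_group_add \<Rightarrow> real" and \<theta> :: "'h \<Rightarrow> 'h" and \<psi> :: "'h \<Rightarrow> 'c"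
    and \<rho> :: "real \<Rightarrow> real" and a :: real
  assumes flow_V: "flow V" and good_S: "good V UNIV S" and Q: "seminorm_on UNIV Q"
    and \<theta>: "additive \<theta>" and \<psi>: "additive \<psi>" and a: "0 < a"
    and dom: "S (V \<tau> (\<psi> w)) \<le> \<rho> \<tau> * Q (\<theta> w)"
    and rho_exp: "exp \<tau> \<le> \<rho> \<tau>" and rho_scale: "\<rho> (s + \<tau>) \<le> scale s * \<rho> \<tau>"
    and rho_le_1: "\<tau> \<le> 0 \<Longrightarrow> \<rho> \<tau> \<le> 1" and rho_lim: "(\<rho> \<longlongrightarrow> 0) at_bot"
    and exponent: "N \<noteq> 0 \<Longrightarrow> Q (mul N h) = 0"
    and small: "0 < e \<Longrightarrow> \<forall>\<^sub>F n in sequentially. \<exists>w. S (\<psi> w) + Q (mul n h - \<theta> w) \<le> e * real n"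
begin

lemmas V = flowD[OF flow_V]
lemmas S = seminorm_onD[OF goodD(1)[OF good_S] flow_subgroup_UNIV, simplified]
lemmas QD = seminorm_onD[OF Q flow_subgroup_UNIV, simplified]

lemma rho_pos: "0 < \<rho> \<tau>"
  using rho_exp[of \<tau>] exp_gt_zero[of \<tau>] by linarith

definition lev :: "real \<Rightarrow> int \<Rightarrow> real" where
  "lev v j = (real_of_int j - v) * a"

definition Psi :: "real \<Rightarrow> (int \<Rightarrow>\<^sub>0 'h) \<Rightarrow> 'c" where
  "Psi v = pm_sum (\<lambda>j w. V (lev v j) (\<psi> w))"

definition cost :: "real \<Rightarrow> (int \<Rightarrow>\<^sub>0 'h) \<Rightarrow> real" where
  "cost v = pm_sum (\<lambda>j h. \<rho> (lev v j) * Q h)"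

text \<open>The quotient seminorm of \<open>S\<close> plus \<open>cost v\<close> on the direct sum,
  modulo the elements (\<open>- Psi v k\<close>, \<open>pm_map \<theta> k\<close>) that express the
  identification at all grid times.\<close>

definition amalg :: "real \<Rightarrow> 'c \<Rightarrow> (int \<Rightarrow>\<^sub>0 'h) \<Rightarrow> real" where
  "amalg v b z = (INF k. S (b + Psi v k) + cost v (z - pm_map \<theta> k))"

text \<open>Rounding to the grid: the index j = \<lfloor>w / a + v\<rfloor> has its time
  \<open>lev v j\<close> in the interval (w - a, w].\<close>

definition Phi :: "real \<Rightarrow> (real \<Rightarrow>\<^sub>0 'h) \<Rightarrow> (int \<Rightarrow>\<^sub>0 'h)" where
  "Phi v = pm_sum (\<lambda>w h. sg \<lfloor>w / a + v\<rfloor> h)"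

definition avg :: "'c \<Rightarrow> (real \<Rightarrow>\<^sub>0 'h) \<Rightarrow> real" where
  "avg b y = mean (\<lambda>v. amalg v b (Phi v y))"

lemma additive_Psi: "additive (Psi v)"
  unfolding Psi_def by (intro additive_pm_sum additive_comp[OF V(1) \<psi>])

lemma additive_Phi: "additive (Phi v)"
  unfolding Phi_def by (intro additive_pm_sum additive_single)

lemma Psi_single: "Psi v (sg j w) = V (lev v j) (\<psi> w)"
  unfolding Psi_def by (rule pm_sum_single) (simp add: additive.zero[OF \<psi>] V)

lemma Phi_single: "Phi v (sg w h) = sg \<lfloor>w / a + v\<rfloor> h"
  unfolding Phi_def by (rule pm_sum_single) simp

lemma cost_single: "cost v (sg j h) = \<rho> (lev v j) * Q h"
  unfolding cost_def by (rule pm_sum_single) (simp add: QD)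

lemma cost_superset: "finite A \<Longrightarrow> ks z \<subseteq> A \<Longrightarrow> cost v z = (\<Sum>j\<in>A. \<rho> (lev v j) * Q (lk z j))"
  unfolding cost_def by (rule pm_sum_superset) (auto simp: QD)

lemma seminorm_cost: "seminorm_on UNIV (cost v)"
  unfolding seminorm_on_def
proof (intro conjI ballI)
  show "cost v 0 = 0"
    by (simp add: cost_def pm_sum_def)
  fix x y :: "int \<Rightarrow>\<^sub>0 'h"
  show "cost v (- x) = cost v x"
    using cost_superset[of "ks x" x v] cost_superset[of "ks x" "- x" v] by (simp add: QD)
  have *: "finite (ks x \<union> ks y)" "ks (x + y) \<subseteq> ks x \<union> ks y" "ks x \<subseteq> ks x \<union> ks y" "ks y \<subseteq> ks x \<union> ks y"
    by (simp_all add: Poly_Mapping.keys_add)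
  have "\<rho> (lev v j) * Q (lk (x + y) j) \<le> \<rho> (lev v j) * Q (lk x j) + \<rho> (lev v j) * Q (lk y j)" for j
    using mult_left_mono[OF QD(3)[of "lk x j" "lk y j"], of "\<rho> (lev v j)"] rho_pos[of "lev v j"]
    by (simp add: lookup_add distrib_left)
  then show "cost v (x + y) \<le> cost v x + cost v y"
    by (simp add: cost_superset[OF *(1) *(2)] cost_superset[OF *(1) *(3)]
        cost_superset[OF *(1) *(4)] sum.distrib[symmetric] sum_mono)
qed

lemmas cost = seminorm_onD[OF seminorm_cost flow_subgroup_UNIV, simplified]

lemma amalg_le: "amalg v b z \<le> S (b + Psi v k) + cost v (z - pm_map \<theta> k)"
  unfolding amalg_def by (rule cINF_lower) (auto intro!: bdd_belowI[of _ 0] add_nonneg_nonneg S cost)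

lemma amalg_ge: "(\<And>k. c \<le> S (b + Psi v k) + cost v (z - pm_map \<theta> k)) \<Longrightarrow> c \<le> amalg v b z"
  unfolding amalg_def by (rule cINF_greatest) auto

lemma amalg_nonneg: "0 \<le> amalg v b z"
  by (intro amalg_ge add_nonneg_nonneg S cost)

lemma amalg_approx:
  assumes "0 < e"
  obtains k where "S (b + Psi v k) + cost v (z - pm_map \<theta> k) < amalg v b z + e"
proof -
  have "\<exists>x\<in>range (\<lambda>k. S (b + Psi v k) + cost v (z - pm_map \<theta> k)). x < amalg v b z + e"
    unfolding amalg_def by (rule cInf_lessD) (use assms in auto)
  then show ?thesis
    using that by auto
qed

lemma amalg_add_le: "amalg v (b + b') (z + z') \<le> amalg v b z + amalg v b' z'"
proof (rule field_le_epsilon)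
  fix e :: real
  assume "0 < e"
  obtain k where k: "S (b + Psi v k) + cost v (z - pm_map \<theta> k) < amalg v b z + e / 2"
    using amalg_approx \<open>0 < e\<close> half_gt_zero by metis
  obtain k' where k': "S (b' + Psi v k') + cost v (z' - pm_map \<theta> k') < amalg v b' z' + e / 2"
    using amalg_approx \<open>0 < e\<close> half_gt_zero by metis
  have "amalg v (b + b') (z + z') \<le> S ((b + b') + Psi v (k + k')) + cost v ((z + z') - pm_map \<theta> (k + k'))"
    by (rule amalg_le)
  also have "(b + b') + Psi v (k + k') = (b + Psi v k) + (b' + Psi v k')"
    by (simp add: additive.add[OF additive_Psi])
  also have "(z + z') - pm_map \<theta> (k + k') = (z - pm_map \<theta> k) + (z' - pm_map \<theta> k')"
    by (simp add: additive.add[OF additive_pm_map[OF \<theta>]])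
  finally show "amalg v (b + b') (z + z') \<le> amalg v b z + amalg v b' z' + e"
    using k k' S(3)[of "b + Psi v k" "b' + Psi v k'"] cost(3)[of v "z - pm_map \<theta> k" "z' - pm_map \<theta> k'"]
    by linarith
qed

lemma amalg_minus_le: "amalg v (- b) (- z) \<le> amalg v b z"
proof (rule amalg_ge)
  fix k
  have "amalg v (- b) (- z) \<le> S (- b + Psi v (- k)) + cost v (- z - pm_map \<theta> (- k))"
    by (rule amalg_le)
  also have "- b + Psi v (- k) = - (b + Psi v k)"
    by (simp add: additive.minus[OF additive_Psi])
  also have "- z - pm_map \<theta> (- k) = - (z - pm_map \<theta> k)"
    by (simp add: additive.minus[OF additive_pm_map[OF \<theta>]])
  finally show "amalg v (- b) (- z) \<le> S (b + Psi v k) + cost v (z - pm_map \<theta> k)"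
    by (simp only: S(2) cost(2))
qed

lemma S_Psi_le: "S (Psi v k) \<le> cost v (pm_map \<theta> k)"
proof -
  have "S (Psi v k) \<le> (\<Sum>j\<in>ks k. S (V (lev v j) (\<psi> (lk k j))))"
    unfolding Psi_def pm_sum_def by (rule seminorm_sum_le[OF goodD(1)[OF good_S]])
  also have "\<dots> \<le> (\<Sum>j\<in>ks k. \<rho> (lev v j) * Q (\<theta> (lk k j)))"
    by (intro sum_mono dom)
  also have "\<dots> = cost v (pm_map \<theta> k)"
    by (subst cost_superset[of "ks k"])
      (auto simp: lookup_pm_map[OF \<theta>] in_keys_iff additive.zero[OF \<theta>])
  finally show ?thesis .
qed

text \<open>Applying a relation \<open>k\<close> to an old element lowers \<open>S\<close> by at
  most \<open>S (Psi v k)\<close>, and the price of \<open>pm_map \<theta> k\<close> pays for that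
  by \<open>S_Psi_le\<close>. So the old group stays isometric for every single offset, before any
  averaging.\<close>

lemma amalg_zero_right: "amalg v b 0 = S b"
proof (rule antisym)
  show "amalg v b 0 \<le> S b"
    using amalg_le[of v b 0 0] by (simp add: additive.zero[OF additive_Psi] additive.zero[OF additive_pm_map[OF \<theta>]] cost)
  show "S b \<le> amalg v b 0"
  proof (rule amalg_ge)
    fix k
    have "S b \<le> S (b + Psi v k) + S (Psi v k)"
      using S(4)[of "b + Psi v k" "Psi v k"] by simp
    then show "S b \<le> S (b + Psi v k) + cost v (0 - pm_map \<theta> k)"
      using S_Psi_le[of v k] cost(2)[of v "pm_map \<theta> k"] by simp
  qed
qed

lemma amalg_le_cost: "amalg v b z \<le> S b + cost v z"
  using amalg_le[of v b z 0] by (simp add: additive.zero[OF additive_Psi] additive.zero[OF additive_pm_map[OF \<theta>]])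

lemma amalg_single_le: "amalg v b (sg j h) \<le> S (b + V (lev v j) (\<psi> w)) + \<rho> (lev v j) * Q (h - \<theta> w)"
  using amalg_le[of v b "sg j h" "sg j w"]
  by (simp add: Psi_single pm_map_single additive.zero[OF \<theta>] cost_single single_diff[symmetric])

text \<open>The part \<open>k1\<close> of a relation at other levels pays for itself by
  \<open>S_Psi_le\<close>, so only level \<open>j\<close> counts. There, flowing back to time 0
  shows that the image of \<open>\<theta> w\<close> keeps at least exp (lev v j) times its
  \<open>Q\<close>, and the rest of \<open>h\<close> is priced by \<rho> >= exp. Times at most 0 are
  considered because the way back then has the factor exp (- lev v j), also for subnorms.\<close>

lemma amalg_single_ge:
  assumes iso: "\<And>w. S (\<psi> w) = Q (\<theta> w)" and "lev v j \<le> 0"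
  shows "exp (lev v j) * Q h \<le> amalg v 0 (sg j h)"
proof (rule amalg_ge)
  fix k :: "int \<Rightarrow>\<^sub>0 'h"
  let ?t = "lev v j"
  define k1 where "k1 = k - sg j (lk k j)"
  have k: "k = sg j (lk k j) + k1"
    by (simp add: k1_def)
  have "S (\<psi> (lk k j)) = S (V (- ?t) (V ?t (\<psi> (lk k j))))"
    using V(3)[of "- ?t" ?t "\<psi> (lk k j)"] by (simp add: V(2))
  also have "\<dots> \<le> scale (- ?t) * S (V ?t (\<psi> (lk k j)))"
    by (rule goodD(2)[OF good_S]) simp
  also have "scale (- ?t) = exp (- ?t)"
    using assms(2) by (rule scale_inverse)
  finally have 1: "exp ?t * Q (\<theta> (lk k j)) \<le> S (V ?t (\<psi> (lk k j)))"
    unfolding iso by (simp add: exp_minus field_simps)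
  have 2: "S (V ?t (\<psi> (lk k j))) \<le> S (Psi v k) + cost v (pm_map \<theta> k1)"
  proof -
    have "V ?t (\<psi> (lk k j)) = Psi v k - Psi v k1"
      using additive.add[OF additive_Psi, of v "sg j (lk k j)" k1] by (simp add: Psi_single k[symmetric])
    then show ?thesis
      using S(4)[of "Psi v k" "Psi v k1"] S_Psi_le[of v k1] by simp
  qed
  have 3: "cost v (sg j h - pm_map \<theta> k) = \<rho> ?t * Q (h - \<theta> (lk k j)) + cost v (pm_map \<theta> k1)"
  proof -
    let ?A = "insert j (ks k)"
    have l: "lk (sg j h - pm_map \<theta> k) i = (if i = j then h - \<theta> (lk k j) else - \<theta> (lk k i))" for i
      by (auto simp: lookup_minus lookup_pm_map[OF \<theta>] lookup_single when_def)
    have l1: "lk (pm_map \<theta> k1) i = (if i = j then 0 else \<theta> (lk k i))" for i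
      by (auto simp: k1_def lookup_minus lookup_pm_map[OF \<theta>] lookup_single when_def additive.zero[OF \<theta>])
    have z: "ks (sg j h - pm_map \<theta> k) \<subseteq> ?A" "ks (pm_map \<theta> k1) \<subseteq> ?A"
      using l l1 by (auto simp: in_keys_iff additive.zero[OF \<theta>] split: if_splits)
    have "cost v (sg j h - pm_map \<theta> k) = \<rho> ?t * Q (h - \<theta> (lk k j)) + (\<Sum>i\<in>?A - {j}. \<rho> (lev v i) * Q (\<theta> (lk k i)))"
      using z(1) by (simp only: cost_superset[of ?A] finite_insert finite_keys sum.remove[of ?A j] insertI1)
        (auto simp: l QD intro!: sum.cong)
    moreover have "cost v (pm_map \<theta> k1) = (\<Sum>i\<in>?A - {j}. \<rho> (lev v i) * Q (\<theta> (lk k i)))"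
      using z(2) by (simp only: cost_superset[of ?A] finite_insert finite_keys sum.remove[of ?A j] insertI1)
        (auto simp: l1 QD intro!: sum.cong)
    ultimately show ?thesis by simp
  qed
  have "exp ?t * Q h \<le> exp ?t * (Q (\<theta> (lk k j)) + Q (h - \<theta> (lk k j)))"
    using QD(7)[of h "\<theta> (lk k j)"] by (intro mult_left_mono) auto
  also have "\<dots> \<le> exp ?t * Q (\<theta> (lk k j)) + \<rho> ?t * Q (h - \<theta> (lk k j))"
    using mult_right_mono[OF rho_exp[of ?t] QD(5)[of "h - \<theta> (lk k j)"]] by (simp add: distrib_left)
  finally show "exp ?t * Q h \<le> S (0 + Psi v k) + cost v (sg j h - pm_map \<theta> k)"
    using 1 2 3 by simp
qed

lemma lev_floor: "lev v \<lfloor>w / a + v\<rfloor> \<le> w" "w - a < lev v \<lfloor>w / a + v\<rfloor>"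
proof -
  have "real_of_int \<lfloor>w / a + v\<rfloor> - v \<le> w / a" "w / a - 1 < real_of_int \<lfloor>w / a + v\<rfloor> - v"
    by linarith+
  from mult_right_mono[OF this(1), of a] mult_strict_right_mono[OF this(2), of a]
  show "lev v \<lfloor>w / a + v\<rfloor> \<le> w" "w - a < lev v \<lfloor>w / a + v\<rfloor>"
    using a unfolding lev_def by (simp_all add: left_diff_distrib[of "w / a" 1 a])
qed

lemma rho_lev_le: "\<rho> (lev v \<lfloor>w / a + v\<rfloor>) \<le> scale w"
proof -
  have "\<rho> (w + (lev v \<lfloor>w / a + v\<rfloor> - w)) \<le> scale w * \<rho> (lev v \<lfloor>w / a + v\<rfloor> - w)"
    by (rule rho_scale)
  also have "\<dots> \<le> scale w * 1"
    using lev_floor(1)[where v = v and w = w] scale_pos[of w] by (intro mult_left_mono rho_le_1) auto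
  finally show ?thesis by simp
qed

lemma cost_Phi_le: "cost v (Phi v y) \<le> (\<Sum>w\<in>ks y. scale w * Q (lk y w))"
proof -
  have "cost v (Phi v y) \<le> (\<Sum>w\<in>ks y. cost v (sg \<lfloor>w / a + v\<rfloor> (lk y w)))"
    unfolding Phi_def pm_sum_def by (rule seminorm_sum_le[OF seminorm_cost])
  also have "\<dots> \<le> (\<Sum>w\<in>ks y. scale w * Q (lk y w))"
    unfolding cost_single by (intro sum_mono mult_right_mono rho_lev_le QD)
  finally show ?thesis .
qed

lemma bdd_amalg: "bdd_fun (\<lambda>v. amalg v b (Phi v y))"
  unfolding bdd_fun_def using amalg_nonneg amalg_le_cost cost_Phi_le by (meson add_left_mono order_trans)

lemma avg_zero_right: "avg b 0 = S b"
proof -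
  have *: "(\<lambda>v. amalg v b (Phi v 0)) = (\<lambda>v. S b)"
    by (simp add: additive.zero[OF additive_Phi] amalg_zero_right)
  have "bdd_fun (\<lambda>v. S b)"
    using S by (auto simp: bdd_fun_def)
  then show ?thesis
    unfolding avg_def * using S(5) by (intro antisym mean_le_const mean_ge) auto
qed

lemma seminorm_avg: "seminorm_on UNIV (\<lambda>(b, y). avg b y)"
  unfolding seminorm_on_def
proof (safe, goal_cases)
  case 1
  then show ?case
    by (simp add: zero_prod_def avg_zero_right S)
next
  case (2 b y)
  have "avg (- b) (- y) \<le> 1 * avg b y" for b y
    unfolding avg_def by (rule mean_scale_le[OF bdd_amalg, where d = 0])
      (auto simp: amalg_nonneg additive.minus[OF additive_Phi] amalg_minus_le)
  from this[of b y] this[of "- b" "- y"] show ?case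
    by simp
next
  case (3 b y b' y')
  have "avg (b + b') (y + y') \<le> avg b y + avg b' y'"
    unfolding avg_def by (rule mean_add_le[OF bdd_amalg bdd_amalg])
      (auto simp: amalg_nonneg additive.add[OF additive_Phi] amalg_add_le)
  then show ?case by simp
qed

lemma avg_nonneg: "0 \<le> avg b y"
  using seminorm_onD(5)[OF seminorm_avg flow_subgroup_UNIV, of "(b, y)"] by simp

lemma Phi_shift: "Phi v (shift s y) = Phi (v + s / a) y"
  by (rule pm_additive_eqI[of "\<lambda>y. Phi v (shift s y)" "Phi (v + s / a)"])
    (auto intro: additive_comp[OF additive_Phi] additive_Phi flowD(1)[OF flow_shift]
      simp: Phi_single add_divide_distrib algebra_simps)

lemma lev_shift: "lev v j = s + lev (v + s / a) j"
  using a by (simp add: lev_def field_simps)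

lemma amalg_flow_le: "amalg v (V s b) z \<le> scale s * amalg (v + s / a) b z"
proof -
  let ?v = "v + s / a"
  have "amalg v (V s b) z / scale s \<le> amalg ?v b z"
  proof (rule amalg_ge)
    fix k
    have "Psi v k = V s (Psi ?v k)"
      by (rule pm_additive_eqI[of "Psi v" "\<lambda>k. V s (Psi ?v k)"])
        (auto intro: additive_Psi additive_comp[OF V(1)] simp: Psi_single lev_shift[of v _ s] V(3))
    then have 1: "S (V s b + Psi v k) \<le> scale s * S (b + Psi ?v k)"
      using goodD(2)[OF good_S, of "b + Psi ?v k" s] by (simp add: V(4))
    have "cost v z' \<le> scale s * cost ?v z'" for z'
      unfolding cost_def pm_sum_def sum_distrib_left
    proof (rule sum_mono)
      show "\<rho> (lev v j) * Q (lk z' j) \<le> scale s * (\<rho> (lev ?v j) * Q (lk z' j))" for j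
        using mult_right_mono[OF rho_scale[of s "lev ?v j"] QD(5)[of "lk z' j"]]
        by (simp add: lev_shift[of v j s] mult.assoc)
    qed
    from this[of "z - pm_map \<theta> k"] 1 amalg_le[of v "V s b" z k]
    have "amalg v (V s b) z \<le> scale s * (S (b + Psi ?v k) + cost ?v (z - pm_map \<theta> k))"
      by (simp add: distrib_left)
    then show "amalg v (V s b) z / scale s \<le> S (b + Psi ?v k) + cost ?v (z - pm_map \<theta> k)"
      using scale_pos[of s] by (simp add: field_simps)
  qed
  then show ?thesis
    using scale_pos[of s] by (simp add: field_simps)
qed

text \<open>No single grid is respected by the flow: it turns the offset \<open>v\<close> into
  \<open>v + s / a\<close>, in \<open>Phi\<close> and in \<open>amalg\<close> alike. Translation
  invariance of the mean absorbs exactly this.\<close>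

lemma avg_flow_le: "avg (V s b) (shift s y) \<le> scale s * avg b y"
  unfolding avg_def
  by (rule mean_scale_le[OF bdd_amalg, where d = "s / a"]) (auto simp: amalg_nonneg scale_pos Phi_shift amalg_flow_le)

lemma avg_single_le:
  assumes "\<And>\<tau>. w - a < \<tau> \<Longrightarrow> \<tau> \<le> w \<Longrightarrow> S (b + V \<tau> (\<psi> x)) + \<rho> \<tau> * Q (h - \<theta> x) \<le> C"
  shows "avg b (sg w h) \<le> C"
  unfolding avg_def
  by (rule mean_le_const)
    (auto simp: amalg_nonneg Phi_single intro: order_trans[OF amalg_single_le assms] lev_floor)

lemma avg_single_ge:
  assumes "\<And>w. S (\<psi> w) = Q (\<theta> w)"
  shows "exp (- a) * Q h \<le> avg 0 (sg 0 h)"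
  unfolding avg_def
proof (rule mean_ge[OF bdd_amalg])
  fix v
  have "lev v \<lfloor>v\<rfloor> \<le> 0" "- a < lev v \<lfloor>v\<rfloor>"
    using lev_floor[where v = v and w = 0] by simp_all
  then show "exp (- a) * Q h \<le> amalg v 0 (Phi v (sg 0 h))"
    using amalg_single_ge[OF assms, of v "\<lfloor>v\<rfloor>" h] mult_right_mono[of "exp (- a)" "exp (lev v \<lfloor>v\<rfloor>)" "Q h"] QD(5)[of h]
    by (simp add: Phi_single)
qed

text \<open>The relation \<open>x\<close> trades a part of \<open>h\<close> for its old image. With
  \<open>x\<close> supplied by \<open>small\<close> this yields sublinear growth of multiples, with
  x = 0 the exponent condition.\<close>

lemma avg_null_left_le: "avg 0 (sg w h) \<le> scale w * (S (\<psi> x) + Q (h - \<theta> x))"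
proof (rule avg_single_le)
  fix \<tau> assume \<tau>: "w - a < \<tau>" "\<tau> \<le> w"
  have "S (V \<tau> (\<psi> x)) \<le> scale w * S (\<psi> x)"
    using goodD(2)[OF good_S, of "\<psi> x" \<tau>] scale_mono[OF \<tau>(2)] S(5)[of "\<psi> x"]
    by (meson UNIV_I mult_right_mono order_trans)
  moreover have "\<rho> \<tau> \<le> scale w"
    using rho_scale[of w "\<tau> - w"] rho_le_1[of "\<tau> - w"] \<tau> scale_pos[of w]
    by (smt (verit, best) mult_left_le)
  then have "\<rho> \<tau> * Q (h - \<theta> x) \<le> scale w * Q (h - \<theta> x)"
    by (intro mult_right_mono QD)
  ultimately show "S (0 + V \<tau> (\<psi> x)) + \<rho> \<tau> * Q (h - \<theta> x) \<le> scale w * (S (\<psi> x) + Q (h - \<theta> x))"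
    by (simp add: distrib_left)
qed

lemma avg_single_cost_le:
  assumes "\<And>\<tau>. w - a < \<tau> \<Longrightarrow> \<tau> \<le> w \<Longrightarrow> \<rho> \<tau> \<le> C"
  shows "avg 0 (sg w h) \<le> C * Q h"
  by (rule avg_single_le[where x = 0])
    (use assms QD(5)[of h] in \<open>auto simp: additive.zero[OF \<psi>] additive.zero[OF \<theta>] V S intro: mult_right_mono\<close>)

text \<open>The two rounded indices agree except for a proportion \<open>s / a\<close> of the
  offsets. Where they differ, the two translates are paid for separately; the index difference, at
  least 1 there, is multiplied in to reach the form that \<open>mean_jump_le\<close>
  accepts.\<close>

lemma avg_jump_le:
  assumes "0 \<le> s"
  shows "avg 0 (sg (w + s) h - sg w h) \<le> (scale (w + s) + scale w) * Q h * (s / a)"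
  unfolding avg_def
proof (rule mean_jump_le)
  fix v
  let ?i = "\<lfloor>w / a + s / a + v\<rfloor>" and ?j = "\<lfloor>w / a + v\<rfloor>"
  have le: "?j \<le> ?i"
    using assms a by (intro floor_mono) auto
  have Phi: "Phi v (sg (w + s) h - sg w h) = sg ?i h - sg ?j h"
    by (simp add: additive.diff[OF additive_Phi] Phi_single add_divide_distrib)
  show "amalg v 0 (Phi v (sg (w + s) h - sg w h)) \<le> (scale (w + s) + scale w) * Q h * real_of_int (?i - ?j)"
  proof (cases "?i = ?j")
    case True
    then show ?thesis
      by (simp add: Phi amalg_zero_right S)
  next
    case False
    have "amalg v 0 (sg ?i h - sg ?j h) \<le> cost v (sg ?i h) + cost v (sg ?j h)"
      using amalg_le_cost[of v 0 "sg ?i h - sg ?j h"] cost(4)[of v "sg ?i h" "sg ?j h"] S by simp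
    also have "\<dots> \<le> (scale (w + s) + scale w) * Q h"
      using rho_lev_le[of v w] rho_lev_le[of v "w + s"] QD(5)[of h]
      by (simp add: cost_single distrib_right add_divide_distrib add_mono mult_right_mono)
    also have "\<dots> \<le> (scale (w + s) + scale w) * Q h * real_of_int (?i - ?j)"
    proof -
      have "1 \<le> real_of_int (?i - ?j)"
        using le False by linarith
      then show ?thesis
        using QD(5)[of h] scale_pos[of w] scale_pos[of "w + s"]
          mult_left_mono[of 1 "real_of_int (?i - ?j)" "(scale (w + s) + scale w) * Q h"] by simp
    qed
    finally show ?thesis
      by (simp add: Phi)
  qed
next
  show "0 \<le> (scale (w + s) + scale w) * Q h"
    using QD(5)[of h] scale_pos[of w] scale_pos[of "w + s"] by simp
qed (use assms a amalg_nonneg in auto)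

end

lemma tendsto_0_add_le:
  fixes f g h :: "'i \<Rightarrow> real"
  assumes "(f \<longlongrightarrow> 0) F" "(g \<longlongrightarrow> 0) F" "\<And>i. 0 \<le> h i" "\<And>i. h i \<le> f i + g i"
  shows "(h \<longlongrightarrow> 0) F"
  by (rule tendsto_sandwich[of "\<lambda>_. 0" h F "\<lambda>i. f i + g i"])
    (use assms tendsto_add_zero[OF assms(1,2)] in auto)

lemma tendsto_0_le:
  fixes f h :: "'i \<Rightarrow> real"
  assumes "(f \<longlongrightarrow> 0) F" "\<And>i. 0 \<le> h i" "\<And>i. h i \<le> f i"
  shows "(h \<longlongrightarrow> 0) F"
  by (rule tendsto_sandwich[of "\<lambda>_. 0" h F f]) (use assms in auto)

text \<open>The limit and exponent conditions of \<open>good\<close> are subadditive in the element,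
  so they have to be checked only on the old group and on single translates of new
  generators.\<close>

lemma pair_pm_induct:
  fixes y :: "'k \<Rightarrow>\<^sub>0 'x::ab_group_add" and b :: "'y::ab_group_add"
  assumes add: "\<And>x y. R x \<Longrightarrow> R y \<Longrightarrow> R (x + y)"
    and fst: "\<And>b. R (b, 0)" and single: "\<And>w h. R (0, sg w h)"
  shows "R (b, y)"
proof -
  have "R (0, \<Sum>j\<in>A. sg j (lk y j))" for A
  proof (induction A rule: infinite_finite_induct)
    case (insert j A)
    then show ?case
      using add[OF single[of j "lk y j"] insert.IH] by simp
  qed (auto simp: fst)
  from add[OF fst[of b] this[of "ks y"]] show ?thesis
    by (simp add: pm_eq_sum_single[symmetric])
qed

lemma mul_pair: "mul n (x, y) = (mul n x, mul n y)"
  by (induction n) (simp_all add: zero_prod_def)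

lemma mul_single: "mul n (sg w h) = sg w (mul n h)"
  using mul_additive[OF additive_single[of w], of n h] by simp

section \<open>Admissibility of the averaged seminorm\<close>

context amalgam
begin

definition Vp :: "real \<Rightarrow> 'c \<times> (real \<Rightarrow>\<^sub>0 'h) \<Rightarrow> 'c \<times> (real \<Rightarrow>\<^sub>0 'h)" where
  "Vp s x = (V s (fst x), shift s (snd x))"

lemma flow_Vp: "flow Vp"
  using flow_V flow_shift unfolding flow_def additive_def Vp_def by simp

definition avg_pair :: "'c \<times> (real \<Rightarrow>\<^sub>0 'h) \<Rightarrow> real" where
  "avg_pair x = avg (fst x) (snd x)"

lemma seminorm_avg_pair: "seminorm_on UNIV avg_pair"
  using seminorm_avg by (simp add: avg_pair_def[abs_def] case_prod_unfold)

lemmas avg_pair = seminorm_onD[OF seminorm_avg_pair flow_subgroup_UNIV, simplified]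

text \<open>For |s| <= 1 both scales are dominated by \<open>scale (w + 1)\<close>, which leaves a
  bound linear in |s|. Negative times reduce to positive ones by starting at
  \<open>w + s\<close>.\<close>

lemma shift_single_diff_le:
  assumes "\<bar>s\<bar> \<le> 1"
  shows "avg 0 (sg (w + s) h - sg w h) \<le> 2 * scale (w + 1) * Q h / a * \<bar>s\<bar>"
proof -
  have *: "avg 0 (sg (u + t) h - sg u h) \<le> 2 * scale (w + 1) * Q h / a * t"
    if "0 \<le> t" "u + t \<le> w + 1" for u t
  proof -
    have "scale (u + t) + scale u \<le> 2 * scale (w + 1)"
      using scale_mono[of "u + t" "w + 1"] scale_mono[of u "w + 1"] that by simp
    then have "(scale (u + t) + scale u) * (Q h * (t / a)) \<le> 2 * scale (w + 1) * (Q h * (t / a))"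
      using that a QD(5)[of h] by (intro mult_right_mono) auto
    then show ?thesis
      using avg_jump_le[OF that(1), of u h] by simp
  qed
  show ?thesis
  proof (cases "0 \<le> s")
    case True
    then show ?thesis
      using *[of s w] assms by simp
  next
    case False
    have "avg 0 (sg (w + s) h - sg w h) = avg 0 (sg w h - sg (w + s) h)"
      using avg_pair(6)[of "(0, sg (w + s) h)" "(0, sg w h)"] by (simp add: avg_pair_def)
    then show ?thesis
      using *[of "- s" "w + s"] False by simp
  qed
qed

lemma avg_pair_cont: "((\<lambda>s. avg_pair (Vp s x - x)) \<longlongrightarrow> 0) (at 0)"
proof -
  have "((\<lambda>s. avg_pair (Vp s (b, y) - (b, y))) \<longlongrightarrow> 0) (at 0)" for b y
  proof (induction rule: pair_pm_induct)
    case (1 x y)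
    show ?case
    proof (rule tendsto_0_add_le[OF 1])
      show "avg_pair (Vp s (x + y) - (x + y)) \<le> avg_pair (Vp s x - x) + avg_pair (Vp s y - y)" for s
        using avg_pair(3)[of "Vp s x - x" "Vp s y - y"] by (simp add: flowD(4)[OF flow_Vp] algebra_simps)
    qed (rule avg_pair)
  next
    case (2 b)
    then show ?case
      using goodD(3)[OF good_S, of b] by (simp add: avg_pair_def Vp_def avg_zero_right flowD(5)[OF flow_shift])
  next
    case (3 w h)
    let ?C = "2 * scale (w + 1) * Q h / a"
    have "((\<lambda>s. ?C * \<bar>s\<bar>) \<longlongrightarrow> ?C * \<bar>0\<bar>) (at 0)"
      by (intro tendsto_intros)
    then have lim: "((\<lambda>s. ?C * \<bar>s\<bar>) \<longlongrightarrow> 0) (at 0)"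
      by simp
    have le: "\<forall>\<^sub>F s in at 0. avg 0 (sg (w + s) h - sg w h) \<le> ?C * \<bar>s\<bar>"
      unfolding eventually_at using shift_single_diff_le by (intro exI[of _ 1]) auto
    have "((\<lambda>s. avg 0 (sg (w + s) h - sg w h)) \<longlongrightarrow> 0) (at 0)"
      by (rule tendsto_sandwich[OF always_eventually[OF allI[OF avg_nonneg]] le tendsto_const lim])
    then show ?case
      by (simp add: avg_pair_def Vp_def V)
  qed
  from this[of "fst x" "snd x"] show ?thesis by simp
qed

lemma avg_pair_decay: "((\<lambda>s. avg_pair (Vp s x)) \<longlongrightarrow> 0) at_bot"
proof -
  have "((\<lambda>s. avg_pair (Vp s (b, y))) \<longlongrightarrow> 0) at_bot" for b y
  proof (induction rule: pair_pm_induct)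
    case (1 x y)
    show ?case
      by (rule tendsto_0_add_le[OF 1]) (use avg_pair in \<open>auto simp: flowD(4)[OF flow_Vp]\<close>)
  next
    case (2 b)
    then show ?case
      using goodD(4)[OF good_S, of b] by (simp add: avg_pair_def Vp_def avg_zero_right flowD(5)[OF flow_shift])
  next
    case (3 w h)
    have "\<forall>\<^sub>F s in at_bot. avg 0 (sg (w + s) h) < e" if e: "e > 0" for e
    proof -
      have e': "e / (Q h + 1) > 0"
        using e QD(5)[of h] by simp
      obtain K where K: "\<And>\<tau>. \<tau> \<le> K \<Longrightarrow> \<rho> \<tau> < e / (Q h + 1)"
        using order_tendstoD(2)[OF rho_lim e'] by (auto simp: eventually_at_bot_linorder)
      have "avg 0 (sg (w + s) h) < e" if "s \<le> K - w" for s
      proof -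
        have "avg 0 (sg (w + s) h) \<le> e / (Q h + 1) * Q h"
          by (rule avg_single_cost_le) (use K that in \<open>auto intro: less_imp_le\<close>)
        also have "\<dots> < e"
          using e QD(5)[of h] by (simp add: field_simps)
        finally show ?thesis .
      qed
      then show ?thesis
        by (auto simp: eventually_at_bot_linorder)
    qed
    then have "((\<lambda>s. avg 0 (sg (w + s) h)) \<longlongrightarrow> 0) at_bot"
      by (intro order_tendstoI) (auto intro!: always_eventually less_le_trans[OF _ avg_nonneg])
    then show ?case
      by (simp add: avg_pair_def Vp_def V)
  qed
  from this[of "fst x" "snd x"] show ?thesis by simp
qed

lemma avg_pair_O0: "(\<lambda>n. avg_pair (mul n x) / real n) \<longlonglongrightarrow> 0"
proof -
  have "(\<lambda>n. avg_pair (mul n (b, y)) / real n) \<longlonglongrightarrow> 0" for b y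
  proof (induction rule: pair_pm_induct)
    case (1 x y)
    show ?case
    proof (rule tendsto_0_add_le[OF 1])
      show "avg_pair (mul n (x + y)) / real n \<le> avg_pair (mul n x) / real n + avg_pair (mul n y) / real n" for n
        using divide_right_mono[OF avg_pair(3)[of "mul n x" "mul n y"], of "real n"]
        by (simp add: additive.add[OF additive_mul] add_divide_distrib)
    qed (use avg_pair in auto)
  next
    case (2 b)
    then show ?case
      using goodD(5)[OF good_S, of b] by (simp add: mul_pair avg_pair_def avg_zero_right additive.zero[OF additive_mul])
  next
    case (3 w h)
    have "\<forall>\<^sub>F n in sequentially. avg 0 (sg w (mul n h)) / real n < e" if e: "e > 0" for e
    proof -
      let ?e = "e / (2 * scale w)"
      have "0 < ?e"
        using e scale_pos[of w] by simp
      from small[OF this, of h] eventually_gt_at_top[of 0] show ?thesis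
      proof eventually_elim
        case (elim n)
        then obtain x where x: "S (\<psi> x) + Q (mul n h - \<theta> x) \<le> ?e * real n"
          by auto
        have "avg 0 (sg w (mul n h)) \<le> scale w * (?e * real n)"
          using avg_null_left_le[of w "mul n h" x] mult_left_mono[OF x, of "scale w"] scale_pos[of w]
          by linarith
        also have "\<dots> < e * real n"
          using scale_pos[of w] e elim(2) by (simp add: field_simps)
        finally show ?case
          using elim(2) by (simp add: field_simps)
      qed
    qed
    then have "(\<lambda>n. avg 0 (sg w (mul n h)) / real n) \<longlonglongrightarrow> 0"
      by (intro order_tendstoI)
        (auto intro!: always_eventually less_le_trans[OF _ divide_nonneg_nonneg] avg_nonneg)
    then show ?case
      by (simp add: mul_pair avg_pair_def mul_single additive.zero[OF additive_mul])
  qed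
  from this[of "fst x" "snd x"] show ?thesis by simp
qed

lemma avg_pair_exponent:
  assumes "N \<noteq> 0"
  shows "avg_pair (mul N x) = 0"
proof -
  have "avg_pair (mul N (b, y)) = 0" for b y
  proof (induction rule: pair_pm_induct)
    case (1 x y)
    then show ?case
      using avg_pair(3)[of "mul N x" "mul N y"] avg_pair(5)[of "mul N (x + y)"] by (simp add: additive.add[OF additive_mul])
  next
    case (2 b)
    then show ?case
      using goodD(6)[OF good_S assms, of b] by (simp add: mul_pair avg_pair_def avg_zero_right additive.zero[OF additive_mul])
  next
    case (3 w h)
    have "avg 0 (sg w (mul N h)) \<le> 0"
      using avg_null_left_le[of w "mul N h" 0] exponent[OF assms, of h]
      by (simp add: additive.zero[OF \<psi>] additive.zero[OF \<theta>] S)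
    then show ?case
      using avg_nonneg[of 0 "sg w (mul N h)"]
      by (simp add: mul_pair avg_pair_def mul_single additive.zero[OF additive_mul])
  qed
  from this[of "fst x" "snd x"] show ?thesis by simp
qed

text \<open>For r = 1 truncation restores the upper bound. It is compatible with the flow because
  \<open>scale\<close> is then at least 1 (\<open>scale_ge_1\<close>), and it leaves
  \<open>S\<close> unchanged because \<open>S\<close> is already at most 1.\<close>

definition capped_avg :: "'c \<times> (real \<Rightarrow>\<^sub>0 'h) \<Rightarrow> real" where
  "capped_avg x = (if cap then min 1 (avg_pair x) else avg_pair x)"

lemma capped_avg_le: "capped_avg x \<le> avg_pair x" and capped_avg_nonneg: "0 \<le> capped_avg x"
  using avg_pair(5)[of x] by (auto simp: capped_avg_def)

lemma good_capped_avg: "good Vp UNIV capped_avg"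
  unfolding good_def
proof (intro conjI allI ballI impI)
  show "seminorm_on UNIV capped_avg"
    unfolding seminorm_on_def
  proof (intro conjI ballI)
    show "capped_avg (x + y) \<le> capped_avg x + capped_avg y" for x y
      using avg_pair(3)[of x y] avg_pair(5)[of x] avg_pair(5)[of y] by (auto simp: capped_avg_def)
  qed (auto simp: capped_avg_def avg_pair)
  show "capped_avg (Vp s x) \<le> scale s * capped_avg x" for s x
  proof -
    have *: "avg_pair (Vp s x) \<le> scale s * avg_pair x"
      unfolding avg_pair_def Vp_def using avg_flow_le by simp
    show ?thesis
    proof (cases "cap \<and> 1 \<le> avg_pair x")
      case True
      then show ?thesis
        using scale_ge_1[of s] unfolding capped_avg_def by (auto simp: min_def)
    next
      case False
      then show ?thesis
        using * capped_avg_le[of "Vp s x"] unfolding capped_avg_def[of x] by auto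
    qed
  qed
  show "((\<lambda>s. capped_avg (Vp s x - x)) \<longlongrightarrow> 0) (at 0)" for x
    by (rule tendsto_0_le[OF avg_pair_cont capped_avg_nonneg capped_avg_le])
  show "((\<lambda>s. capped_avg (Vp s x)) \<longlongrightarrow> 0) at_bot" for x
    by (rule tendsto_0_le[OF avg_pair_decay capped_avg_nonneg capped_avg_le])
  show "(\<lambda>n. capped_avg (mul n x) / real n) \<longlonglongrightarrow> 0" for x
    by (rule tendsto_0_le[OF avg_pair_O0]) (auto intro: divide_right_mono capped_avg_le simp: capped_avg_nonneg)
  show "capped_avg (mul N x) = 0" if "N \<noteq> 0" for x
    using avg_pair_exponent[OF that, of x] by (simp add: capped_avg_def)
  show "capped_avg x \<le> 1" if cap for x
    using that unfolding capped_avg_def by simp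
qed

lemma capped_avg_zero_right: "capped_avg (b, 0) = S b"
  using goodD(7)[OF good_S, of b] unfolding capped_avg_def avg_pair_def fst_conv snd_conv avg_zero_right by simp

lemma capped_avg_single_le:
  assumes "\<And>\<tau>. - a < \<tau> \<Longrightarrow> \<tau> \<le> 0 \<Longrightarrow> S (b + V \<tau> (\<psi> x)) + \<rho> \<tau> * Q (h - \<theta> x) \<le> C"
  shows "capped_avg (b, sg 0 h) \<le> C"
  using order_trans[OF capped_avg_le[of "(b, sg 0 h)"], of C] avg_single_le[of 0 b x h C] assms by (simp add: avg_pair_def)

lemma capped_avg_single_cost_le: "capped_avg (0, sg 0 h) \<le> Q h"
  using avg_single_cost_le[of 0 1 h] rho_le_1 order_trans[OF capped_avg_le[of "(0, sg 0 h)"]] by (simp add: avg_pair_def)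

lemma capped_avg_single_ge:
  assumes "\<And>w. S (\<psi> w) = Q (\<theta> w)" "cap \<Longrightarrow> Q h \<le> 1"
  shows "exp (- a) * Q h \<le> capped_avg (0, sg 0 h)"
proof -
  have "exp (- a) * Q h \<le> 1" if cap
    using mult_mono[of "exp (- a)" 1 "Q h" 1] that assms(2) QD(5)[of h] a by simp
  then show ?thesis
    using avg_single_ge[OF assms(1), of h] unfolding capped_avg_def avg_pair_def by simp
qed

end

section \<open>Completion\<close>

text \<open>An equicontinuity argument: the eventual operator bound \<open>K\<close> carries
  convergence from the dense set \<open>C\<close> to all of \<open>B\<close>. The weight
  \<open>k i\<close> makes room for the factor 1 / n of class O_0.\<close>

lemma tendsto_0_dense:
  assumes B: "flow_subgroup V B" and p: "seminorm_on B p" and C: "C \<subseteq> B"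
    and dense: "\<And>x e. x \<in> B \<Longrightarrow> 0 < e \<Longrightarrow> \<exists>c\<in>C. p (x - c) < e"
    and T: "\<And>i. additive (T i)" "\<And>i y. y \<in> B \<Longrightarrow> T i y \<in> B" "\<And>i. 0 \<le> k i"
    and bd: "\<And>y. y \<in> B \<Longrightarrow> \<forall>\<^sub>F i in F. p (T i y) * k i \<le> K * p y" and K: "0 < K"
    and c: "\<And>y. y \<in> C \<Longrightarrow> ((\<lambda>i. p (T i y) * k i) \<longlongrightarrow> 0) F" and x: "x \<in> B"
  shows "((\<lambda>i. p (T i x) * k i) \<longlongrightarrow> 0) F"
proof (rule order_tendstoI)
  note BD = flow_subgroupD[OF B] and pD = seminorm_onD[OF p B]
  fix e :: real
  assume e: "0 < e"
  then obtain y where y: "y \<in> C" "p (x - y) < e / (2 * K)"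
    using dense[OF x, of "e / (2 * K)"] K by auto
  have yB: "y \<in> B"
    using y C by auto
  have "0 < e / 2"
    using e by simp
  from order_tendstoD(2)[OF c[OF y(1)] this] bd[OF BD(4)[OF x yB]]
  show "\<forall>\<^sub>F i in F. p (T i x) * k i < e"
  proof eventually_elim
    case (elim i)
    have "p (T i x) \<le> p (T i (x - y)) + p (T i y)"
      using pD(3)[OF T(2)[OF BD(4)[OF x yB], of i] T(2)[OF yB, of i]]
      by (simp add: additive.add[OF T(1), symmetric])
    then have "p (T i x) * k i \<le> p (T i (x - y)) * k i + p (T i y) * k i"
      using T(3)[of i] by (metis distrib_right mult_right_mono)
    moreover have "K * p (x - y) < e / 2"
      using y(2) K by (simp add: field_simps)
    ultimately show ?case
      using elim by linarith
  qed
next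
  note BD = flow_subgroupD[OF B] and pD = seminorm_onD[OF p B]
  fix e :: real
  assume e: "e < 0"
  then show "\<forall>\<^sub>F i in F. e < p (T i x) * k i"
    using pD(5) T(2)[OF x] T(3) by (intro always_eventually allI less_le_trans[OF e]) simp
qed

context value_class
begin

text \<open>Each limit is an instance of \<open>tendsto_0_dense\<close>, for the operators V s - id,
  V s and the n-fold multiples; the exponent condition is one too, for a constant family.\<close>

lemma good_dense:
  assumes V: "flow V" and B: "flow_subgroup V B" and p: "seminorm_on B p"
    and scale: "\<And>s x. x \<in> B \<Longrightarrow> p (V s x) \<le> scale s * p x"
    and C: "C \<subseteq> B" "good V C p"
    and dense: "\<And>x e. x \<in> B \<Longrightarrow> 0 < e \<Longrightarrow> \<exists>c\<in>C. p (x - c) < e"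
  shows "good V B p"
proof -
  note BD = flow_subgroupD[OF B] and pD = seminorm_onD[OF p B] and VD = flowD[OF V]
  note lim = tendsto_0_dense[OF B p C(1) dense]
  show ?thesis
    unfolding good_def
  proof (intro conjI allI ballI impI p scale)
    fix x assume x: "x \<in> B"
    have "((\<lambda>s. p (V s x - x) * 1) \<longlongrightarrow> 0) (at 0)"
    \<comment> \<open>exp 1 bounds \<open>scale s\<close> for |s| < 1, and 1 accounts for the
      identity.\<close>
    proof (rule lim[where K = "exp 1 + 1"])
      show "\<forall>\<^sub>F s in at 0. p (V s y - y) * 1 \<le> (exp 1 + 1) * p y" if y: "y \<in> B" for y
      proof -
        have "p (V s y - y) * 1 \<le> (exp 1 + 1) * p y" if s: "\<bar>s\<bar> < 1" for s
        proof -
          have "scale s \<le> exp 1"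
            using s exp_le_cancel_iff[of s 1] one_le_exp_iff[of "1::real"] by (simp add: scale_def)
          then have "scale s * p y \<le> exp 1 * p y"
            using pD(5)[OF y] by (rule mult_right_mono)
          then show ?thesis
            using pD(4)[OF BD(5)[OF y, of s] y] scale[OF y, of s] by (simp add: distrib_right)
        qed
        then show ?thesis
          unfolding eventually_at by (intro exI[of _ 1]) auto
      qed
      show "additive (\<lambda>x. V s x - x)" for s
        by (simp add: additive_def VD)
      show "((\<lambda>s. p (V s y - y) * 1) \<longlongrightarrow> 0) (at 0)" if "y \<in> C" for y
        using goodD(3)[OF C(2) that] by simp
    qed (use x BD in \<open>auto intro: add_pos_pos\<close>)
    then show "((\<lambda>s. p (V s x - x)) \<longlongrightarrow> 0) (at 0)"
      by simp
    have "((\<lambda>s. p (V s x) * 1) \<longlongrightarrow> 0) at_bot"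
    proof (rule lim[where K = 1])
      show "\<forall>\<^sub>F s in at_bot. p (V s y) * 1 \<le> 1 * p y" if y: "y \<in> B" for y
        using eventually_le_at_bot[of 0]
      proof eventually_elim
        case (elim s)
        have "scale s * p y \<le> 1 * p y"
          using scale_le_1[OF elim] pD(5)[OF y] by (rule mult_right_mono)
        then show ?case
          using scale[OF y, of s] by simp
      qed
      show "((\<lambda>s. p (V s y) * 1) \<longlongrightarrow> 0) at_bot" if "y \<in> C" for y
        using goodD(4)[OF C(2) that] by simp
    qed (use x BD VD in auto)
    then show "((\<lambda>s. p (V s x)) \<longlongrightarrow> 0) at_bot"
      by simp
    have "(\<lambda>n. p (mul n x) * (1 / real n)) \<longlonglongrightarrow> 0"
    proof (rule lim[where K = 1])
      show "\<forall>\<^sub>F n in sequentially. p (mul n y) * (1 / real n) \<le> 1 * p y" if y: "y \<in> B" for y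
        using eventually_gt_at_top[of 0]
      proof eventually_elim
        case (elim n)
        then show ?case
          using seminorm_mul_le[OF p B y, of n] by (simp add: field_simps)
      qed
      show "(\<lambda>n. p (mul n y) * (1 / real n)) \<longlonglongrightarrow> 0" if "y \<in> C" for y
        using goodD(5)[OF C(2) that] by simp
    qed (use x BD additive_mul in auto)
    then show "(\<lambda>n. p (mul n x) / real n) \<longlonglongrightarrow> 0"
      by simp
  next
    fix x assume x: "x \<in> B"
    {
      assume N: "N \<noteq> 0"
      have "((\<lambda>i. p (mul N x) * 1) \<longlongrightarrow> 0) sequentially"
        by (rule lim[where K = "real N"])
          (use x N BD additive_mul seminorm_mul_le[OF p B] goodD(6)[OF C(2) N] in \<open>auto simp: always_eventually\<close>)
      then show "p (mul N x) = 0"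
        by (simp add: LIMSEQ_const_iff)
    }
    assume cap
    show "p x \<le> 1"
    proof (rule field_le_epsilon)
      fix e :: real
      assume "0 < e"
      then obtain c where c: "c \<in> C" "p (x - c) < e"
        using dense[OF x] by auto
      then show "p x \<le> 1 + e"
        using pD(7)[OF x, of c] goodD(7)[OF C(2) \<open>cap\<close>, of c] C(1) by auto
    qed
  qed
qed

text \<open>The cost of the translates of new generators. Unlike \<open>scale\<close> it vanishes at \<open>- \<infinity>\<close> also for subnorms,
  as continuity of the action at time \<open>0\<close> requires.\<close>

lemma ex_rho:
  assumes V: "flow V" and B: "flow_subgroup V B" and p: "good V B p"
    and F: "finite F" "\<And>x c. (x, c) \<in> F \<Longrightarrow> x \<in> B \<and> 0 < c \<and> p x \<le> c"
  shows "\<exists>\<rho>. (\<forall>\<tau>. exp \<tau> \<le> \<rho> \<tau>) \<and> (\<forall>s \<tau>. \<rho> (s + \<tau>) \<le> scale s * \<rho> \<tau>) \<and> (\<forall>\<tau>\<le>0. \<rho> \<tau> \<le> 1) \<and>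
    (\<rho> \<longlongrightarrow> 0) at_bot \<and> (\<forall>(x, c)\<in>F. \<forall>\<tau>. p (V \<tau> x) \<le> \<rho> \<tau> * c)"
  using F
proof (induction F rule: finite_induct)
  case empty
  show ?case
  proof (intro exI[of _ exp] conjI allI impI)
    show "exp (s + \<tau>) \<le> scale s * exp \<tau>" for s \<tau> :: real
      by (simp add: exp_add exp_le_scale mult_right_mono)
  qed (auto simp: exp_at_bot)
next
  case (insert xc F)
  obtain x c where xc: "xc = (x, c)"
    by (cases xc)
  then have x: "x \<in> B" "0 < c" "p x \<le> c"
    using insert.prems by auto
  have "\<exists>\<rho>. (\<forall>\<tau>. exp \<tau> \<le> \<rho> \<tau>) \<and> (\<forall>s \<tau>. \<rho> (s + \<tau>) \<le> scale s * \<rho> \<tau>) \<and> (\<forall>\<tau>\<le>0. \<rho> \<tau> \<le> 1) \<and>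
    (\<rho> \<longlongrightarrow> 0) at_bot \<and> (\<forall>(x, c)\<in>F. \<forall>\<tau>. p (V \<tau> x) \<le> \<rho> \<tau> * c)"
    by (rule insert.IH) (use insert.prems in auto)
  then obtain \<rho> where \<rho>: "\<And>\<tau>. exp \<tau> \<le> \<rho> \<tau>" "\<And>s \<tau>. \<rho> (s + \<tau>) \<le> scale s * \<rho> \<tau>" "\<And>\<tau>. \<tau> \<le> 0 \<Longrightarrow> \<rho> \<tau> \<le> 1"
    "(\<rho> \<longlongrightarrow> 0) at_bot" "\<And>x c \<tau>. (x, c) \<in> F \<Longrightarrow> p (V \<tau> x) \<le> \<rho> \<tau> * c"
    by blast
  \<comment> \<open>The least enlargement of \<open>\<rho>\<close> that also dominates the orbit of
    \<open>x\<close> relative to \<open>c\<close>. The upper conditions hold for both functions and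
    pass to the maximum; the lower bound by exp is inherited from \<open>\<rho>\<close>.\<close>
  let ?r = "\<lambda>\<tau>. max (\<rho> \<tau>) (p (V \<tau> x) / c)"
  note BD = flow_subgroupD[OF B] and pD = seminorm_onD[OF goodD(1)[OF p] B]
  have le: "p (V (s + \<tau>) x) \<le> scale s * p (V \<tau> x)" for s \<tau>
    using goodD(2)[OF p BD(5)[OF x(1)], of s \<tau>] by (simp add: flowD[OF V])
  show ?case
  proof (intro exI[of _ ?r] conjI allI impI)
    show "exp \<tau> \<le> ?r \<tau>" for \<tau>
      using \<rho>(1) by (simp add: le_max_iff_disj)
    show "?r (s + \<tau>) \<le> scale s * ?r \<tau>" for s \<tau>
    proof (rule max.boundedI)
      show "\<rho> (s + \<tau>) \<le> scale s * ?r \<tau>"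
        by (rule order_trans[OF \<rho>(2)]) (use scale_pos[of s] in simp)
      have "p (V (s + \<tau>) x) / c \<le> scale s * (p (V \<tau> x) / c)"
        using le[of s \<tau>] x(2) by (simp add: divide_right_mono)
      also have "\<dots> \<le> scale s * ?r \<tau>"
        using scale_pos[of s] by (intro mult_left_mono) auto
      finally show "p (V (s + \<tau>) x) / c \<le> scale s * ?r \<tau>" .
    qed
    show "?r \<tau> \<le> 1" if "\<tau> \<le> 0" for \<tau>
    proof -
      have "p (V \<tau> x) \<le> scale \<tau> * p x"
        by (rule goodD(2)[OF p x(1)])
      also have "\<dots> \<le> 1 * p x"
        using scale_le_1[OF that] pD(5)[OF x(1)] by (rule mult_right_mono)
      finally show ?thesis
        using \<rho>(3)[OF that] x by (simp add: field_simps)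
    qed
    have "((\<lambda>\<tau>. p (V \<tau> x) / c) \<longlongrightarrow> 0 / c) at_bot"
      by (intro tendsto_intros goodD(4)[OF p x(1)]) (use x(2) in simp)
    from tendsto_max[OF \<rho>(4) this] show "(?r \<longlongrightarrow> 0) at_bot"
      by simp
    have "p (V \<tau> y) \<le> ?r \<tau> * d" if yd: "(y, d) \<in> insert xc F" for \<tau> y d
    proof (cases "(y, d) \<in> F")
      case True
      have "p (V \<tau> y) \<le> \<rho> \<tau> * d"
        using \<rho>(5)[OF True] .
      also have "\<dots> \<le> ?r \<tau> * d"
        using insert.prems[of y d] yd by (intro mult_right_mono) auto
      finally show ?thesis .
    next
      case False
      then have "y = x" "d = c"
        using yd xc by auto
      then show ?thesis
        using x(2) by (simp add: max_mult_distrib_right)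
    qed
    then show "\<forall>(x, c)\<in>insert xc F. \<forall>\<tau>. p (V \<tau> x) \<le> ?r \<tau> * c"
      by blast
  qed
qed

end

locale completion = value_class +
  fixes V :: "real \<Rightarrow> 'b::ab_group_add \<Rightarrow> 'b" and p :: "'b \<Rightarrow> real"
  assumes flow_V: "flow V" and good_p: "good V UNIV p"
begin

lemmas VD = flowD[OF flow_V]
lemmas pD = seminorm_onD[OF goodD(1)[OF good_p] flow_subgroup_UNIV, simplified]

text \<open>Null sequences are not divided out here. Pointwise operations keep the function type an
  Abelian group, and the identification is left to the final quotient.\<close>

definition CS :: "(nat \<Rightarrow> 'b) set" where
  "CS = {X. \<forall>e>0. \<exists>M. \<forall>m\<ge>M. \<forall>n\<ge>M. p (X m - X n) < e}"

definition VB :: "real \<Rightarrow> (nat \<Rightarrow> 'b) \<Rightarrow> (nat \<Rightarrow> 'b)" where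
  "VB s X = (\<lambda>i. V s (X i))"

definition pB :: "(nat \<Rightarrow> 'b) \<Rightarrow> real" where
  "pB X = lim (\<lambda>i. p (X i))"

definition cst :: "'b \<Rightarrow> nat \<Rightarrow> 'b" where
  "cst x = (\<lambda>_. x)"

lemma flow_VB: "flow VB"
  unfolding flow_def additive_def VB_def by (auto simp: VD fun_eq_iff)

lemma CS_I:
  assumes "\<And>e. 0 < e \<Longrightarrow> \<exists>M. \<forall>m\<ge>M. \<forall>n\<ge>M. p (X m - X n) < e"
  shows "X \<in> CS"
  using assms by (auto simp: CS_def)

lemma CS_le:
  assumes X: "X \<in> CS" and K: "0 < K" and le: "\<And>m n. p (Y m - Y n) \<le> K * p (X m - X n)"
  shows "Y \<in> CS"
proof (rule CS_I)
  fix e :: real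
  assume "0 < e"
  then have "0 < e / K"
    using K by simp
  then obtain M where "\<forall>m\<ge>M. \<forall>n\<ge>M. p (X m - X n) < e / K"
    using X unfolding CS_def by blast
  then have "\<forall>m\<ge>M. \<forall>n\<ge>M. p (Y m - Y n) < e"
    using K le_less_trans[OF le] by (simp add: field_simps)
  then show "\<exists>M. \<forall>m\<ge>M. \<forall>n\<ge>M. p (Y m - Y n) < e" ..
qed

lemma flow_subgroup_CS: "flow_subgroup VB CS"
  unfolding flow_subgroup_def
proof (intro conjI ballI allI)
  show "0 \<in> CS"
    by (auto simp: CS_def pD)
  show "- X \<in> CS" if "X \<in> CS" for X
    by (rule CS_le[OF that, of 1]) (auto simp: pD)
  show "VB s X \<in> CS" if "X \<in> CS" for s X
    by (rule CS_le[OF that scale_pos[of s]])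
      (use goodD(2)[OF good_p] in \<open>auto simp: VB_def VD(7)[symmetric]\<close>)
  show "X + Y \<in> CS" if XY: "X \<in> CS" "Y \<in> CS" for X Y
  proof (rule CS_I)
    fix e :: real
    assume "0 < e"
    then have "0 < e / 2" by simp
    then obtain M M' where M: "\<forall>m\<ge>M. \<forall>n\<ge>M. p (X m - X n) < e / 2"
      "\<forall>m\<ge>M'. \<forall>n\<ge>M'. p (Y m - Y n) < e / 2"
      using XY unfolding CS_def by blast
    have "p ((X + Y) m - (X + Y) n) < e" if "m \<ge> max M M'" "n \<ge> max M M'" for m n
    proof -
      have "p ((X + Y) m - (X + Y) n) \<le> p (X m - X n) + p (Y m - Y n)"
        using pD(3)[of "X m - X n" "Y m - Y n"] by (simp add: algebra_simps)
      also have "\<dots> < e / 2 + e / 2"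
        using M that by (intro add_strict_mono) auto
      finally show ?thesis by simp
    qed
    then show "\<exists>M. \<forall>m\<ge>M. \<forall>n\<ge>M. p ((X + Y) m - (X + Y) n) < e"
      by blast
  qed
qed

lemmas CSD = flow_subgroupD[OF flow_subgroup_CS]

lemma pB_lim: "X \<in> CS \<Longrightarrow> (\<lambda>i. p (X i)) \<longlonglongrightarrow> pB X"
proof -
  assume X: "X \<in> CS"
  have "Cauchy (\<lambda>i. p (X i))"
  proof (rule CauchyI)
    fix e :: real
    assume "0 < e"
    then obtain M where M: "\<forall>m\<ge>M. \<forall>n\<ge>M. p (X m - X n) < e"
      using X unfolding CS_def by blast
    show "\<exists>M. \<forall>m\<ge>M. \<forall>n\<ge>M. norm (p (X m) - p (X n)) < e"
      using M by (intro exI[of _ M]) (auto intro: le_less_trans[OF pD(8)])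
  qed
  then show ?thesis
    unfolding pB_def by (simp add: Cauchy_convergent_iff convergent_LIMSEQ_iff)
qed

lemma pB_eqI: "X \<in> CS \<Longrightarrow> (\<lambda>i. p (X i)) \<longlonglongrightarrow> l \<Longrightarrow> pB X = l"
  using pB_lim LIMSEQ_unique by blast

lemma cst_CS [simp]: "cst x \<in> CS"
  by (auto simp: CS_def cst_def pD)

lemma pB_cst [simp]: "pB (cst x) = p x"
  by (rule pB_eqI) (auto simp: cst_def cst_CS[unfolded cst_def])

lemma additive_cst: "additive cst"
  by standard (auto simp: cst_def)

lemma VB_cst: "VB s (cst x) = cst (V s x)"
  by (simp add: VB_def cst_def)

lemma seminorm_pB: "seminorm_on CS pB"
  unfolding seminorm_on_def
proof (intro conjI ballI)
  show "pB 0 = 0"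
    by (rule pB_eqI) (use CSD(1) in \<open>auto simp: pD\<close>)
  show "pB (- X) = pB X" if "X \<in> CS" for X
    by (rule pB_eqI) (use pB_lim[OF that] CSD(2)[OF that] in \<open>auto simp: pD\<close>)
  show "pB (X + Y) \<le> pB X + pB Y" if "X \<in> CS" "Y \<in> CS" for X Y
    by (rule LIMSEQ_le[OF pB_lim[OF CSD(3)[OF that]] tendsto_add[OF pB_lim[OF that(1)] pB_lim[OF that(2)]]])
      (auto simp: pD)
qed

lemmas pBD = seminorm_onD[OF seminorm_pB flow_subgroup_CS]

lemma pB_le_I:
  assumes "X \<in> CS" "\<exists>M. \<forall>m\<ge>M. p (X m) \<le> e"
  shows "pB X \<le> e"
  by (rule LIMSEQ_le_const2[OF pB_lim[OF assms(1)] assms(2)])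

lemma cst_dense:
  assumes X: "X \<in> CS" and e: "0 < e"
  shows "\<exists>x. pB (X - cst x) < e"
proof -
  have "0 < e / 2"
    using e by simp
  then obtain M where M: "\<forall>m\<ge>M. \<forall>n\<ge>M. p (X m - X n) < e / 2"
    using X unfolding CS_def by blast
  have "pB (X - cst (X M)) \<le> e / 2"
    by (rule pB_le_I) (use M CSD(4)[OF X] in \<open>auto simp: cst_def[of "X M", symmetric] intro!: exI[of _ M] less_imp_le\<close>,
        auto simp: cst_def)
  then show ?thesis
    using e by (intro exI[of _ "X M"]) simp
qed

lemma good_pB: "good VB CS pB"
proof (rule good_dense[OF flow_VB flow_subgroup_CS seminorm_pB])
  show "pB (VB s X) \<le> scale s * pB X" if "X \<in> CS" for s X
    by (rule LIMSEQ_le[OF pB_lim[OF CSD(5)[OF that]] tendsto_mult_left[OF pB_lim[OF that]]])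
      (use goodD(2)[OF good_p] in \<open>auto simp: VB_def\<close>)
  show "range cst \<subseteq> CS"
    by auto
  show "good VB (range cst) pB"
    using good_p pBD(1) unfolding good_def
    by (simp add: seminorm_on_def mul_additive[OF additive_cst, symmetric] VB_cst additive.add[OF additive_cst, symmetric]
        additive.minus[OF additive_cst, symmetric] additive.diff[OF additive_cst, symmetric])
  show "\<exists>c\<in>range cst. pB (X - c) < e" if "X \<in> CS" "0 < e" for X e
    using cst_dense[OF that] by auto
qed

text \<open>If \<open>x n\<close> is chosen within 1 / (n + 1) of \<open>Y n\<close>, then the
  sequence \<open>x\<close> is Cauchy in the original group and, read as an element of
  \<open>CS\<close>, is itself the limit.\<close>

lemma complete:
  assumes Y: "\<And>n. Y n \<in> CS" "\<And>e. 0 < e \<Longrightarrow> \<exists>M. \<forall>m\<ge>M. \<forall>n\<ge>M. pB (Y m - Y n) < e"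
  shows "\<exists>X\<in>CS. (\<lambda>n. pB (Y n - X)) \<longlonglongrightarrow> 0"
proof -
  have "\<exists>x. pB (Y n - cst x) < 1 / real (Suc n)" for n
    by (rule cst_dense[OF Y(1)]) simp
  then obtain x where x: "\<And>n. pB (Y n - cst (x n)) < 1 / real (Suc n)"
    by metis
  have small: "\<exists>M. \<forall>n\<ge>M. 1 / real (Suc n) < e" if "0 < e" for e
    using order_tendstoD(2)[OF lim_inverse_n'[THEN LIMSEQ_Suc] that] by (auto simp: eventually_sequentially)
  have xm: "p (x m - x n) < 1 / real (Suc m) + pB (Y m - Y n) + 1 / real (Suc n)" for m n
  proof -
    have "p (x m - x n) = pB (cst (x m) - cst (x n))"
      by (simp add: additive.diff[OF additive_cst, symmetric])
    also have "\<dots> \<le> pB (cst (x m) - Y m) + pB (Y m - cst (x n))"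
      by (rule pBD) (simp_all add: Y)
    also have "pB (Y m - cst (x n)) \<le> pB (Y m - Y n) + pB (Y n - cst (x n))"
      by (rule pBD) (simp_all add: Y)
    also have "pB (cst (x m) - Y m) = pB (Y m - cst (x m))"
      by (rule pBD) (simp_all add: Y)
    finally show ?thesis
      using x[of m] x[of n] by linarith
  qed
  have xCS: "x \<in> CS"
  proof (rule CS_I)
    fix e :: real
    assume "0 < e"
    then have e: "0 < e / 3" by simp
    obtain M M' where M: "\<forall>n\<ge>M. 1 / real (Suc n) < e / 3" "\<forall>m\<ge>M'. \<forall>n\<ge>M'. pB (Y m - Y n) < e / 3"
      using small[OF e] Y(2)[OF e] by blast
    have "p (x m - x n) < e" if "m \<ge> max M M'" "n \<ge> max M M'" for m n
    proof -
      have "1 / real (Suc m) < e / 3" "1 / real (Suc n) < e / 3" "pB (Y m - Y n) < e / 3"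
        using M that by auto
      then show ?thesis
        using xm[of m n] by linarith
    qed
    then show "\<exists>M. \<forall>m\<ge>M. \<forall>n\<ge>M. p (x m - x n) < e"
      by blast
  qed
  have "(\<lambda>n. pB (Y n - x)) \<longlonglongrightarrow> 0"
  proof (rule order_tendstoI)
    fix e :: real
    assume "0 < e"
    then have e: "0 < e / 3" by simp
    obtain M M' where M: "\<forall>n\<ge>M. 1 / real (Suc n) < e / 3" "\<forall>m\<ge>M'. \<forall>n\<ge>M'. p (x m - x n) < e / 3"
      using small[OF e] xCS e unfolding CS_def by blast
    have "pB (Y n - x) < e" if n: "n \<ge> max M M'" for n
    proof -
      have "pB (cst (x n) - x) \<le> e / 3"
        by (rule pB_le_I) (use M n xCS CSD(4) in \<open>auto simp: cst_def[of "x n"] cst_CS[unfolded cst_def] intro!: exI[of _ M'] less_imp_le\<close>)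
      moreover have "pB (Y n - x) \<le> pB (Y n - cst (x n)) + pB (cst (x n) - x)"
        by (rule pBD) (simp_all add: Y xCS)
      moreover have "1 / real (Suc n) < e / 3"
        using M n by auto
      ultimately show ?thesis
        using x[of n] e by linarith
    qed
    then show "\<forall>\<^sub>F n in sequentially. pB (Y n - x) < e"
      unfolding eventually_sequentially by blast
  next
    fix e :: real
    assume "e < 0"
    then show "\<forall>\<^sub>F n in sequentially. e < pB (Y n - x)"
      using less_le_trans[OF \<open>e < 0\<close> pBD(5)[OF CSD(4)[OF Y(1) xCS]]] by (intro always_eventually allI)
  qed
  then show ?thesis
    using xCS by blast
qed

end

section \<open>The tower of extensions\<close>

lemma countable_pm: "countable (UNIV :: ('k::{countable,linorder} \<Rightarrow>\<^sub>0 'x::{countable,zero}) set)"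
proof -
  have "UNIV \<subseteq> range (Poly_Mapping.the_value :: ('k \<times> 'x) list \<Rightarrow> _)"
    using the_value_items by (metis rangeI subsetI)
  then show ?thesis
    by (rule countable_subset) simp
qed

text \<open>The finite groups in (G2) have carriers inside \<open>nat\<close>, so each is a quotient
  of this free group, with its relations turned into elements of seminorm 0. One countable type of
  generators thus serves all tasks.\<close>

type_synonym frag = "nat \<Rightarrow>\<^sub>0 int"

text \<open>The underlying group is fixed in advance: \<open>'g\<close> together with, for each
  round, the free group on all translates of \<open>frag\<close>. \<open>D0\<close> contains 0 so
  that a task can bound the seminorm of a generator itself and not only its distance to another
  element.\<close>

locale tower = value_class +
  fixes V0 :: "real \<Rightarrow> 'g::ab_group_add \<Rightarrow> 'g" and p0 :: "'g \<Rightarrow> real" and D0 :: "'g set"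
  assumes flow_V0: "flow V0" and good_p0: "good V0 UNIV p0"
    and D0: "countable D0" "0 \<in> D0" "\<And>x e. 0 < e \<Longrightarrow> \<exists>d\<in>D0. p0 (x - d) < e"
begin

definition VA :: "real \<Rightarrow> 'g \<times> (nat \<Rightarrow>\<^sub>0 (real \<Rightarrow>\<^sub>0 frag)) \<Rightarrow> 'g \<times> (nat \<Rightarrow>\<^sub>0 (real \<Rightarrow>\<^sub>0 frag))" where
  "VA s x = (V0 s (fst x), pm_map (shift s) (snd x))"

definition lo :: "nat \<Rightarrow> 'g \<times> (nat \<Rightarrow>\<^sub>0 (real \<Rightarrow>\<^sub>0 frag)) \<Rightarrow> 'g \<times> (nat \<Rightarrow>\<^sub>0 (real \<Rightarrow>\<^sub>0 frag))" where
  "lo n x = (fst x, \<Sum>i<n. sg i (lk (snd x) i))"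

definition below :: "nat \<Rightarrow> 'g \<times> (nat \<Rightarrow>\<^sub>0 (real \<Rightarrow>\<^sub>0 frag)) \<Rightarrow> bool" where
  "below n x \<longleftrightarrow> (\<forall>i\<ge>n. lk (snd x) i = 0)"

text \<open>The inner 0 is the time of the scalar 1, so this is the untranslated generator.\<close>

definition inst :: "nat \<Rightarrow> frag \<Rightarrow> 'g \<times> (nat \<Rightarrow>\<^sub>0 (real \<Rightarrow>\<^sub>0 frag))" where
  "inst n m = (0, sg n (sg 0 m))"

lemma flow_VA: "flow VA"
proof -
  have "pm_map (shift 0) y = y" "pm_map (shift (s + t)) y = pm_map (shift s) (pm_map (shift t) y)"
    for s t and y :: "nat \<Rightarrow>\<^sub>0 (real \<Rightarrow>\<^sub>0 frag)"
    by (rule poly_mapping_eqI, simp only: lookup_pm_map[OF flowD(1)[OF flow_shift]] flowD(2,3)[OF flow_shift])+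
  moreover have "additive (pm_map (shift s) :: (nat \<Rightarrow>\<^sub>0 (real \<Rightarrow>\<^sub>0 frag)) \<Rightarrow> _)" for s
    by (rule additive_pm_map[OF flowD(1)[OF flow_shift]])
  ultimately show ?thesis
    using flow_V0 unfolding flow_def additive_def VA_def by simp
qed

lemmas VAD = flowD[OF flow_VA]

lemma lookup_lo: "lk (snd (lo n x)) i = (if i < n then lk (snd x) i else 0)"
proof -
  have "lk (snd (lo n x)) i = (\<Sum>j<n. if j = i then lk (snd x) i else 0)"
    unfolding lo_def snd_conv lookup_sum by (intro sum.cong) (auto simp: lookup_single when_def)
  then show ?thesis by simp
qed

lemma eqI: "fst x = fst y \<Longrightarrow> (\<And>i. lk (snd x) i = lk (snd y) i) \<Longrightarrow> x = y"
  by (simp add: prod_eq_iff poly_mapping_eqI)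

lemma fst_lo [simp]: "fst (lo n x) = fst x"
  by (simp add: lo_def)

lemma additive_lo: "additive (lo n)"
  by standard (auto intro!: eqI simp: lookup_lo lookup_add)

lemma lo_VA: "lo n (VA s x) = VA s (lo n x)"
  by (rule eqI)
    (auto simp: lookup_lo VA_def lookup_pm_map[OF flowD(1)[OF flow_shift]] flowD(5)[OF flow_shift])

lemma lo_below: "below n x \<Longrightarrow> lo n x = x"
  by (rule eqI) (auto simp: lookup_lo below_def)

lemma lo_inst: "lo n (inst n m) = 0"
  by (rule eqI) (auto simp: lookup_lo inst_def lookup_single)

lemma lookup_inst [simp]: "lk (snd (inst n m)) n = sg 0 m"
  by (simp add: inst_def)

lemma additive_inst: "additive (inst n)"
  by standard (simp add: inst_def single_add)

lemma below_mono: "below m x \<Longrightarrow> m \<le> n \<Longrightarrow> below n x"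
  by (auto simp: below_def)

lemma below_closed:
  "below n x \<Longrightarrow> below n y \<Longrightarrow> below n (x + y)" "below n x \<Longrightarrow> below n (- x)"
  "below n x \<Longrightarrow> below n y \<Longrightarrow> below n (x - y)" "below n x \<Longrightarrow> below n (VA s x)"
  "below n 0" "below n x \<Longrightarrow> below n (mul k x)" "below (Suc n) (inst n m)" "below n (g, 0)"
proof -
  show add: "below n x \<Longrightarrow> below n y \<Longrightarrow> below n (x + y)" and z: "below n 0" for x y
    by (simp_all add: below_def lookup_add)
  show "below n x \<Longrightarrow> below n (mul k x)"
    by (induction k) (auto intro: add z)
qed (auto simp: below_def lookup_add lookup_minus VA_def inst_def lookup_single when_def
    lookup_pm_map[OF flowD(1)[OF flow_shift]] flowD(5)[OF flow_shift])

lemma ex_below: "\<exists>n. below n x"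
proof -
  obtain n where "\<forall>i\<in>ks (snd x). i < n"
    using finite_keys[of "snd x"] finite_nat_set_iff_bounded by blast
  then show ?thesis
    unfolding below_def by (metis in_keys_iff not_less)
qed

lemma ex_below_finite:
  assumes "finite F"
  shows "\<exists>n. \<forall>x\<in>F. below n x"
  using assms
proof (induction F rule: finite_induct)
  case (insert x F)
  then obtain n m where "\<forall>x\<in>F. below n x" "below m x"
    using ex_below by blast
  then show ?case
    by (intro exI[of _ "max n m"]) (auto intro: below_mono)
qed simp

text \<open>With all real times the new part of the tower is uncountable; rational times are dense
  in it because the flow is continuous.\<close>

definition rat_combs :: "(nat \<Rightarrow>\<^sub>0 (real \<Rightarrow>\<^sub>0 frag)) set" where
  "rat_combs = sum_list ` lists ((\<lambda>(n, w, h). sg n (sg w h)) ` (UNIV \<times> \<rat> \<times> UNIV))"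

definition D :: "('g \<times> (nat \<Rightarrow>\<^sub>0 (real \<Rightarrow>\<^sub>0 frag))) set" where
  "D = D0 \<times> rat_combs"

lemma countable_D: "countable D"
  unfolding D_def rat_combs_def by (intro countable_SIGMA D0 countable_image countable_lists countable_pm countable_rat) simp

lemma rat_combs_add:
  assumes "x \<in> rat_combs" "y \<in> rat_combs"
  shows "x + y \<in> rat_combs"
proof -
  let ?S = "(\<lambda>(n, w, h). sg n (sg w h)) ` (UNIV \<times> \<rat> \<times> UNIV)"
  obtain as bs where "as \<in> lists ?S" "bs \<in> lists ?S" "x = sum_list as" "y = sum_list bs"
    using assms unfolding rat_combs_def by blast
  then have "as @ bs \<in> lists ?S" "x + y = sum_list (as @ bs)"
    by (simp_all only: append_in_lists_conv sum_list_append)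
  then show ?thesis
    unfolding rat_combs_def by blast
qed

lemma rat_combs_zero: "0 \<in> rat_combs"
  unfolding rat_combs_def by (rule image_eqI[of _ _ "[]"]) auto

lemma rat_combs_single: "w \<in> \<rat> \<Longrightarrow> sg n (sg w h) \<in> rat_combs"
  unfolding rat_combs_def by (rule image_eqI[of _ _ "[sg n (sg w h)]"]) (auto intro!: image_eqI[of _ _ "(n, w, h)"])

lemma D_zero: "0 \<in> D"
  by (simp add: D_def D0 rat_combs_zero zero_prod_def)

text \<open>The approximable new parts (\<open>R\<close>) are closed under sums, so a single
  translated generator has to be treated, and a small flow moves it to a rational time.\<close>

lemma D_dense:
  assumes p: "good VA UNIV p" "\<And>g. p (g, 0) = p0 g" and e: "0 < e"
  shows "\<exists>d\<in>D. p (x - d) < e"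
proof -
  note pD = seminorm_onD[OF goodD(1)[OF p(1)] flow_subgroup_UNIV, simplified]
  define R where "R y \<longleftrightarrow> (\<forall>e>0. \<exists>y'\<in>rat_combs. p (0, y - y') < e)" for y
  have R0: "R 0"
    using rat_combs_zero pD(1) by (auto simp: R_def zero_prod_def intro!: bexI[of _ 0])
  have Radd: "R (y + z)" if yz: "R y" "R z" for y z
    unfolding R_def
  proof (intro allI impI)
    fix e :: real
    assume "0 < e"
    then have "0 < e / 2" by simp
    then obtain y' z' where *: "y' \<in> rat_combs" "z' \<in> rat_combs" "p (0, y - y') < e / 2" "p (0, z - z') < e / 2"
      using yz unfolding R_def by blast
    have "p (0, (y + z) - (y' + z')) \<le> p (0, y - y') + p (0, z - z')"
      using pD(3)[of "(0, y - y')" "(0, z - z')"] by (simp add: algebra_simps)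
    then have "p (0, (y + z) - (y' + z')) < e"
      using * by linarith
    then show "\<exists>w\<in>rat_combs. p (0, (y + z) - w) < e"
      using rat_combs_add[OF *(1,2)] by blast
  qed
  have Rsum: "R (sum g A)" if "\<And>i. R (g i)" for g :: "'i \<Rightarrow> _" and A
    by (induction A rule: infinite_finite_induct) (auto intro: R0 Radd that)
  have Rsg: "R (sg n (sg w h))" for n w h
    unfolding R_def
  proof (intro allI impI)
    fix e :: real
    assume "0 < e"
    let ?x = "(0, sg n (sg w h))"
    have "\<forall>\<^sub>F s in at 0. p (VA s ?x - ?x) < e"
      by (rule order_tendstoD(2)[OF goodD(3)[OF p(1)] \<open>0 < e\<close>]) simp
    then obtain d where d: "0 < d" "\<And>s. s \<noteq> 0 \<Longrightarrow> \<bar>s\<bar> < d \<Longrightarrow> p (VA s ?x - ?x) < e"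
      unfolding eventually_at by auto
    obtain q where q: "q \<in> \<rat>" "w < q" "q < w + d"
      using Rats_dense_in_real[of w "w + d"] d(1) by auto
    have "VA (q - w) ?x = (0, sg n (sg q h))"
      by (simp add: VA_def pm_map_single flowD(5)[OF flow_shift] flowD(5)[OF flow_V0])
    then have "p ((0, sg n (sg q h)) - ?x) < e"
      using d(2)[of "q - w"] q by auto
    then have "p (?x - (0, sg n (sg q h))) < e"
      using pD(6)[of ?x "(0, sg n (sg q h))"] by simp
    then show "\<exists>y'\<in>rat_combs. p (0, sg n (sg w h) - y') < e"
      using rat_combs_single[OF q(1)] by auto
  qed
  have "R (sg n z)" for n z
    using Rsum[of "\<lambda>w. sg n (sg w (lk z w))" "ks z", OF Rsg]
    by (simp add: additive.sum[OF additive_single, symmetric] pm_eq_sum_single[symmetric])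
  from Rsum[of "\<lambda>n. sg n (lk (snd x) n)" "ks (snd x)", OF this] have "R (snd x)"
    by (simp add: pm_eq_sum_single[symmetric])
  moreover have e2: "0 < e / 2"
    using e by simp
  ultimately obtain y where y: "y \<in> rat_combs" "p (0, snd x - y) < e / 2"
    unfolding R_def by blast
  obtain d where d: "d \<in> D0" "p0 (fst x - d) < e / 2"
    using D0(3)[OF e2] by blast
  have "p (x - (d, y)) \<le> p (fst x - d, 0) + p (0, snd x - y)"
    using pD(3)[of "(fst x - d, 0)" "(0, snd x - y)"] by (cases x) simp
  then have "p (x - (d, y)) < e"
    using d y p(2) by simp
  then show ?thesis
    using d y by (intro bexI[of _ "(d, y)"]) (auto simp: D_def)
qed

text \<open>Centres from \<open>D\<close> and rational bounds keep the set countable. This is why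
  real bounds are later replaced by rational ones lying between what an extension achieves and what
  is demanded.\<close>

definition templates ::
    "(('g \<times> (nat \<Rightarrow>\<^sub>0 (real \<Rightarrow>\<^sub>0 frag))) \<times> frag \<times> real \<times> real) list set" where
  "templates = lists (D \<times> UNIV \<times> \<rat> \<times> \<rat>)"

text \<open>Discarding the second component of \<open>prod_decode\<close> makes every template come
  up at arbitrarily late rounds, in particular after all its centres have been built.\<close>

definition task ::
    "nat \<Rightarrow> (('g \<times> (nat \<Rightarrow>\<^sub>0 (real \<Rightarrow>\<^sub>0 frag))) \<times> frag \<times> real \<times> real) list" where
  "task n = from_nat_into templates (fst (prod_decode n))"

definition sat where
  "sat ts n p \<longleftrightarrow> (\<forall>(x, m, l, u)\<in>set ts. l \<le> p (inst n m - x) \<and> p (inst n m - x) \<le> u)"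

definition extends where
  "extends n p p' \<longleftrightarrow> good VA UNIV p' \<and> (\<forall>x. below n x \<longrightarrow> p' x = p x)"

text \<open>The seminorm chosen lives on the whole group, but later rounds preserve only its values
  below \<open>Suc n\<close>. A round without a solution to its task leaves the seminorm as it
  is.\<close>

primrec stage :: "nat \<Rightarrow> 'g \<times> (nat \<Rightarrow>\<^sub>0 (real \<Rightarrow>\<^sub>0 frag)) \<Rightarrow> real" where
  "stage 0 = (\<lambda>x. p0 (fst x))"
| "stage (Suc n) =
     (if \<exists>p'. extends n (stage n) p' \<and> sat (task n) n p'
      then SOME p'. extends n (stage n) p' \<and> sat (task n) n p' else stage n)"

definition limit where
  "limit x = stage (LEAST n. below n x) x"

lemma good_stage: "good VA UNIV (stage n)"
proof (induction n)
  case 0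
  have "additive (fst :: 'g \<times> (nat \<Rightarrow>\<^sub>0 (real \<Rightarrow>\<^sub>0 frag)) \<Rightarrow> 'g)"
    by (simp add: additive_def)
  moreover have "fst (VA s x) = V0 s (fst x)" for s x
    by (simp add: VA_def)
  ultimately show ?case
    using good_pullback[OF good_p0, of fst VA] by simp
next
  case (Suc n)
  show ?case
  proof (cases "\<exists>p'. extends n (stage n) p' \<and> sat (task n) n p'")
    case True
    from someI_ex[OF this] True have "extends n (stage n) (stage (Suc n))"
      by simp
    then show ?thesis
      unfolding extends_def by blast
  qed (use Suc in auto)
qed

lemma stage_Suc: "below n x \<Longrightarrow> stage (Suc n) x = stage n x"
proof (cases "\<exists>p'. extends n (stage n) p' \<and> sat (task n) n p'")
  case True
  from someI_ex[OF this] True have "extends n (stage n) (stage (Suc n))"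
    by simp
  then show "below n x \<Longrightarrow> stage (Suc n) x = stage n x"
    unfolding extends_def by blast
qed auto

lemma stage_mono:
  assumes "below n x" "n \<le> m"
  shows "stage m x = stage n x"
  using assms(2)
proof (induction m rule: dec_induct)
  case (step k)
  then show ?case
    using stage_Suc[OF below_mono[OF assms(1), of k]] by simp
qed simp

lemma limit_stage: "below n x \<Longrightarrow> limit x = stage n x"
  unfolding limit_def using stage_mono[of "LEAST n. below n x" x n] LeastI[of "\<lambda>n. below n x" n]
  by (simp add: Least_le)

lemma good_limit: "good VA UNIV limit"
  unfolding good_def
proof (intro conjI allI ballI impI)
  note sD = seminorm_onD[OF goodD(1)[OF good_stage] flow_subgroup_UNIV, simplified]
  show "seminorm_on UNIV limit"
    unfolding seminorm_on_def
  proof (intro conjI ballI)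
    show "limit 0 = 0"
      using limit_stage[OF below_closed(5)[of 0]] sD(1)[of 0] by simp
    fix x y
    obtain n where n: "below n x" "below n y"
      using ex_below_finite[of "{x, y}"] by auto
    then show "limit (- x) = limit x" "limit (x + y) \<le> limit x + limit y"
      using sD(2,3) by (auto simp: limit_stage[of n] below_closed)
  qed
  fix x
  obtain n where n: "below n x"
    using ex_below by blast
  note * = limit_stage[of n] n below_closed
  show "limit (VA s x) \<le> scale s * limit x" for s
    using goodD(2)[OF good_stage] by (simp add: *)
  show "((\<lambda>s. limit (VA s x - x)) \<longlongrightarrow> 0) (at 0)"
    using goodD(3)[OF good_stage] by (simp add: *)
  show "((\<lambda>s. limit (VA s x)) \<longlongrightarrow> 0) at_bot"
    using goodD(4)[OF good_stage] by (simp add: *)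
  show "(\<lambda>k. limit (mul k x) / real k) \<longlonglongrightarrow> 0"
    using goodD(5)[OF good_stage] by (simp add: *)
  show "limit (mul N x) = 0" if "N \<noteq> 0"
    using goodD(6)[OF good_stage that] by (simp add: *)
  show "limit x \<le> 1" if cap
    using goodD(7)[OF good_stage that] by (simp add: *)
qed

lemma limit_base: "limit (g, 0) = p0 g"
  by (simp add: limit_stage[of 0] below_closed)

lemma countable_templates: "countable templates"
  unfolding templates_def
  by (intro countable_lists countable_SIGMA countable_D countable_pm countable_rat)

lemma ex_task:
  assumes "ts \<in> templates"
  shows "\<exists>n\<ge>n0. task n = ts"
proof (intro exI conjI)
  let ?n = "prod_encode (to_nat_on templates ts, n0)"
  show "n0 \<le> ?n"
    by (rule le_prod_encode_2)
  show "task ?n = ts"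
    using assms countable_templates by (simp add: task_def)
qed

text \<open>Extendability may be tested against \<open>limit\<close>, since this agrees with
  \<open>stage n\<close> below \<open>n\<close>. This removes an apparent circularity: the solution
  is found over the finished tower, yet it proves that round \<open>n\<close> already had one to
  choose.\<close>

lemma limit_sat:
  assumes ts: "ts \<in> templates"
    and ex: "\<And>n. (\<And>x m l u. (x, m, l, u) \<in> set ts \<Longrightarrow> below n x) \<Longrightarrow> \<exists>p'. extends n limit p' \<and> sat ts n p'"
  shows "\<exists>n. sat ts n limit"
proof -
  obtain n0 where n0: "\<forall>x\<in>fst ` set ts. below n0 x"
    using ex_below_finite[of "fst ` set ts"] by auto
  obtain n where n: "n \<ge> n0" "task n = ts"
    using ex_task[OF ts] by blast
  have b: "below n x" if "(x, m, l, u) \<in> set ts" for x m l u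
    using n0 n(1) that by (force intro: below_mono)
  obtain p' where "extends n limit p'" "sat ts n p'"
    using ex b by blast
  then have *: "\<exists>p'. extends n (stage n) p' \<and> sat (task n) n p'"
    using limit_stage n(2) unfolding extends_def by metis
  have "sat ts n (stage (Suc n))"
    using someI_ex[OF *] * n(2) by simp
  moreover have "below (Suc n) (inst n m - x)" if "(x, m, l, u) \<in> set ts" for x m l u
    by (rule below_closed(3)[OF below_closed(7) below_mono[OF b[OF that]]]) simp
  then have "limit (inst n m - x) = stage (Suc n) (inst n m - x)" if "(x, m, l, u) \<in> set ts" for x m l u
    using that by (intro limit_stage)
  ultimately have "sat ts n limit"
    unfolding sat_def by (auto simp del: stage.simps)
  then show ?thesis ..
qed

end

definition zmul :: "int \<Rightarrow> 'b::ab_group_add \<Rightarrow> 'b" where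
  "zmul k x = mul (nat k) x - mul (nat (- k)) x"

lemma additive_zmul: "additive (\<lambda>k. zmul k x)"
proof
  fix k l :: int
  have "nat (k + l) + (nat (- k) + nat (- l)) = nat (- (k + l)) + (nat k + nat l)"
    by linarith
  then have "mul (nat (k + l)) x + (mul (nat (- k)) x + mul (nat (- l)) x)
      = mul (nat (- (k + l))) x + (mul (nat k) x + mul (nat l) x)"
    by (metis mul_add_left)
  then show "zmul (k + l) x = zmul k x + zmul l x"
    by (simp add: zmul_def algebra_simps)
qed

lemma zmul_1 [simp]: "zmul 1 x = x"
  by (simp add: zmul_def)

lemma mul_zmul: "mul n (zmul k x) = zmul (int n * k) x"
proof -
  have "mul n k = int n * k"
    by (induction n) (simp_all add: algebra_simps)
  then show ?thesis
    using mul_additive[OF additive_zmul[of x], of n k] by simp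
qed

lemma zmul_cases: "zmul k x = mul (nat \<bar>k\<bar>) x \<or> zmul k x = - mul (nat \<bar>k\<bar>) x"
  by (auto simp: zmul_def abs_if)

sublocale tower \<subseteq> C: completion sub cap N VA limit
  by unfold_locales (auto intro: flow_VA good_limit)

section \<open>Extension problems over the completed tower\<close>

context tower
begin

text \<open>A smoothed amalgam over the completion, pulled back to the tower. The estimates on
  \<open>p'\<close> serve three purposes: the distance from a new generator to an old element
  \<open>x\<close>, the upper bound by \<open>Q\<close>, and, for isometric \<open>e\<close>, the
  lower bound.\<close>

lemma extension:
  fixes e :: "frag \<Rightarrow> nat \<Rightarrow> 'g \<times> (nat \<Rightarrow>\<^sub>0 (real \<Rightarrow>\<^sub>0 frag))"
  assumes e: "additive e" "\<And>h. e h \<in> C.CS"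
    and Q: "seminorm_on UNIV Q" and \<theta>: "additive \<theta>" and a: "0 < a"
    and dom: "\<And>\<tau> w. C.pB (C.VB \<tau> (e w)) \<le> \<rho> \<tau> * Q (\<theta> w)"
    and \<rho>: "\<And>\<tau>. exp \<tau> \<le> \<rho> \<tau>" "\<And>s \<tau>. \<rho> (s + \<tau>) \<le> scale s * \<rho> \<tau>" "\<And>\<tau>. \<tau> \<le> 0 \<Longrightarrow> \<rho> \<tau> \<le> 1"
      "(\<rho> \<longlongrightarrow> 0) at_bot"
    and exponent: "\<And>h. N \<noteq> 0 \<Longrightarrow> Q (mul N h) = 0"
    and small: "\<And>\<epsilon> h. 0 < \<epsilon> \<Longrightarrow> \<forall>\<^sub>F n in sequentially. \<exists>w. C.pB (e w) + Q (mul n h - \<theta> w) \<le> \<epsilon> * real n"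
  shows "\<exists>p'. extends n limit p' \<and>
    (\<forall>h x w u. below n x \<longrightarrow>
       (\<forall>\<tau>. - a < \<tau> \<longrightarrow> \<tau> \<le> 0 \<longrightarrow> C.pB (C.VB \<tau> (e w) - C.cst x) + \<rho> \<tau> * Q (h - \<theta> w) \<le> u) \<longrightarrow>
       p' (inst n h - x) \<le> u) \<and>
    (\<forall>h. p' (inst n h) \<le> Q h) \<and>
    (\<forall>h. (\<forall>w. C.pB (e w) = Q (\<theta> w)) \<longrightarrow> (cap \<longrightarrow> Q h \<le> 1) \<longrightarrow> exp (- a) * Q h \<le> p' (inst n h))"
proof -
  \<comment> \<open>\<open>amalgam\<close> works with a group filling its type, whereas
    \<open>CS\<close> is a subset of one. The old group is therefore the direct sum of the tower and
    formal translates of the images \<open>e m\<close>, with the seminorm pulled back from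
    \<open>CS\<close> along \<open>j\<close>.\<close>
  define E where "E = pm_sum (\<lambda>w m. C.VB w (e m))"
  define Vc where "Vc s z = (VA s (fst z), shift s (snd z))" for s and z :: "('g \<times> (nat \<Rightarrow>\<^sub>0 (real \<Rightarrow>\<^sub>0 frag))) \<times> (real \<Rightarrow>\<^sub>0 frag)"
  define j where "j z = C.cst (fst z) + E (snd z)" for z
  define S where "S z = C.pB (j z)" for z
  define \<psi> where "\<psi> m = (0 :: 'g \<times> (nat \<Rightarrow>\<^sub>0 (real \<Rightarrow>\<^sub>0 frag)), sg (0::real) m)" for m :: frag
  note VBD = flowD[OF C.flow_VB]
  have addE: "additive E"
    unfolding E_def by (intro additive_pm_sum additive_comp[OF VBD(1)] e)
  have E_single: "E (sg w m) = C.VB w (e m)" for w m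
    unfolding E_def by (rule pm_sum_single) (simp add: additive.zero[OF e(1)] VBD)
  have E_CS: "E z \<in> C.CS" for z
  proof -
    have "(\<Sum>w\<in>W. C.VB w (e (lk z w))) \<in> C.CS" for W
      by (induction W rule: infinite_finite_induct)
        (simp_all only: sum.infinite sum.empty sum.insert C.CSD e not_False_eq_True)
    then show ?thesis
      by (simp add: E_def pm_sum_def)
  qed
  have E_shift: "E (shift s z) = C.VB s (E z)" for s z
    by (rule pm_additive_eqI[of "\<lambda>z. E (shift s z)" "\<lambda>z. C.VB s (E z)"])
      (auto intro: additive_comp[OF addE] additive_comp[OF VBD(1)] addE flowD(1)[OF flow_shift]
        simp: E_single VBD(3)[symmetric] add.commute)
  have flow_Vc: "flow Vc"
    using flow_VA flow_shift unfolding flow_def additive_def Vc_def by simp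
  have "additive j"
    unfolding j_def additive_def
    by (simp add: additive.add[OF addE] additive.add[OF C.additive_cst])
  moreover have "j z \<in> C.CS" for z
    unfolding j_def by (intro C.CSD C.cst_CS E_CS)
  moreover have "j (Vc s z) = C.VB s (j z)" for s z
    by (simp add: j_def Vc_def E_shift C.VB_cst VBD(4))
  ultimately have good_S: "good Vc UNIV S"
    unfolding S_def[abs_def] by (rule good_pullback[OF C.good_pB])
  have S_psi: "S (b + Vc \<tau> (\<psi> w)) = C.pB (C.cst (fst b) + E (snd b) + C.VB \<tau> (e w))" for b \<tau> w
    by (simp add: S_def j_def Vc_def \<psi>_def VAD additive.add[OF addE] E_single add.assoc)
  have S_psi0: "S (Vc \<tau> (\<psi> w)) = C.pB (C.VB \<tau> (e w))" for \<tau> w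
    using S_psi[of 0 \<tau> w] by (simp add: additive.zero[OF addE] additive.zero[OF C.additive_cst])
  have S_psi1: "S (\<psi> w) = C.pB (e w)" for w
    using S_psi0[of 0 w] by (simp add: flowD(2)[OF flow_Vc] VBD(2))
  interpret am: amalgam sub cap N Vc S Q \<theta> \<psi> \<rho> a
  proof (intro amalgam.intro amalgam_axioms.intro value_class_axioms)
    show "additive \<psi>"
      by (auto simp: additive_def \<psi>_def single_add)
    show "\<forall>\<^sub>F n in sequentially. \<exists>w. S (\<psi> w) + Q (mul n h - \<theta> w) \<le> \<epsilon> * real n" if "0 < \<epsilon>" for \<epsilon> h
      using small[OF that, of h] by (simp add: S_psi1)
  qed (use flow_Vc good_S Q \<theta> a dom \<rho> exponent in \<open>auto simp: S_psi0\<close>)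
  \<comment> \<open>Rounds before \<open>n\<close> are read as old elements and round
    \<open>n\<close> as the new generators. Hence the pullback agrees with \<open>limit\<close>
    below \<open>n\<close>, although the amalgam was formed over the whole tower.\<close>
  define g where "g x = ((lo n x, 0 :: real \<Rightarrow>\<^sub>0 frag), lk (snd x) n)" for x
  have "additive g"
    unfolding additive_def g_def by (simp add: additive.add[OF additive_lo] lookup_add)
  moreover have "g (VA s x) = am.Vp s (g x)" for s x
    unfolding g_def am.Vp_def Vc_def
    by (simp add: lo_VA flowD(5)[OF flow_shift]) (simp add: VA_def lookup_pm_map[OF flowD(1)[OF flow_shift]])
  ultimately have good: "good VA UNIV (\<lambda>x. am.capped_avg (g x))"
    by (intro good_pullback[OF am.good_capped_avg]) auto
  have S0: "S (x, 0) = limit x" for x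
    by (simp add: S_def j_def additive.zero[OF addE])
  have g_inst: "g (inst n h - x) = ((- x, 0), sg 0 h)" if "below n x" for h x
  proof -
    have "lk (snd x) n = 0"
      using that by (simp add: below_def)
    then show ?thesis
      by (simp add: g_def additive.diff[OF additive_lo] lo_inst lo_below[OF that] lookup_minus)
  qed
  have g_inst0: "g (inst n h) = (0, sg 0 h)" for h
    using g_inst[OF below_closed(5), of h] by (simp flip: zero_prod_def)
  show ?thesis
  proof (intro exI[of _ "\<lambda>x. am.capped_avg (g x)"] conjI allI impI)
    show "extends n limit (\<lambda>x. am.capped_avg (g x))"
      unfolding extends_def
    proof (intro conjI allI impI good)
      fix x assume x: "below n x"
      then have "g x = ((x, 0), 0)"
        by (simp add: g_def lo_below) (simp add: below_def)
      then show "am.capped_avg (g x) = limit x"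
        by (simp add: am.capped_avg_zero_right S0)
    qed
    show "am.capped_avg (g (inst n h - x)) \<le> u"
      if x: "below n x" and le: "\<forall>\<tau>. - a < \<tau> \<longrightarrow> \<tau> \<le> 0 \<longrightarrow> C.pB (C.VB \<tau> (e w) - C.cst x) + \<rho> \<tau> * Q (h - \<theta> w) \<le> u"
      for h x w u
      unfolding g_inst[OF x]
    proof (rule am.capped_avg_single_le)
      fix \<tau> assume "- a < \<tau>" "\<tau> \<le> 0"
      then show "S ((- x, 0) + Vc \<tau> (\<psi> w)) + \<rho> \<tau> * Q (h - \<theta> w) \<le> u"
        using le by (simp add: S_psi additive.zero[OF addE] additive.minus[OF C.additive_cst])
    qed
    show "am.capped_avg (g (inst n h)) \<le> Q h" for h
      unfolding g_inst0 by (rule am.capped_avg_single_cost_le)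
    show "exp (- a) * Q h \<le> am.capped_avg (g (inst n h))"
      if "\<forall>w. C.pB (e w) = Q (\<theta> w)" "cap \<longrightarrow> Q h \<le> 1" for h
      unfolding g_inst0 by (rule am.capped_avg_single_ge) (use that in \<open>auto simp: S_psi1\<close>)
  qed
qed

lemma ex_small_time:
  assumes W: "finite W" "\<And>X. X \<in> W \<Longrightarrow> X \<in> C.CS" and d: "0 < d"
  shows "\<exists>a>0. \<forall>X\<in>W. \<forall>\<tau>. - a < \<tau> \<longrightarrow> \<tau> \<le> 0 \<longrightarrow> C.pB (C.VB \<tau> X - X) \<le> d"
proof -
  have "\<forall>\<^sub>F s in at 0. \<forall>X\<in>W. C.pB (C.VB s X - X) < d"
    by (intro eventually_ball_finite W ballI order_tendstoD(2)[OF goodD(3)[OF C.good_pB] d])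
  then obtain a where a: "0 < a" "\<And>s. s \<noteq> 0 \<Longrightarrow> \<bar>s\<bar> < a \<Longrightarrow> \<forall>X\<in>W. C.pB (C.VB s X - X) < d"
    unfolding eventually_at by auto
  have "C.pB (C.VB \<tau> X - X) \<le> d" if "X \<in> W" "- a < \<tau>" "\<tau> \<le> 0" for X \<tau>
  proof (cases "\<tau> = 0")
    case True
    then show ?thesis
      using d by (simp only: flowD(2)[OF C.flow_VB] diff_self C.pBD(1))
  next
    case False
    then show ?thesis
      using a(2)[of \<tau>] that by auto
  qed
  then show ?thesis
    using a(1) by blast
qed

lemma D_dense_CS:
  assumes "X \<in> C.CS" "0 < \<epsilon>"
  shows "\<exists>d\<in>D. C.pB (X - C.cst d) < \<epsilon>"
proof -
  have e2: "0 < \<epsilon> / 2"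
    using assms by simp
  obtain x where x: "C.pB (X - C.cst x) < \<epsilon> / 2"
    using C.cst_dense[OF assms(1) e2] by blast
  obtain d where d: "d \<in> D" "limit (x - d) < \<epsilon> / 2"
    using D_dense[OF good_limit limit_base e2] by blast
  have "C.pB (X - C.cst d) \<le> C.pB (X - C.cst x) + C.pB (C.cst x - C.cst d)"
    by (rule C.pBD(9)) (auto simp: assms)
  then have "C.pB (X - C.cst d) < \<epsilon>"
    using x d by (simp only: additive.diff[OF C.additive_cst, symmetric] C.pB_cst)
  then show ?thesis
    using d by blast
qed

text \<open>\<open>extension\<close> solves the problem up to the factor exp a, and a task transfers
  the solution to the tower up to rational errors. \<open>R\<close> represents all images modulo
  null elements; it is finite because \<open>\<rho>\<close> can be adapted to finitely many elements
  by \<open>ex_rho\<close>.\<close>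

lemma approximate_extension:
  fixes e :: "frag \<Rightarrow> nat \<Rightarrow> 'g \<times> (nat \<Rightarrow>\<^sub>0 (real \<Rightarrow>\<^sub>0 frag))"
  assumes e: "additive e" "\<And>h. e h \<in> C.CS"
    and Q: "seminorm_on UNIV Q" and \<theta>: "additive \<theta>" and iso: "\<And>w. C.pB (e w) = Q (\<theta> w)"
    and R: "finite R" "\<And>w. \<exists>w'\<in>R. C.pB (e (w - w')) = 0"
    and bounded: "\<And>h. Q h \<le> K" and capped: "\<And>h. cap \<Longrightarrow> Q h \<le> 1"
    and exponent: "\<And>h. N \<noteq> 0 \<Longrightarrow> Q (mul N h) = 0"
    and fin: "finite H" "finite W" and \<epsilon>: "0 < \<epsilon>" "\<epsilon> < 1"
  shows "\<exists>n. (\<forall>h\<in>H. (1 - \<epsilon>) * Q h \<le> limit (inst n h) \<and> limit (inst n h) \<le> (1 + \<epsilon>) * Q h) \<and>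
    (\<forall>w\<in>W. C.pB (e w - C.cst (inst n (\<theta> w))) \<le> \<epsilon>)"
proof -
  note QD = seminorm_onD[OF Q flow_subgroup_UNIV, simplified]
  have e4: "0 < \<epsilon> / 4"
    using \<epsilon> by simp
  have "\<And>X. X \<in> e ` W \<Longrightarrow> X \<in> C.CS"
    using e(2) by blast
  from ex_small_time[OF finite_imageI[OF fin(2)] this e4]
  obtain a1 where a1: "0 < a1" "\<And>w \<tau>. w \<in> W \<Longrightarrow> - a1 < \<tau> \<Longrightarrow> \<tau> \<le> 0 \<Longrightarrow> C.pB (C.VB \<tau> (e w) - e w) \<le> \<epsilon> / 4"
    by blast
  \<comment> \<open>\<open>a1\<close> keeps the images of \<open>W\<close> nearly fixed under
    rounding. The logarithm gives exp (- a) >= 1 - \<epsilon> / 2, strictly above 1 - \<epsilon>,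
    which leaves room for a rational lower bound.\<close>
  define a where "a = min a1 (- ln (1 - \<epsilon> / 2))"
  have a: "0 < a" "a \<le> a1" "1 - \<epsilon> < exp (- a)"
  proof -
    have "ln (1 - \<epsilon> / 2) < 0"
      using \<epsilon> by simp
    then show "0 < a" "a \<le> a1"
      using a1(1) by (auto simp: a_def)
    have "1 - \<epsilon> < exp (ln (1 - \<epsilon> / 2))"
      using \<epsilon> by simp
    also have "\<dots> \<le> exp (- a)"
      by (simp add: a_def)
    finally show "1 - \<epsilon> < exp (- a)" .
  qed
  \<comment> \<open>\<open>ex_rho\<close> divides by the bound, so only representatives of positive
    seminorm enter. Null elements stay null under the flow and are treated by
    \<open>null\<close>.\<close>
  let ?F = "{(e w, Q (\<theta> w)) | w. w \<in> R \<and> 0 < Q (\<theta> w)}"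
  have finF: "finite ?F"
    using R(1) by (simp add: setcompr_eq_image)
  have inF: "x \<in> C.CS \<and> 0 < c \<and> C.pB x \<le> c" if "(x, c) \<in> ?F" for x c
    using that e(2) by (auto simp: iso)
  from ex_rho[OF C.flow_VB C.flow_subgroup_CS C.good_pB finF inF] obtain \<rho> where \<rho>: "\<And>\<tau>. exp \<tau> \<le> \<rho> \<tau>" "\<And>s \<tau>. \<rho> (s + \<tau>) \<le> scale s * \<rho> \<tau>"
    "\<And>\<tau>. \<tau> \<le> 0 \<Longrightarrow> \<rho> \<tau> \<le> 1" "(\<rho> \<longlongrightarrow> 0) at_bot" "\<forall>(x, c)\<in>?F. \<forall>\<tau>. C.pB (C.VB \<tau> x) \<le> \<rho> \<tau> * c"
    by blast
  have null: "C.pB (C.VB \<tau> X) = 0" if "X \<in> C.CS" "C.pB X = 0" for \<tau> X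
    using goodD(2)[OF C.good_pB that(1), of \<tau>] C.pBD(5)[OF C.CSD(5)[OF that(1), of \<tau>]] that(2) by simp
  have dom: "C.pB (C.VB \<tau> (e w)) \<le> \<rho> \<tau> * Q (\<theta> w)" for \<tau> w
  proof (cases "Q (\<theta> w) = 0")
    case True
    then show ?thesis
      using null[OF e(2), of w \<tau>] by (simp add: iso)
  next
    case False
    obtain w' where w': "w' \<in> R" "C.pB (e (w - w')) = 0"
      using R(2) by blast
    have "Q (\<theta> w) \<le> Q (\<theta> w') + Q (\<theta> w - \<theta> w')" "Q (\<theta> w') \<le> Q (\<theta> w) + Q (\<theta> w - \<theta> w')"
      using QD(7)[of "\<theta> w" "\<theta> w'"] QD(7)[of "\<theta> w'" "\<theta> w"] QD(6)[of "\<theta> w" "\<theta> w'"] by simp_all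
    moreover have "Q (\<theta> w - \<theta> w') = 0"
      using w'(2) by (simp add: iso additive.diff[OF \<theta>])
    ultimately have eq: "Q (\<theta> w) = Q (\<theta> w')"
      by simp
    have "C.pB (C.VB \<tau> (e w)) \<le> C.pB (C.VB \<tau> (e w')) + C.pB (C.VB \<tau> (e (w - w')))"
      using C.pBD(3)[OF C.CSD(5)[OF e(2)] C.CSD(5)[OF e(2)], of \<tau> w' \<tau> "w - w'"]
      by (simp only: flowD(4)[OF C.flow_VB, symmetric] additive.add[OF e(1), symmetric] add_diff_cancel_left' diff_add_cancel add.commute[of w'])
    also have "C.pB (C.VB \<tau> (e (w - w'))) = 0"
      by (rule null[OF e(2) w'(2)])
    also have "C.pB (C.VB \<tau> (e w')) \<le> \<rho> \<tau> * Q (\<theta> w')"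
    proof -
      have "(e w', Q (\<theta> w')) \<in> ?F"
        using False eq w'(1) QD(5)[of "\<theta> w"] by auto
      then show ?thesis
        using \<rho>(5) by blast
    qed
    finally show ?thesis
      by (simp add: eq)
  qed
  have small: "\<forall>\<^sub>F n in sequentially. \<exists>w. C.pB (e w) + Q (mul n h - \<theta> w) \<le> \<epsilon>' * real n" if "0 < \<epsilon>'" for \<epsilon>' h
  proof -
    obtain n0 where n0: "K / \<epsilon>' < real n0"
      using reals_Archimedean2 by blast
    have "\<exists>w. C.pB (e w) + Q (mul n h - \<theta> w) \<le> \<epsilon>' * real n" if "n \<ge> n0" for n
    \<comment> \<open>Since \<open>Q\<close> is bounded by \<open>K\<close>, the zero relation is
      good enough for large \<open>n\<close>.\<close>
    proof (rule exI[of _ 0])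
      have "K / \<epsilon>' \<le> real n"
        using n0 that by (simp add: order_trans[of _ "real n0"])
      then have "K \<le> \<epsilon>' * real n"
        using \<open>0 < \<epsilon>'\<close> by (simp add: field_simps)
      then show "C.pB (e 0) + Q (mul n h - \<theta> 0) \<le> \<epsilon>' * real n"
        using bounded[of "mul n h"] by (simp add: iso additive.zero[OF \<theta>] QD)
    qed
    then show ?thesis
      unfolding eventually_sequentially by blast
  qed
  have "\<exists>l u. l \<in> \<rat> \<and> u \<in> \<rat> \<and> (1 - \<epsilon>) * Q h \<le> l \<and> l \<le> exp (- a) * Q h \<and> Q h \<le> u \<and> u \<le> (1 + \<epsilon>) * Q h" for h
  proof (cases "Q h = 0")
    case True
    then show ?thesis
      by (intro exI[of _ 0]) auto
  next
    case False
    then have "0 < Q h"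
      using QD(5)[of h] by simp
    then have "(1 - \<epsilon>) * Q h < exp (- a) * Q h" "Q h < (1 + \<epsilon>) * Q h"
      using a \<epsilon> by auto
    from Rats_dense_in_real[OF this(1)] Rats_dense_in_real[OF this(2)] show ?thesis
      by (meson less_imp_le)
  qed
  then obtain l u where lu: "\<And>h. l h \<in> \<rat>" "\<And>h. u h \<in> \<rat>" "\<And>h. (1 - \<epsilon>) * Q h \<le> l h" "\<And>h. l h \<le> exp (- a) * Q h"
    "\<And>h. Q h \<le> u h" "\<And>h. u h \<le> (1 + \<epsilon>) * Q h"
    by metis
  have "\<exists>d\<in>D. C.pB (e w - C.cst d) < \<epsilon> / 4" for w
    by (rule D_dense_CS[OF e(2) e4])
  then obtain d where d: "\<And>w. d w \<in> D" "\<And>w. C.pB (e w - C.cst (d w)) < \<epsilon> / 4"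
    by metis
  \<comment> \<open>\<epsilon> / 2 covers the time rounding and the error of \<open>d w\<close>,
    each \<epsilon> / 4; below 3 \<epsilon> / 4, the detour over \<open>d w\<close> still ends
    within \<epsilon>.\<close>
  obtain \<eta> where \<eta>: "\<eta> \<in> \<rat>" "\<epsilon> / 2 < \<eta>" "\<eta> < 3 * \<epsilon> / 4"
    using Rats_dense_in_real[of "\<epsilon> / 2" "3 * \<epsilon> / 4"] \<epsilon> by auto
  \<comment> \<open>Centre 0 prescribes the seminorms of the elements of \<open>H\<close>; the
    entries from \<open>W\<close> bring \<open>\<theta> w\<close> close to \<open>e w\<close> by way
    of \<open>d w\<close>.\<close>
  obtain ts where ts: "set ts = (\<lambda>h. (0, h, l h, u h)) ` H \<union> (\<lambda>w. (d w, \<theta> w, 0, \<eta>)) ` W"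
    using fin finite_list[of "(\<lambda>h. (0, h, l h, u h)) ` H \<union> (\<lambda>w. (d w, \<theta> w, 0, \<eta>)) ` W"] by auto
  have "ts \<in> templates"
    unfolding templates_def using ts lu d \<eta> D_zero by auto
  moreover have "\<exists>p'. extends n limit p' \<and> sat ts n p'"
    if below: "\<And>x m l u. (x, m, l, u) \<in> set ts \<Longrightarrow> below n x" for n
  proof -
    obtain p' where p': "extends n limit p'"
      "\<And>h x w u. below n x \<Longrightarrow>
       (\<And>\<tau>. - a < \<tau> \<Longrightarrow> \<tau> \<le> 0 \<Longrightarrow> C.pB (C.VB \<tau> (e w) - C.cst x) + \<rho> \<tau> * Q (h - \<theta> w) \<le> u) \<Longrightarrow>
       p' (inst n h - x) \<le> u"
      "\<And>h. p' (inst n h) \<le> Q h" "\<And>h. exp (- a) * Q h \<le> p' (inst n h)"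
      using extension[OF e Q \<theta> a(1) dom \<rho>(1-4) exponent small, of n] iso capped by blast
    have "p' (inst n (\<theta> w) - d w) \<le> \<eta>" if w: "w \<in> W" for w
    proof (rule p'(2)[of "d w" w])
      show "below n (d w)"
        by (rule below[of _ "\<theta> w" 0 \<eta>]) (use ts w in blast)
      fix \<tau> assume "- a < \<tau>" "\<tau> \<le> 0"
      then have "C.pB (C.VB \<tau> (e w) - e w) \<le> \<epsilon> / 4"
        using a(2) by (intro a1(2)[OF w]) auto
      moreover have "C.pB (C.VB \<tau> (e w) - C.cst (d w)) \<le> C.pB (C.VB \<tau> (e w) - e w) + C.pB (e w - C.cst (d w))"
        by (rule C.pBD(9)) (auto intro!: e(2) C.CSD(5))
      ultimately show "C.pB (C.VB \<tau> (e w) - C.cst (d w)) + \<rho> \<tau> * Q (\<theta> w - \<theta> w) \<le> \<eta>"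
        using d(2)[of w] \<eta> by (simp only: diff_self QD(1))
    qed
    moreover have "0 \<le> p' x" for x
      using p'(1) seminorm_onD(5)[OF goodD(1) flow_subgroup_UNIV, of VA p' x] unfolding extends_def by simp
    moreover have "l h \<le> p' (inst n h)" "p' (inst n h) \<le> u h" for h
      using order_trans[OF lu(4) p'(4)] order_trans[OF p'(3) lu(5)] by blast+
    ultimately have "sat ts n p'"
      unfolding sat_def ts by (simp add: ball_Un del: split_paired_All)
    then show ?thesis
      using p'(1) by blast
  qed
  ultimately obtain n where n: "sat ts n limit"
    using limit_sat by blast
  show ?thesis
  proof (intro exI[of _ n] conjI ballI)
    fix h assume "h \<in> H"
    then have "l h \<le> limit (inst n h)" "limit (inst n h) \<le> u h"
      using n unfolding sat_def ts by (simp_all add: ball_Un)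
    then show "(1 - \<epsilon>) * Q h \<le> limit (inst n h)" "limit (inst n h) \<le> (1 + \<epsilon>) * Q h"
      using lu by (auto intro: order_trans)
  next
    fix w assume "w \<in> W"
    then have "limit (inst n (\<theta> w) - d w) \<le> \<eta>"
      using n unfolding sat_def ts by (simp_all add: ball_Un)
    then have "C.pB (C.cst (d w) - C.cst (inst n (\<theta> w))) \<le> \<eta>"
      using C.pD(6)[of "inst n (\<theta> w)" "d w"] by (simp only: additive.diff[OF C.additive_cst, symmetric] C.pB_cst)
    moreover have "C.pB (e w - C.cst (inst n (\<theta> w))) \<le> C.pB (e w - C.cst (d w)) + C.pB (C.cst (d w) - C.cst (inst n (\<theta> w)))"
      by (rule C.pBD(9)) (auto intro!: e(2))
    ultimately show "C.pB (e w - C.cst (inst n (\<theta> w))) \<le> \<epsilon>"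
      using d(2)[of w] \<eta> by linarith
  qed
qed


lemma zmul_CS: "X \<in> C.CS \<Longrightarrow> zmul k X \<in> C.CS"
  unfolding zmul_def by (intro C.CSD)

lemma pB_VB_zmul:
  assumes "X \<in> C.CS"
  shows "C.pB (C.VB \<tau> (zmul l X)) = C.pB (C.VB \<tau> (mul (nat \<bar>l\<bar>) X))"
  using zmul_cases[of l X]
proof
  assume "zmul l X = - mul (nat \<bar>l\<bar>) X"
  then show ?thesis
    using C.pBD(2)[OF C.CSD(5)[OF C.CSD(6)[OF assms]], of \<tau> "nat \<bar>l\<bar>"]
    by (simp only: flowD(6)[OF C.flow_VB])
qed simp

text \<open>An element \<open>X\<close> of sublinear growth is \<open>\<epsilon>\<close>-close to a new generator of large order \<open>k\<close>: in the group
  generated by that generator (index 0) and its difference to \<open>X\<close> (index 1), the cost \<open>c\<close> of an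
  element that is not a multiple of \<open>k\<close> only has to dominate the finitely many multiples \<open>r X\<close>, \<open>r < k\<close>.\<close>

lemma torsion_dense:
  assumes N0: "N = 0" and X: "X \<in> C.CS" and \<epsilon>: "0 < \<epsilon>"
  shows "\<exists>k>0. \<exists>y. limit (mul k y) = 0 \<and> C.pB (X - C.cst y) < \<epsilon>"
proof -
  \<comment> \<open>The time rounding, the error of \<open>d\<close> and the \<open>Q\<close> of the
    index-1 generator contribute \<open>\<delta>\<close> each, so \<open>u\<close> must exceed 3
    \<delta>; with u < 4 \<delta> and one more \<delta> for the way from \<open>X\<close> to
    \<open>d\<close>, the total stays below \<epsilon>.\<close>
  define \<delta> where "\<delta> = \<epsilon> / 8"
  have \<delta>: "0 < \<delta>"
    using \<epsilon> by (simp add: \<delta>_def)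
  have "\<forall>\<^sub>F n in sequentially. C.pB (mul n X) / real n < \<delta>"
    by (rule order_tendstoD(2)[OF goodD(5)[OF C.good_pB X] \<delta>])
  then have "\<forall>\<^sub>F n in sequentially. 0 < n \<and> C.pB (mul n X) / real n < \<delta>"
    using eventually_gt_at_top[of 0] by eventually_elim auto
  then obtain k where k: "0 < k" "C.pB (mul k X) / real k < \<delta>"
    by (auto simp: eventually_sequentially)
  then have k': "C.pB (mul k X) \<le> real k * \<delta>"
    by (simp add: field_simps)
  have X_CS: "mul n X \<in> C.CS" for n
    by (rule C.CSD(6)[OF X])
  define c where "c = 1 + (\<Sum>r<k. C.pB (mul r X))"
  have c: "0 < c" "r < k \<Longrightarrow> C.pB (mul r X) \<le> c" for r
  proof -
    show "0 < c"
      unfolding c_def by (intro add_pos_nonneg sum_nonneg C.pBD(5) X_CS) simp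
    show "r < k \<Longrightarrow> C.pB (mul r X) \<le> c"
      unfolding c_def using member_le_sum[of r "{..<k}" "\<lambda>r. C.pB (mul r X)"] C.pBD(5)[OF X_CS] by simp
  qed
  \<comment> \<open>Coordinate 0 counts modulo \<open>k\<close>, coordinate 1 has the linear weight
    \<open>\<delta>\<close>. \<open>\<theta> w\<close> is \<open>lk w 0\<close> times the sum of
    both generators and \<open>e w\<close> the same multiple of \<open>X\<close>; so
    \<open>X\<close> becomes the torsion generator plus an element of size
    \<open>\<delta>\<close>.\<close>
  define Q where "Q m = (if int k dvd lk m 0 then 0 else c) + \<delta> * real_of_int \<bar>lk m 1\<bar>" for m :: frag
  define \<theta> where "\<theta> w = (sg 0 (lk w 0) + sg 1 (lk w 0) :: frag)" for w :: frag
  define e where "e w = zmul (lk w 0) X" for w :: frag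
  have Q: "seminorm_on UNIV Q"
    unfolding seminorm_on_def
  proof (intro conjI ballI)
    fix x y :: frag
    have "real_of_int \<bar>lk (x + y) 1\<bar> \<le> real_of_int \<bar>lk x 1\<bar> + real_of_int \<bar>lk y 1\<bar>"
      by (simp add: lookup_add)
    then have "\<delta> * real_of_int \<bar>lk (x + y) 1\<bar> \<le> \<delta> * real_of_int \<bar>lk x 1\<bar> + \<delta> * real_of_int \<bar>lk y 1\<bar>"
      using \<delta> by (simp add: distrib_left[symmetric])
    moreover have "(if int k dvd lk (x + y) 0 then 0 else c)
        \<le> (if int k dvd lk x 0 then 0 else c) + (if int k dvd lk y 0 then 0 else c)"
      using c(1) by (auto simp: lookup_add)
    ultimately show "Q (x + y) \<le> Q x + Q y"
      by (simp add: Q_def)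
  qed (auto simp: Q_def)
  have Qk: "Q (sg 0 (int k)) = 0"
    by (simp add: Q_def lookup_single del: single_of_nat)
  have \<theta>: "additive \<theta>"
    by standard (simp add: \<theta>_def lookup_add single_add)
  have e: "additive e" "\<And>h. e h \<in> C.CS"
    unfolding e_def using additive_comp[OF additive_zmul additive_lookup] zmul_CS[OF X] by auto
  let ?F = "insert (mul k X, real k * \<delta>) ((\<lambda>r. (mul r X, c)) ` {..<k})"
  have inF: "x \<in> C.CS \<and> 0 < u \<and> C.pB x \<le> u" if "(x, u) \<in> ?F" for x u
    using that X_CS k k' \<delta> c by auto
  have finF: "finite ?F"
    by simp
  from ex_rho[OF C.flow_VB C.flow_subgroup_CS C.good_pB finF inF] obtain \<rho> where
    \<rho>: "\<And>\<tau>. exp \<tau> \<le> \<rho> \<tau>" "\<And>s \<tau>. \<rho> (s + \<tau>) \<le> scale s * \<rho> \<tau>"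
    "\<And>\<tau>. \<tau> \<le> 0 \<Longrightarrow> \<rho> \<tau> \<le> 1" "(\<rho> \<longlongrightarrow> 0) at_bot" "\<forall>(x, u)\<in>?F. \<forall>\<tau>. C.pB (C.VB \<tau> x) \<le> \<rho> \<tau> * u"
    by blast
  have \<rho>k: "C.pB (C.VB \<tau> (mul k X)) \<le> \<rho> \<tau> * (real k * \<delta>)" for \<tau>
    using \<rho>(5) by blast
  have \<rho>r: "C.pB (C.VB \<tau> (mul r X)) \<le> \<rho> \<tau> * c" if "r < k" for \<tau> r
    using \<rho>(5) that by blast
  have \<rho>0: "0 \<le> \<rho> \<tau>" for \<tau>
    using \<rho>(1)[of \<tau>] exp_gt_zero[of \<tau>] by linarith
  have dom: "C.pB (C.VB \<tau> (e w)) \<le> \<rho> \<tau> * Q (\<theta> w)" for \<tau> w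
  proof -
    \<comment> \<open>Division with remainder by \<open>k\<close>: each full block
      \<open>mul k X\<close> has seminorm at most k \<delta> and is paid by coordinate 1; the
      remainder is paid by \<open>c\<close> from coordinate 0.\<close>
    define L q r where "L = nat \<bar>lk w 0\<bar>" and "q = L div k" and "r = L mod k"
    have L: "L = q * k + r" "r < k"
      using k(1) by (auto simp: q_def r_def)
    have dvd: "int k dvd lk w 0 \<longleftrightarrow> r = 0"
    proof -
      have "int k dvd lk w 0 \<longleftrightarrow> int k dvd int L"
        by (simp add: L_def)
      then show ?thesis
        by (simp add: r_def dvd_eq_mod_eq_0 del: of_nat_dvd_iff flip: of_nat_mod)
    qed
    have Qw: "Q (\<theta> w) = (if r = 0 then 0 else c) + \<delta> * real L"
      by (simp add: Q_def \<theta>_def lookup_add lookup_single dvd[symmetric] L_def)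
    have "C.pB (C.VB \<tau> (e w)) = C.pB (C.VB \<tau> (mul L X))"
      unfolding e_def L_def by (rule pB_VB_zmul[OF X])
    also have "C.VB \<tau> (mul L X) = mul q (C.VB \<tau> (mul k X)) + C.VB \<tau> (mul r X)"
      unfolding L(1) mul_add_left mul_mul[symmetric]
      by (simp only: flowD(4)[OF C.flow_VB] mul_additive[OF flowD(1)[OF C.flow_VB]])
    also have "C.pB \<dots> \<le> C.pB (mul q (C.VB \<tau> (mul k X))) + C.pB (C.VB \<tau> (mul r X))"
      by (intro C.pBD(3) C.CSD X)
    also have "C.pB (mul q (C.VB \<tau> (mul k X))) \<le> real q * (\<rho> \<tau> * (real k * \<delta>))"
      by (rule order_trans[OF seminorm_mul_le[OF C.seminorm_pB C.flow_subgroup_CS]])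
        (auto intro!: C.CSD X mult_left_mono \<rho>k)
    also have "C.pB (C.VB \<tau> (mul r X)) \<le> \<rho> \<tau> * (if r = 0 then 0 else c)"
    proof (cases "r = 0")
      case True
      then show ?thesis
        by (simp only: mul.simps flowD(5)[OF C.flow_VB] C.pBD(1) simp_thms if_True mult_zero_right order_refl)
    qed (use \<rho>r[OF L(2)] in simp)
    also have "real q * (\<rho> \<tau> * (real k * \<delta>)) + \<rho> \<tau> * (if r = 0 then 0 else c) \<le> \<rho> \<tau> * Q (\<theta> w)"
    proof -
      have "real q * real k \<le> real L"
        by (simp add: L(1))
      then have "(real q * real k) * \<delta> \<le> real L * \<delta>"
        using \<delta> by (intro mult_right_mono) auto
      then have "\<rho> \<tau> * ((real q * real k) * \<delta> + (if r = 0 then 0 else c)) \<le> \<rho> \<tau> * Q (\<theta> w)"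
        unfolding Qw using \<rho>0[of \<tau>] by (intro mult_left_mono) (auto simp: mult.commute)
      then show ?thesis
        by (simp add: algebra_simps)
    qed
    finally show ?thesis by simp
  qed
  have small: "\<forall>\<^sub>F n in sequentially. \<exists>w. C.pB (e w) + Q (mul n h - \<theta> w) \<le> \<epsilon>' * real n" if "0 < \<epsilon>'" for \<epsilon>' h
  proof -
    have e2: "0 < \<epsilon>' / 2"
      using that by simp
    have "\<forall>\<^sub>F n in sequentially. c / real n < \<epsilon>' / 2"
      by (rule order_tendstoD(2)[OF lim_const_over_n e2])
    moreover have "\<forall>\<^sub>F n in sequentially. C.pB (mul n (zmul (lk h 1) X)) / real n < \<epsilon>' / 2"
      by (rule order_tendstoD(2)[OF goodD(5)[OF C.good_pB zmul_CS[OF X]] e2])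
    ultimately show ?thesis
      using eventually_gt_at_top[of 0]
    proof eventually_elim
      case (elim n)
      \<comment> \<open>This relation cancels coordinate 1 of the n-fold of \<open>h\<close>, so
        that \<open>Q\<close> leaves at most \<open>c\<close>. What is traded in is the n-fold of a
        fixed multiple of \<open>X\<close>, which grows sublinearly.\<close>
      let ?w = "sg 0 (int n * lk h 1) :: frag"
      have lk_mul: "lk (mul n h) 1 = int n * lk h 1"
        by (induction n) (simp_all add: lookup_add algebra_simps)
      have "lk (mul n h - \<theta> ?w) 1 = 0"
        by (simp add: \<theta>_def lookup_minus lookup_add lookup_single lk_mul[simplified])
      then have "Q (mul n h - \<theta> ?w) \<le> c"
        using c(1) by (simp add: Q_def)
      moreover have "e ?w = mul n (zmul (lk h 1) X)"
        by (simp add: e_def mul_zmul)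
      ultimately have "C.pB (e ?w) + Q (mul n h - \<theta> ?w) \<le> \<epsilon>' / 2 * real n + \<epsilon>' / 2 * real n"
        using elim by (intro add_mono) (simp_all add: field_simps)
      then show ?case
        by (intro exI[of _ ?w]) (simp add: field_simps)
    qed
  qed
  obtain d where d: "d \<in> D" "C.pB (X - C.cst d) < \<delta>"
    using D_dense_CS[OF X \<delta>] by blast
  obtain a where a: "0 < a" "\<And>\<tau>. - a < \<tau> \<Longrightarrow> \<tau> \<le> 0 \<Longrightarrow> C.pB (C.VB \<tau> X - X) \<le> \<delta>"
    using ex_small_time[of "{X}", OF _ _ \<delta>] X by auto
  obtain u where u: "u \<in> \<rat>" "3 * \<delta> < u" "u < 4 * \<delta>"
    using Rats_dense_in_real[of "3 * \<delta>" "4 * \<delta>"] \<delta> by auto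
  \<comment> \<open>The bounds 0 and 0 make the k-fold generator null, hence the generator genuinely
    torsion in the quotient; the second entry places it near \<open>X\<close> through
    \<open>d\<close>.\<close>
  define ts where "ts = [(0, sg 0 (int k) :: frag, 0 :: real, 0), (d, sg 0 1, 0, u)]"
  have "ts \<in> templates"
    unfolding templates_def ts_def using d u D_zero by auto
  moreover have "\<exists>p'. extends n limit p' \<and> sat ts n p'"
    if below: "\<And>x m l u. (x, m, l, u) \<in> set ts \<Longrightarrow> below n x" for n
  proof -
    obtain p' where p': "extends n limit p'"
      "\<And>h x w u. below n x \<Longrightarrow>
       (\<And>\<tau>. - a < \<tau> \<Longrightarrow> \<tau> \<le> 0 \<Longrightarrow> C.pB (C.VB \<tau> (e w) - C.cst x) + \<rho> \<tau> * Q (h - \<theta> w) \<le> u) \<Longrightarrow>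
       p' (inst n h - x) \<le> u"
      "\<And>h. p' (inst n h) \<le> Q h"
      using extension[OF e Q \<theta> a(1) dom \<rho>(1-4) _ small, of n] N0 by blast
    have "p' (inst n (sg 0 1) - d) \<le> u"
    proof (rule p'(2)[of d "sg 0 1"])
      show "below n d"
        by (rule below[of _ "sg 0 1" 0 u]) (simp add: ts_def)
      fix \<tau> assume \<tau>: "- a < \<tau>" "\<tau> \<le> 0"
      have "C.pB (C.VB \<tau> X - C.cst d) \<le> C.pB (C.VB \<tau> X - X) + C.pB (X - C.cst d)"
        by (rule C.pBD(9)) (auto intro!: X C.CSD(5))
      moreover have "\<rho> \<tau> * Q (sg 0 1 - \<theta> (sg 0 1)) \<le> 1 * \<delta>"
        using \<rho>(3)[OF \<tau>(2)] \<rho>0[of \<tau>] \<delta>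
        by (intro mult_mono) (auto simp: Q_def \<theta>_def lookup_minus lookup_add lookup_single)
      moreover have "e (sg 0 1) = X"
        by (simp add: e_def)
      ultimately show "C.pB (C.VB \<tau> (e (sg 0 1)) - C.cst d) + \<rho> \<tau> * Q (sg 0 1 - \<theta> (sg 0 1)) \<le> u"
        using a(2)[OF \<tau>] d(2) u(2) by simp
    qed
    moreover have "p' (inst n (sg 0 (int k))) \<le> 0"
      using p'(3)[of "sg 0 (int k)"] unfolding Qk .
    moreover have "0 \<le> p' x" for x
      using p'(1) seminorm_onD(5)[OF goodD(1) flow_subgroup_UNIV, of VA p' x] unfolding extends_def by simp
    ultimately have "sat ts n p'"
      unfolding sat_def ts_def by simp
    then show ?thesis
      using p'(1) by blast
  qed
  ultimately obtain n where "sat ts n limit"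
    using limit_sat by blast
  then have n: "limit (inst n (sg 0 (int k))) \<le> 0" "0 \<le> limit (inst n (sg 0 (int k)))" "limit (inst n (sg 0 1) - d) \<le> u"
    unfolding sat_def ts_def by simp_all
  let ?y = "inst n (sg 0 1)"
  have "mul k (1::int) = int k"
    by (induction k) simp_all
  then have "mul k ?y = inst n (sg 0 (int k))"
    by (simp only: mul_additive[OF additive_inst, symmetric] mul_single)
  then have "limit (mul k ?y) = 0"
    using n by simp
  moreover have "C.pB (X - C.cst ?y) < \<epsilon>"
  proof -
    have "C.pB (C.cst d - C.cst ?y) \<le> u"
      using n(3) C.pD(6)[of ?y d] by (simp only: additive.diff[OF C.additive_cst, symmetric] C.pB_cst)
    moreover have "C.pB (X - C.cst ?y) \<le> C.pB (X - C.cst d) + C.pB (C.cst d - C.cst ?y)"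
      by (rule C.pBD(9)) (auto intro!: X)
    ultimately show ?thesis
      using d(2) u(3) \<epsilon> unfolding \<delta>_def by linarith
  qed
  ultimately show ?thesis
    using k(1) by blast
qed

end

section \<open>Abelian groups on carrier sets\<close>

lemma gzero:
  assumes "ab_grp G f"
  shows "gzero G f \<in> G" "x \<in> G \<Longrightarrow> f (gzero G f) x = x" "x \<in> G \<Longrightarrow> f x (gzero G f) = x"
proof -
  obtain e where e: "e \<in> G" "\<forall>x\<in>G. f e x = x"
    using assms by (auto simp: ab_grp_def)
  have comm: "\<And>x y. x \<in> G \<Longrightarrow> y \<in> G \<Longrightarrow> f x y = f y x"
    using assms by (auto simp: ab_grp_def)
  have "gzero G f = e"
    unfolding gzero_def
  proof (rule the_equality)
    show "e' = e" if "e' \<in> G \<and> (\<forall>x\<in>G. f e' x = x)" for e'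
      using that e comm by metis
  qed (use e in auto)
  then show "gzero G f \<in> G" "x \<in> G \<Longrightarrow> f (gzero G f) x = x" "x \<in> G \<Longrightarrow> f x (gzero G f) = x"
    using e comm by auto
qed

lemma ab_grpD:
  assumes "ab_grp G f"
  shows "x \<in> G \<Longrightarrow> y \<in> G \<Longrightarrow> f x y \<in> G"
    "x \<in> G \<Longrightarrow> y \<in> G \<Longrightarrow> z \<in> G \<Longrightarrow> f (f x y) z = f x (f y z)"
    "x \<in> G \<Longrightarrow> y \<in> G \<Longrightarrow> f x y = f y x"
  using assms by (auto simp: ab_grp_def)

lemma ex_inverse:
  assumes "ab_grp G f" "x \<in> G"
  shows "\<exists>y\<in>G. f x y = gzero G f"
proof -
  obtain e where e: "e \<in> G" "\<forall>x\<in>G. f e x = x" "\<forall>x\<in>G. \<exists>y\<in>G. f x y = e"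
    using assms by (auto simp: ab_grp_def)
  have "e = gzero G f"
    using e(1,2) gzero[OF assms(1)] by metis
  then show ?thesis
    using e(3) assms(2) by auto
qed

lemma gneg_eqI:
  assumes G: "ab_grp G f" and xy: "x \<in> G" "y \<in> G" "f x y = gzero G f"
  shows "gneg G f x = y"
  unfolding gneg_def
proof (rule the_equality)
  fix z assume z: "z \<in> G \<and> f x z = gzero G f"
  have "z = f (f x y) z"
    using xy z gzero[OF G] by simp
  also have "\<dots> = f y (f x z)"
    using xy z ab_grpD[OF G] by metis
  also have "\<dots> = y"
    using xy z gzero[OF G] by simp
  finally show "z = y" .
qed (use xy in auto)

lemma gneg:
  assumes G: "ab_grp G f" and x: "x \<in> G"
  shows "gneg G f x \<in> G" "f x (gneg G f x) = gzero G f"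
  using ex_inverse[OF assms] gneg_eqI[OF G x] by metis+

lemma idem_gzero:
  assumes G: "ab_grp G f" and x: "x \<in> G" "f x x = x"
  shows "x = gzero G f"
proof -
  have "x = f x (f x (gneg G f x))"
    using gneg[OF G x(1)] gzero[OF G] x by simp
  also have "\<dots> = f (f x x) (gneg G f x)"
    using ab_grpD(2)[OF G x(1) x(1) gneg(1)[OF G x(1)]] by simp
  also have "\<dots> = gzero G f"
    using x gneg[OF G x(1)] by simp
  finally show ?thesis .
qed

lemma gsub_self: "ab_grp G f \<Longrightarrow> x \<in> G \<Longrightarrow> gsub G f x x = gzero G f"
  by (simp add: gsub_def gneg)

lemma gsub_zero:
  assumes G: "ab_grp G f" and x: "x \<in> G"
  shows "gsub G f x (gzero G f) = x"
proof -
  have "gneg G f (gzero G f) = gzero G f"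
    by (rule gneg_eqI[OF G]) (use gzero[OF G] in auto)
  then show ?thesis
    using gzero[OF G] x by (simp add: gsub_def)
qed

lemma gsub_closed: "ab_grp G f \<Longrightarrow> x \<in> G \<Longrightarrow> y \<in> G \<Longrightarrow> gsub G f x y \<in> G"
  by (simp add: gsub_def gneg ab_grpD)

lemma gsub_eq_gzero:
  assumes G: "ab_grp G f" and xy: "x \<in> G" "y \<in> G" "gsub G f x y = gzero G f"
  shows "x = y"
proof -
  have "x = f x (f (gneg G f y) y)"
    using gneg[OF G xy(2)] gzero[OF G] xy ab_grpD(3)[OF G, of y "gneg G f y"] by simp
  also have "\<dots> = f (gsub G f x y) y"
    unfolding gsub_def using ab_grpD(2)[OF G xy(1) gneg(1)[OF G xy(2)] xy(2)] by simp
  also have "\<dots> = y"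
    using xy gzero[OF G] by simp
  finally show ?thesis .
qed

text \<open>The bridge from type-class groups to operations defined by descriptions on a carrier
  set. It serves the evaluations of free groups as well as the quotient map.\<close>

lemma hom_into_grp:
  fixes V :: "real \<Rightarrow> 'b::ab_group_add \<Rightarrow> 'b"
  assumes G: "ab_grp G f" and B: "flow_subgroup V B" and g: "\<And>x. x \<in> B \<Longrightarrow> g x \<in> G"
    and add: "\<And>x y. x \<in> B \<Longrightarrow> y \<in> B \<Longrightarrow> g (x + y) = f (g x) (g y)"
  shows "g 0 = gzero G f" "x \<in> B \<Longrightarrow> g (- x) = gneg G f (g x)"
    "x \<in> B \<Longrightarrow> y \<in> B \<Longrightarrow> g (x - y) = gsub G f (g x) (g y)"
    "x \<in> B \<Longrightarrow> g (mul n x) = gmult G f n (g x)"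
proof -
  note BD = flow_subgroupD[OF B]
  show 0: "g 0 = gzero G f"
    by (rule idem_gzero[OF G]) (use g add[of 0 0] BD(1) in auto)
  show neg: "g (- x) = gneg G f (g x)" if "x \<in> B" for x
    by (rule gneg_eqI[OF G, symmetric]) (use that g add[of x "- x"] BD 0 in auto)
  show "x \<in> B \<Longrightarrow> y \<in> B \<Longrightarrow> g (x - y) = gsub G f (g x) (g y)"
    using add[of x "- y"] neg[of y] BD(2)[of y] by (simp add: gsub_def)
  show "x \<in> B \<Longrightarrow> g (mul n x) = gmult G f n (g x)"
    using add BD by (induction n) (auto simp: 0)
qed

lemmas hom_into_grp_UNIV = hom_into_grp[OF _ flow_subgroup_UNIV, simplified]

lemma free_hom_eqI:
  fixes g g' :: "('i \<Rightarrow>\<^sub>0 int) \<Rightarrow> 'a"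
  assumes G: "ab_grp G f"
    and g: "\<And>x. g x \<in> G" "\<And>x y. g (x + y) = f (g x) (g y)"
    and g': "\<And>x. g' x \<in> G" "\<And>x y. g' (x + y) = f (g' x) (g' y)"
    and eq: "\<And>i. g (frag_of i) = g' (frag_of i)"
  shows "g x = g' x"
proof (rule frag_induction[OF subset_UNIV, where P = "\<lambda>x. g x = g' x"])
  show "g 0 = g' 0"
    using hom_into_grp_UNIV(1)[OF G g] hom_into_grp_UNIV(1)[OF G g'] by simp
  show "g (a - b) = g' (a - b)" if "g a = g' a" "g b = g' b" for a b
    using hom_into_grp_UNIV(3)[OF G g, of a b] hom_into_grp_UNIV(3)[OF G g', of a b] that by simp
qed (rule eq)

lemma ex_free_hom:
  fixes c :: "'i \<Rightarrow> 'a"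
  assumes G: "ab_grp G f" and c: "\<And>i. c i \<in> G"
  shows "\<exists>g :: ('i \<Rightarrow>\<^sub>0 int) \<Rightarrow> 'a.
    (\<forall>x. g x \<in> G) \<and> (\<forall>x y. g (x + y) = f (g x) (g y)) \<and> (\<forall>i. g (frag_of i) = c i)"
proof -
  let ?G = "\<lparr>carrier = G, monoid.mult = f, one = gzero G f\<rparr>"
  interpret comm_group ?G
  proof (rule comm_groupI)
    show "\<exists>y\<in>carrier ?G. y \<otimes>\<^bsub>?G\<^esub> x = \<one>\<^bsub>?G\<^esub>" if "x \<in> carrier ?G" for x
      using ex_inverse[OF G, of x] ab_grpD(3)[OF G, of x] that by auto
  qed (use gzero[OF G] ab_grpD[OF G] in auto)
  obtain h where h: "h \<in> hom (free_Abelian_group UNIV) ?G" "\<And>x. x \<in> UNIV \<Longrightarrow> h (frag_of x) = c x"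
    using free_Abelian_group_universal[of c UNIV] c by auto
  then show ?thesis
    by (intro exI[of _ h]) (auto simp: hom_def)
qed

lemma ab_grp_flow_subgroup:
  assumes "flow_subgroup V B"
  shows "ab_grp B (+)"
proof -
  note BD = flow_subgroupD[OF assms]
  have "\<exists>y\<in>B. x + y = 0" if "x \<in> B" for x
    by (rule bexI[of _ "- x"]) (use that BD(2) in auto)
  then have "\<exists>e\<in>B. (\<forall>x\<in>B. e + x = x) \<and> (\<forall>x\<in>B. \<exists>y\<in>B. x + y = e)"
    using BD(1) by (intro bexI[of _ 0] conjI) simp_all
  then show ?thesis
    unfolding ab_grp_def using BD(3) by (simp add: ac_simps)
qed

section \<open>Quotients of seminormed groups as valued groups\<close>

text \<open>\<open>\<pi>\<close> may be any labelling whose fibres are the null classes. With the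
  label type left open, the old elements can later be labelled by themselves.\<close>

locale quotient_model = value_class +
  fixes V :: "real \<Rightarrow> 'b::ab_group_add \<Rightarrow> 'b" and B :: "'b set" and p :: "'b \<Rightarrow> real"
    and \<pi> :: "'b \<Rightarrow> 't"
  assumes flow_V: "flow V" and B: "flow_subgroup V B" and good_p: "good V B p"
    and \<pi>: "X \<in> B \<Longrightarrow> Y \<in> B \<Longrightarrow> \<pi> X = \<pi> Y \<longleftrightarrow> p (X - Y) = 0"
begin

lemmas BD = flow_subgroupD[OF B]
lemmas pD = seminorm_onD[OF goodD(1)[OF good_p] B]
lemmas VD = flowD[OF flow_V]

definition T where "T = \<pi> ` B"
definition rep where "rep = inv_into B \<pi>"
definition plusT where "plusT s t = \<pi> (rep s + rep t)"
text \<open>The scalar \<open>t\<close> is time \<open>ln t\<close>; the scalar 0 corresponds to no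
  time and is set apart.\<close>

definition actT where "actT t s = (if t = 0 then \<pi> 0 else \<pi> (V (ln t) (rep s)))"
definition nrmT where "nrmT s = p (rep s)"

lemma T_I: "X \<in> B \<Longrightarrow> \<pi> X \<in> T"
  by (simp add: T_def)

lemma rep: "s \<in> T \<Longrightarrow> rep s \<in> B" "s \<in> T \<Longrightarrow> \<pi> (rep s) = s"
  by (auto simp: rep_def T_def inv_into_into f_inv_into_f)

lemma rep_\<pi>: "X \<in> B \<Longrightarrow> p (rep (\<pi> X) - X) = 0"
  using \<pi>[of "rep (\<pi> X)" X] rep[OF T_I, of X] by simp

lemma p_eqI: "X \<in> B \<Longrightarrow> Y \<in> B \<Longrightarrow> p (X - Y) = 0 \<Longrightarrow> p X = p Y"
  using pD(8)[of X Y] by simp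

lemma null_add:
  assumes "X \<in> B" "Y \<in> B" "p X = 0" "p Y = 0"
  shows "p (X + Y) = 0"
  using pD(3)[OF assms(1,2)] pD(5)[OF BD(3)[OF assms(1,2)]] assms by simp

lemma null_V:
  assumes "X \<in> B" "p X = 0"
  shows "p (V s X) = 0"
  using goodD(2)[OF good_p assms(1), of s] pD(5)[OF BD(5)[OF assms(1)], of s] assms by simp

lemma plusT_\<pi>: 
  assumes "X \<in> B" "Y \<in> B"
  shows "plusT (\<pi> X) (\<pi> Y) = \<pi> (X + Y)"
proof -
  note r = rep(1)[OF T_I[OF assms(1)]] rep(1)[OF T_I[OF assms(2)]]
  have "p ((rep (\<pi> X) - X) + (rep (\<pi> Y) - Y)) = 0"
    by (intro null_add BD r assms rep_\<pi>)
  also have "(rep (\<pi> X) - X) + (rep (\<pi> Y) - Y) = (rep (\<pi> X) + rep (\<pi> Y)) - (X + Y)"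
    by (simp add: algebra_simps)
  finally show ?thesis
    unfolding plusT_def using \<pi>[OF BD(3)[OF r] BD(3)[OF assms]] by simp
qed

lemma nrmT_\<pi>: "X \<in> B \<Longrightarrow> nrmT (\<pi> X) = p X"
  unfolding nrmT_def by (intro p_eqI rep T_I rep_\<pi>)

lemma actT_\<pi>:
  assumes "X \<in> B" "0 < t"
  shows "actT t (\<pi> X) = \<pi> (V (ln t) X)"
proof -
  note r = rep(1)[OF T_I[OF assms(1)]]
  have "p (V (ln t) (rep (\<pi> X) - X)) = 0"
    by (intro null_V BD r assms rep_\<pi>)
  then show ?thesis
    unfolding actT_def using \<pi>[OF BD(5)[OF r, of "ln t"] BD(5)[OF assms(1), of "ln t"]] assms by (simp add: VD(7))
qed

lemma actT_0: "actT 0 s = \<pi> 0"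
  by (simp add: actT_def)

lemma ball_T: "(\<forall>x\<in>T. R x) \<longleftrightarrow> (\<forall>X\<in>B. R (\<pi> X))"
  by (simp add: T_def)

lemma ab_grp_T: "ab_grp T plusT"
  unfolding ab_grp_def ball_T
proof (intro conjI ballI)
  show "\<exists>e\<in>T. (\<forall>X\<in>B. plusT e (\<pi> X) = \<pi> X) \<and> (\<forall>X\<in>B. \<exists>y\<in>T. plusT (\<pi> X) y = e)"
  proof (rule bexI[of _ "\<pi> 0"], intro conjI ballI)
    show "\<exists>y\<in>T. plusT (\<pi> X) y = \<pi> 0" if "X \<in> B" for X
      by (intro bexI[of _ "\<pi> (- X)"]) (simp_all add: that plusT_\<pi> BD T_I)
  qed (simp_all add: plusT_\<pi> BD T_I)
qed (simp_all add: plusT_\<pi> BD T_I algebra_simps)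

lemmas \<pi>_hom = hom_into_grp[OF ab_grp_T B T_I plusT_\<pi>[symmetric]]

lemma p_zero_iff: "X \<in> B \<Longrightarrow> p X = 0 \<longleftrightarrow> \<pi> X = gzero T plusT"
  using \<pi>[of X 0] BD(1) by (simp add: \<pi>_hom(1)[symmetric])

lemma is_value_T: "is_value T plusT nrmT"
  unfolding is_value_def ball_T
  by (auto simp: nrmT_\<pi> pD plusT_\<pi> BD p_zero_iff \<pi>_hom(2)[symmetric])

lemma nrmT_gsub: "X \<in> B \<Longrightarrow> Y \<in> B \<Longrightarrow> nrmT (gsub T plusT (\<pi> X) (\<pi> Y)) = p (X - Y)"
  by (simp add: \<pi>_hom(3)[symmetric] nrmT_\<pi> BD)

lemma pvg_T: "pvg T plusT actT"
  unfolding pvg_def ball_T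
proof (intro conjI allI impI ballI ab_grp_T)
  show "actT t (\<pi> X) \<in> T" if "0 \<le> t" "X \<in> B" for t X
    using that by (cases "t = 0") (simp_all add: actT_0 actT_\<pi> T_I BD)
  show "actT (s * t) (\<pi> X) = actT s (actT t (\<pi> X))" if "0 \<le> s" "0 \<le> t" "X \<in> B" for s t X
  proof (cases "s = 0 \<or> t = 0")
    case True
    then show ?thesis
      using that BD by (cases "s = 0") (auto simp: actT_0 actT_\<pi> VD(5))
  next
    case False
    then show ?thesis
      using that BD by (simp add: actT_\<pi> ln_mult VD(3))
  qed
  show "actT t (plusT (\<pi> X) (\<pi> Y)) = plusT (actT t (\<pi> X)) (actT t (\<pi> Y))"
    if "0 \<le> t" "X \<in> B" "Y \<in> B" for t X Y
    using that BD by (cases "t = 0") (simp_all add: actT_0 actT_\<pi> plusT_\<pi> VD(4))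
next
  fix X assume "X \<in> B"
  then show "actT 0 (\<pi> X) = gzero T plusT" "actT 1 (\<pi> X) = \<pi> X"
    by (simp_all add: actT_0 \<pi>_hom(1) actT_\<pi> VD(2))
qed

lemma scale_ln_le: "0 < s \<Longrightarrow> scale (ln s) \<le> 1 + s"
  by (simp add: scale_def)

text \<open>V (ln s) Y - Z is split into V (ln s) (Y - X), controlled by \<open>scale\<close>, and V
  (ln s) X - Z, controlled by the limit of \<open>good\<close> at time 0, or at -infinity if t =
  0.\<close>

lemma act_continuous_T: "act_continuous T plusT actT nrmT"
  unfolding act_continuous_def ball_T
proof (intro allI impI ballI)
  fix t \<epsilon> :: real and X
  assume t: "0 \<le> t" and X: "X \<in> B" and \<epsilon>: "0 < \<epsilon>"
  define Z where "Z = (if t = 0 then 0 else V (ln t) X)"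
  have Z: "Z \<in> B" "actT t (\<pi> X) = \<pi> Z"
    using t X BD by (auto simp: Z_def actT_0 actT_\<pi>)
  have e2: "0 < \<epsilon> / 2"
    using \<epsilon> by simp
  have "\<exists>d>0. \<forall>s>0. \<bar>s - t\<bar> < d \<longrightarrow> p (V (ln s) X - Z) < \<epsilon> / 2"
  proof (cases "t = 0")
    case True
    obtain K where K: "\<And>u. u \<le> K \<Longrightarrow> p (V u X) < \<epsilon> / 2"
      using order_tendstoD(2)[OF goodD(4)[OF good_p X] e2] by (auto simp: eventually_at_bot_linorder)
    have "ln s \<le> K" if "0 < s" "s < exp K" for s
      using that by (metis exp_le_cancel_iff exp_ln less_imp_le)
    then show ?thesis
      using True K by (intro exI[of _ "exp K"]) (auto simp: Z_def)
  next
    case False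
    then have t0: "0 < t"
      using t by simp
    have "0 < \<epsilon> / 2 / scale (ln t)"
      using e2 scale_pos by simp
    from order_tendstoD(2)[OF goodD(3)[OF good_p X] this]
    obtain d where d: "0 < d" "\<And>u. u \<noteq> 0 \<Longrightarrow> \<bar>u\<bar> < d \<Longrightarrow> p (V u X - X) < \<epsilon> / 2 / scale (ln t)"
      unfolding eventually_at by auto
    have "isCont ln t"
      using t0 by (intro isCont_ln) auto
    then obtain d' where d': "0 < d'" "\<And>s. s \<noteq> t \<Longrightarrow> \<bar>s - t\<bar> < d' \<Longrightarrow> \<bar>ln s - ln t\<bar> < d"
      using d(1) unfolding isCont_def LIM_eq real_norm_def by blast
    have "p (V (ln s) X - Z) < \<epsilon> / 2" if s: "0 < s" "\<bar>s - t\<bar> < d'" for s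
    proof (cases "ln s = ln t")
      case True
      then show ?thesis
        using t0 e2 pD(1) by (simp add: Z_def)
    next
      case neq: False
      have "V (ln s) X - Z = V (ln t) (V (ln s - ln t) X - X)"
        using t0 VD(3)[of "ln t" "ln s - ln t" X] by (simp add: Z_def VD(7))
      then have "p (V (ln s) X - Z) \<le> scale (ln t) * p (V (ln s - ln t) X - X)"
        using goodD(2)[OF good_p BD(4)[OF BD(5)[OF X] X]] by simp
      also have "\<dots> < scale (ln t) * (\<epsilon> / 2 / scale (ln t))"
        using d(2)[of "ln s - ln t"] d'(2)[OF _ s(2)] neq scale_pos by (intro mult_strict_left_mono) auto
      also have "\<dots> = \<epsilon> / 2"
        using scale_pos[of "ln t"] by simp
      finally show ?thesis .
    qed
    then show ?thesis
      using d'(1) by blast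
  qed
  then obtain d where d: "0 < d" "\<And>s. 0 < s \<Longrightarrow> \<bar>s - t\<bar> < d \<Longrightarrow> p (V (ln s) X - Z) < \<epsilon> / 2"
    by blast
  \<comment> \<open>The bound 1 gives s < t + 1, hence \<open>scale (ln s)\<close> <= t + 2; the
    quotient turns this factor into \<epsilon> / 2; the last term excludes s = 0 when
    \<open>t\<close> is positive.\<close>
  define \<delta> where "\<delta> = min d (min 1 (min (\<epsilon> / (2 * (t + 2))) (if t = 0 then 1 else t)))"
  have \<delta>: "0 < \<delta>" "\<delta> \<le> d" "\<delta> \<le> 1" "\<delta> \<le> \<epsilon> / (2 * (t + 2))" "t \<noteq> 0 \<Longrightarrow> \<delta> \<le> t"
    using d(1) t \<epsilon> by (auto simp: \<delta>_def)
  show "\<exists>\<delta>>0. \<forall>s\<ge>0. \<forall>Y\<in>B. \<bar>s - t\<bar> < \<delta> \<and> nrmT (gsub T plusT (\<pi> Y) (\<pi> X)) < \<delta> \<longrightarrow>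
      nrmT (gsub T plusT (actT s (\<pi> Y)) (actT t (\<pi> X))) < \<epsilon>"
  proof (intro exI[of _ \<delta>] conjI allI impI ballI \<delta>(1), elim conjE)
    fix s Y assume s: "0 \<le> s" "\<bar>s - t\<bar> < \<delta>" and Y: "Y \<in> B" "nrmT (gsub T plusT (\<pi> Y) (\<pi> X)) < \<delta>"
    show "nrmT (gsub T plusT (actT s (\<pi> Y)) (actT t (\<pi> X))) < \<epsilon>"
    proof (cases "s = 0")
      case True
      then have "t = 0"
        using s t \<delta>(5) by (cases "t = 0") auto
      then show ?thesis
        using True \<epsilon> BD(1) pD(1) by (simp add: actT_0 nrmT_gsub)
    next
      case False
      then have s0: "0 < s"
        using s by simp
      have "p (V (ln s) (Y - X)) \<le> scale (ln s) * p (Y - X)"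
        by (intro goodD(2)[OF good_p] BD Y X)
      also have "\<dots> \<le> (t + 2) * p (Y - X)"
        using scale_ln_le[OF s0] s \<delta>(3) t pD(5)[OF BD(4)[OF Y(1) X]] by (intro mult_right_mono) auto
      also have "\<dots> < (t + 2) * (\<epsilon> / (2 * (t + 2)))"
        using Y X \<delta>(4) t by (intro mult_strict_left_mono) (auto simp: nrmT_gsub)
      also have "\<dots> = \<epsilon> / 2"
        using t by (simp add: divide_simps)
      finally have 1: "p (V (ln s) (Y - X)) < \<epsilon> / 2" .
      have "V (ln s) Y - Z = V (ln s) (Y - X) + (V (ln s) X - Z)"
        by (simp add: VD(7))
      then have "p (V (ln s) Y - Z) \<le> p (V (ln s) (Y - X)) + p (V (ln s) X - Z)"
        using pD(3)[OF BD(5)[OF BD(4)[OF Y(1) X]] BD(4)[OF BD(5)[OF X] Z(1)]] by (simp only:)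
      also have "\<dots> < \<epsilon> / 2 + \<epsilon> / 2"
        using 1 d(2)[OF s0] s \<delta>(2) by (intro add_strict_mono) auto
      finally show ?thesis
        using s0 Y(1) Z BD(5) by (simp add: actT_\<pi> nrmT_gsub)
    qed
  qed
qed

lemma top_pvg_T: "top_pvg sub T plusT actT nrmT"
proof -
  have le: "nrmT (actT t x) \<le> scale (ln t) * nrmT x" if "0 < t" "x \<in> T" for t x
    using that goodD(2)[OF good_p] BD by (auto simp: T_def actT_\<pi> nrmT_\<pi>)
  have act_inv: "actT (1 / t) (actT t x) = x" "actT t x \<in> T" if "0 < t" "x \<in> T" for t x
    using pvg_T that unfolding pvg_def by (metis less_imp_le divide_self_if less_irrefl mult.commute times_divide_eq_right zero_le_divide_1_iff mult.right_neutral)+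
  \<comment> \<open>The upper bound for the inverse scalar is a lower bound for \<open>t\<close>.
    The two together give equality for norms and both inequalities for subnorms.\<close>
  have ge: "nrmT x \<le> scale (- ln t) * nrmT (actT t x)" if "0 < t" "x \<in> T" for t x
    using le[of "1 / t" "actT t x"] act_inv[OF that] that by (simp add: ln_div)
  have nonneg: "0 \<le> nrmT x" if "x \<in> T" for x
    using is_value_T that by (simp add: is_value_def)
  have "is_pv_subnorm T actT nrmT" if sub
    unfolding is_pv_subnorm_def
  proof (intro allI impI ballI conjI)
    fix s x assume s: "1 \<le> (s::real)" and x: "x \<in> T"
    have "scale (ln s) = s" "scale (- ln s) = 1"
      unfolding scale_def using s that by (auto simp: exp_minus max_def field_simps)
    then show "nrmT x \<le> nrmT (actT s x)" "nrmT (actT s x) \<le> s * nrmT x"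
      using le[of s x] ge[of s x] s x by simp_all
  qed
  moreover have "is_pv_norm T actT nrmT" if "\<not> sub"
    unfolding is_pv_norm_def
  proof (intro allI impI ballI)
    fix t x assume t: "0 \<le> (t::real)" and x: "x \<in> T"
    show "nrmT (actT t x) = t * nrmT x"
    proof (cases "t = 0")
      case True
      then show ?thesis
        using BD(1) pD(1) by (simp add: actT_0 nrmT_\<pi>)
    next
      case False
      then have t0: "0 < t" and sc: "scale (ln t) = t" "scale (- ln t) = 1 / t"
        unfolding scale_def using t that by (auto simp: exp_minus field_simps)
      have "nrmT (actT t x) \<le> t * nrmT x" "nrmT x \<le> 1 / t * nrmT (actT t x)"
        using le[OF t0 x] ge[OF t0 x] unfolding sc .
      then show ?thesis
        using t0 by (simp add: field_simps)
    qed
  qed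
  ultimately show ?thesis
    unfolding top_pvg_def using pvg_T is_value_T act_continuous_T by presburger
qed

lemma frakG_T:
  assumes r: "r = (if cap then 1 else \<infinity>)"
    and D: "countable D" "D \<subseteq> B" "\<And>X \<epsilon>. X \<in> B \<Longrightarrow> 0 < \<epsilon> \<Longrightarrow> \<exists>d\<in>D. p (X - d) < \<epsilon>"
  shows "frakG r N T plusT nrmT"
  unfolding frakG_def
proof (intro conjI impI)
  show "valued_grp T plusT nrmT"
    by (simp add: valued_grp_def ab_grp_T is_value_T)
  show "vg_separable T plusT nrmT"
    unfolding vg_separable_def ball_T
  proof (intro exI[of _ "\<pi> ` D"] conjI ballI allI impI)
    show "\<exists>d\<in>\<pi> ` D. nrmT (gsub T plusT (\<pi> X) d) < \<epsilon>" if "X \<in> B" "0 < \<epsilon>" for X \<epsilon>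
      using D(3)[OF that] D(2) that by (force simp: nrmT_gsub)
  qed (use D in \<open>auto simp: T_def\<close>)
  show "class_O0 T plusT nrmT"
    unfolding class_O0_def ball_T
    using goodD(5)[OF good_p] by (simp add: \<pi>_hom(4)[symmetric] nrmT_\<pi> BD)
  show "\<forall>x\<in>T. ereal (nrmT x) \<le> r"
    unfolding ball_T using goodD(7)[OF good_p] by (auto simp: r nrmT_\<pi> one_ereal_def)
  show "has_exponent T plusT N" if "N \<noteq> 0"
    unfolding has_exponent_def ball_T
    using goodD(6)[OF good_p that] by (simp add: \<pi>_hom(4)[symmetric] p_zero_iff[symmetric] BD)
qed

lemma vg_complete_T:
  assumes "\<And>Y. (\<And>n. Y n \<in> B) \<Longrightarrow> (\<And>e. 0 < e \<Longrightarrow> \<exists>M. \<forall>m\<ge>M. \<forall>n\<ge>M. p (Y m - Y n) < e) \<Longrightarrow>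
    \<exists>X\<in>B. (\<lambda>n. p (Y n - X)) \<longlonglongrightarrow> 0"
  shows "vg_complete T plusT nrmT"
  unfolding vg_complete_def
proof (intro allI impI, elim conjE)
  fix Y :: "nat \<Rightarrow> 't"
  assume Y: "\<forall>n. Y n \<in> T" "\<forall>\<epsilon>>0. \<exists>M. \<forall>m\<ge>M. \<forall>n\<ge>M. nrmT (gsub T plusT (Y m) (Y n)) < \<epsilon>"
  have r: "rep (Y n) \<in> B" "\<pi> (rep (Y n)) = Y n" for n
    using Y(1) rep by auto
  have "nrmT (gsub T plusT (Y m) (Y n)) = p (rep (Y m) - rep (Y n))" for m n
    using nrmT_gsub[OF r(1) r(1), of m n] by (simp add: r)
  then have "\<exists>X\<in>B. (\<lambda>n. p (rep (Y n) - X)) \<longlonglongrightarrow> 0"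
    using Y(2) by (intro assms r) simp
  then obtain X where X: "X \<in> B" "(\<lambda>n. p (rep (Y n) - X)) \<longlonglongrightarrow> 0"
    by blast
  have "nrmT (gsub T plusT (Y n) (\<pi> X)) = p (rep (Y n) - X)" for n
    using nrmT_gsub[OF r(1) X(1), of n] by (simp add: r)
  then show "\<exists>x\<in>T. (\<lambda>n. nrmT (gsub T plusT (Y n) x)) \<longlonglongrightarrow> 0"
    using X by (intro bexI[of _ "\<pi> X"]) (simp_all add: T_I)
qed

end

section \<open>The enlargement\<close>

locale base_group = value_class +
  fixes G :: "'a set" and f :: "'a \<Rightarrow> 'a \<Rightarrow> 'a" and act :: "real \<Rightarrow> 'a \<Rightarrow> 'a" and nrm :: "'a \<Rightarrow> real"
    and r :: ereal
  assumes top: "top_pvg sub G f act nrm" and r: "r = (if cap then 1 else \<infinity>)" and frakG: "frakG r N G f nrm"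
begin

lemma G: "ab_grp G f"
  using frakG by (simp add: frakG_def valued_grp_def)

lemmas GD = ab_grpD[OF G] and G0 = gzero[OF G]

lemma act:
  "0 \<le> t \<Longrightarrow> x \<in> G \<Longrightarrow> act t x \<in> G" "x \<in> G \<Longrightarrow> act 0 x = gzero G f" "x \<in> G \<Longrightarrow> act 1 x = x"
  "0 \<le> s \<Longrightarrow> 0 \<le> t \<Longrightarrow> x \<in> G \<Longrightarrow> act (s * t) x = act s (act t x)"
  "0 \<le> t \<Longrightarrow> x \<in> G \<Longrightarrow> y \<in> G \<Longrightarrow> act t (f x y) = f (act t x) (act t y)"
  using top by (auto simp: top_pvg_def pvg_def)

lemma nrm:
  "x \<in> G \<Longrightarrow> 0 \<le> nrm x" "x \<in> G \<Longrightarrow> nrm x = 0 \<longleftrightarrow> x = gzero G f"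
  "x \<in> G \<Longrightarrow> nrm (gneg G f x) = nrm x" "x \<in> G \<Longrightarrow> y \<in> G \<Longrightarrow> nrm (f x y) \<le> nrm x + nrm y"
  using top by (auto simp: top_pvg_def is_value_def)

lemma nrm_gzero [simp]: "nrm (gzero G f) = 0"
  using nrm(2)[OF G0(1)] by blast

lemma nrm_act_le:
  assumes x: "x \<in> G"
  shows "nrm (act (exp s) x) \<le> scale s * nrm x"
proof (cases sub)
  case True
  have mono: "y \<in> G \<Longrightarrow> 1 \<le> t \<Longrightarrow> nrm y \<le> nrm (act t y) \<and> nrm (act t y) \<le> t * nrm y" for y t
    using top True by (auto simp: top_pvg_def is_pv_subnorm_def)
  have sc: "scale s = max 1 (exp s)"
    unfolding scale_def using True by simp
  show ?thesis
  proof (cases "0 \<le> s")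
    case True
    then show ?thesis
      unfolding sc using mono[OF x, of "exp s"] by simp
  next
    case False
    have "x = act (exp (- s)) (act (exp s) x)"
      using act(4)[of "exp (- s)" "exp s" x] x by (simp add: act(3) exp_minus)
    then have "nrm (act (exp s) x) \<le> nrm x"
      using mono[of "act (exp s) x" "exp (- s)"] x False by (simp add: act(1))
    then show ?thesis
      unfolding sc using False by simp
  qed
next
  case False
  then have "nrm (act (exp s) x) = exp s * nrm x"
    using top x by (auto simp: top_pvg_def is_pv_norm_def)
  then show ?thesis
    unfolding scale_def using False by simp
qed

lemma act_cont:
  assumes "0 \<le> t" "x \<in> G" "0 < \<epsilon>"
  obtains \<delta> where "0 < \<delta>" "\<And>s. 0 \<le> s \<Longrightarrow> \<bar>s - t\<bar> < \<delta> \<Longrightarrow> nrm (gsub G f (act s x) (act t x)) < \<epsilon>"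
proof -
  have "act_continuous G f act nrm"
    using top by (simp add: top_pvg_def)
  then obtain \<delta> where \<delta>: "0 < \<delta>" "\<forall>s\<ge>0. \<forall>y\<in>G. \<bar>s - t\<bar> < \<delta> \<and> nrm (gsub G f y x) < \<delta> \<longrightarrow> nrm (gsub G f (act s y) (act t x)) < \<epsilon>"
    using assms unfolding act_continuous_def by blast
  have "nrm (gsub G f x x) < \<delta>"
    using \<delta>(1) assms G0(1) by (simp add: gsub_self[OF G] nrm)
  then show ?thesis
    using that[OF \<delta>(1)] \<delta>(2) assms(2) by blast
qed

text \<open>The free group over all of \<open>'a\<close> supplies the type-class group on which the
  construction runs, and \<open>G\<close> is its image. Generators outside \<open>G\<close> are sent
  to zero.\<close>

definition ev :: "('a \<Rightarrow>\<^sub>0 int) \<Rightarrow> 'a" where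
  "ev = (SOME g. (\<forall>x. g x \<in> G) \<and> (\<forall>x y. g (x + y) = f (g x) (g y)) \<and>
     (\<forall>i. g (frag_of i) = (if i \<in> G then i else gzero G f)))"

lemma ev: "ev x \<in> G" "ev (x + y) = f (ev x) (ev y)" "ev (frag_of i) = (if i \<in> G then i else gzero G f)"
proof -
  have "\<exists>g :: ('a \<Rightarrow>\<^sub>0 int) \<Rightarrow> 'a. (\<forall>x. g x \<in> G) \<and> (\<forall>x y. g (x + y) = f (g x) (g y)) \<and>
     (\<forall>i. g (frag_of i) = (if i \<in> G then i else gzero G f))"
    by (rule ex_free_hom[OF G]) (use G0 in auto)
  from someI_ex[OF this] show "ev x \<in> G" "ev (x + y) = f (ev x) (ev y)"
      "ev (frag_of i) = (if i \<in> G then i else gzero G f)"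
    unfolding ev_def[symmetric] by blast+
qed

lemmas ev_hom = hom_into_grp_UNIV[OF G ev(1,2)]

definition V0 :: "real \<Rightarrow> ('a \<Rightarrow>\<^sub>0 int) \<Rightarrow> ('a \<Rightarrow>\<^sub>0 int)" where
  "V0 s = frag_extend (\<lambda>g. frag_of (if g \<in> G then act (exp s) g else g))"

definition p0 :: "('a \<Rightarrow>\<^sub>0 int) \<Rightarrow> real" where
  "p0 x = nrm (ev x)"

lemma V0_frag_of: "V0 s (frag_of g) = frag_of (if g \<in> G then act (exp s) g else g)"
  by (simp add: V0_def)

lemma additive_V0: "additive (V0 s)"
  by standard (simp add: V0_def frag_extend_add)

lemma flow_V0: "flow V0"
proof -
  have eq: "g x = g' x" if "additive g" "additive g'" "\<And>i. g (frag_of i) = g' (frag_of i)"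
    for g g' :: "('a \<Rightarrow>\<^sub>0 int) \<Rightarrow> ('a \<Rightarrow>\<^sub>0 int)" and x
    by (rule free_hom_eqI[where G = UNIV and f = "(+)"])
      (use that ab_grp_flow_subgroup[OF flow_subgroup_UNIV] in \<open>auto simp: additive.add\<close>)
  have "V0 0 x = x" for x
    by (rule eq[of "V0 0" "\<lambda>x. x", OF additive_V0]) (auto simp: V0_frag_of act additive_def)
  moreover have "V0 (s + t) x = V0 s (V0 t x)" for s t x
    by (rule eq[of "V0 (s + t)" "\<lambda>x. V0 s (V0 t x)"])
      (auto simp: additive_V0 V0_frag_of act exp_add intro: additive_comp[OF additive_V0 additive_V0])
  ultimately show ?thesis
    by (simp add: flow_def additive_V0)
qed

lemma ev_V0: "ev (V0 s x) = act (exp s) (ev x)"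
proof (rule free_hom_eqI[OF G])
  fix i
  have "act (exp s) (gzero G f) = gzero G f"
    by (rule idem_gzero[OF G]) (use G0 act(1,5)[of "exp s" "gzero G f" ] in \<open>auto simp flip: act(5)\<close>)
  then show "ev (V0 s (frag_of i)) = act (exp s) (ev (frag_of i))"
    by (simp add: V0_frag_of ev act)
qed (simp_all add: ev act additive.add[OF additive_V0])

lemma good_p0: "good V0 UNIV p0"
  unfolding good_def
proof (intro conjI allI ballI impI)
  show "seminorm_on UNIV p0"
    using G0(1) by (simp add: seminorm_on_def p0_def ev_hom ev nrm)
  fix x
  \<comment> \<open>One statement for both limits: t = 1 for times near 0, and t = 0 for times near
    -infinity, where \<open>act 0\<close> makes it a comparison with zero.\<close>
  have lim: "((\<lambda>s. nrm (gsub G f (act (exp s) (ev x)) (act t (ev x)))) \<longlongrightarrow> 0) F"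
    if t: "0 \<le> t" "(exp \<longlongrightarrow> t) F" for t F
  proof (rule order_tendstoI)
    fix e :: real
    assume "0 < e"
    then obtain \<delta> where \<delta>: "0 < \<delta>" "\<And>s. 0 \<le> s \<Longrightarrow> \<bar>s - t\<bar> < \<delta> \<Longrightarrow> nrm (gsub G f (act s (ev x)) (act t (ev x))) < e"
      using act_cont[OF t(1) ev(1)] by metis
    from tendstoD[OF t(2) \<delta>(1)]
    show "\<forall>\<^sub>F s in F. nrm (gsub G f (act (exp s) (ev x)) (act t (ev x))) < e"
      by eventually_elim (auto intro: \<delta>(2) simp: dist_real_def)
  next
    fix e :: real
    assume "e < 0"
    then show "\<forall>\<^sub>F s in F. e < nrm (gsub G f (act (exp s) (ev x)) (act t (ev x)))"
      by (intro always_eventually allI less_le_trans[OF _ nrm(1)] gsub_closed[OF G] act ev t) auto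
  qed
  have "(exp \<longlongrightarrow> exp 0) (at (0::real))"
    by (rule isContD) simp
  from lim[OF _ this[unfolded exp_zero]] show "((\<lambda>s. p0 (V0 s x - x)) \<longlongrightarrow> 0) (at 0)"
    by (simp add: p0_def ev_hom ev_V0 act ev)
  from lim[OF _ exp_at_bot] show "((\<lambda>s. p0 (V0 s x)) \<longlongrightarrow> 0) at_bot"
    by (simp add: p0_def ev_V0 act ev gsub_zero[OF G])
  show "p0 (V0 s x) \<le> scale s * p0 x" for s
    by (simp add: p0_def ev_V0 nrm_act_le ev)
  have "class_O0 G f nrm"
    using frakG by (simp add: frakG_def)
  then show "(\<lambda>n. p0 (mul n x) / real n) \<longlonglongrightarrow> 0"
    by (simp add: class_O0_def p0_def ev_hom ev)
  show "p0 (mul N x) = 0" if "N \<noteq> 0"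
  proof -
    have "has_exponent G f N"
      using frakG that by (simp add: frakG_def)
    then show ?thesis
      using G0(1) by (simp add: has_exponent_def p0_def ev_hom ev nrm)
  qed
  show "p0 x \<le> 1" if cap
  proof -
    have "ereal (nrm (ev x)) \<le> r"
      using frakG ev(1) by (simp add: frakG_def)
    then show ?thesis
      using that by (simp add: r p0_def one_ereal_def)
  qed
qed

definition D0 :: "('a \<Rightarrow>\<^sub>0 int) set" where
  "D0 = insert 0 (frag_of ` (SOME D. D \<subseteq> G \<and> countable D \<and> (\<forall>x\<in>G. \<forall>\<epsilon>>0. \<exists>d\<in>D. nrm (gsub G f x d) < \<epsilon>)))"

lemma D0: "countable D0" "0 \<in> D0" "0 < \<epsilon> \<Longrightarrow> \<exists>d\<in>D0. p0 (x - d) < \<epsilon>"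
proof -
  define D where "D = (SOME D. D \<subseteq> G \<and> countable D \<and> (\<forall>x\<in>G. \<forall>\<epsilon>>0. \<exists>d\<in>D. nrm (gsub G f x d) < \<epsilon>))"
  have "vg_separable G f nrm"
    using frakG by (simp add: frakG_def)
  then have "\<exists>D. D \<subseteq> G \<and> countable D \<and> (\<forall>x\<in>G. \<forall>\<epsilon>>0. \<exists>d\<in>D. nrm (gsub G f x d) < \<epsilon>)"
    unfolding vg_separable_def .
  from someI_ex[OF this] have D: "D \<subseteq> G" "countable D" "\<And>x \<epsilon>. x \<in> G \<Longrightarrow> 0 < \<epsilon> \<Longrightarrow> \<exists>d\<in>D. nrm (gsub G f x d) < \<epsilon>"
    unfolding D_def[symmetric] by blast+
  have D0: "D0 = insert 0 (frag_of ` D)"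
    by (simp add: D0_def D_def)
  show "countable D0" "0 \<in> D0"
    using D(2) by (auto simp: D0)
  show "\<exists>d\<in>D0. p0 (x - d) < \<epsilon>" if \<epsilon>: "0 < \<epsilon>"
  proof -
    obtain d where "d \<in> D" "nrm (gsub G f (ev x) d) < \<epsilon>"
      using D(3)[OF ev(1) \<epsilon>] by blast
    then show ?thesis
      using D(1) by (intro bexI[of _ "frag_of d"]) (auto simp: D0 p0_def ev_hom ev)
  qed
qed

end

sublocale base_group \<subseteq> tower sub cap N V0 p0 D0
  by unfold_locales (fact flow_V0 good_p0 D0)+

section \<open>Labels for the null classes in the sum type\<close>

context base_group
begin

definition emb :: "'a \<Rightarrow> nat \<Rightarrow> ('a \<Rightarrow>\<^sub>0 int) \<times> (nat \<Rightarrow>\<^sub>0 (real \<Rightarrow>\<^sub>0 frag))" where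
  "emb g = C.cst (frag_of g, 0)"

definition set_code :: "nat set \<Rightarrow> real" where
  "set_code = (SOME h. inj h)"

lemma inj_set_code: "inj set_code"
proof -
  obtain h :: "nat set \<Rightarrow> real" where "bij_betw h UNIV UNIV"
    using nat_sets_eqpoll_reals unfolding eqpoll_def by blast
  then have "\<exists>h :: nat set \<Rightarrow> real. inj h"
    by (auto simp: bij_betw_def)
  then show ?thesis
    unfolding set_code_def by (rule someI_ex)
qed

text \<open>Up to null elements, \<open>X\<close> is determined by which balls of radius 1 / (k + 1)
  around points of the countable dense set \<open>D\<close> contain it. The set of these index pairs
  is a set of naturals and is injected into the reals.\<close>

definition code :: "(nat \<Rightarrow> ('a \<Rightarrow>\<^sub>0 int) \<times> (nat \<Rightarrow>\<^sub>0 (real \<Rightarrow>\<^sub>0 frag))) \<Rightarrow> real" where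
  "code X = set_code {n. C.pB (X - C.cst (from_nat_into D (fst (prod_decode n)))) < 1 / real (Suc (snd (prod_decode n)))}"

text \<open>At most one \<open>g\<close> qualifies, since \<open>nrm\<close> vanishes only at zero,
  and the condition depends only on the null class of \<open>X\<close>. Old elements thereby keep
  their names, and all others receive a real.\<close>

definition \<pi> :: "(nat \<Rightarrow> ('a \<Rightarrow>\<^sub>0 int) \<times> (nat \<Rightarrow>\<^sub>0 (real \<Rightarrow>\<^sub>0 frag))) \<Rightarrow> 'a + real" where
  "\<pi> X = (if \<exists>g\<in>G. C.pB (X - emb g) = 0 then Inl (SOME g. g \<in> G \<and> C.pB (X - emb g) = 0) else Inr (code X))"

lemma emb_CS [simp]: "emb g \<in> C.CS"
  by (simp add: emb_def)

lemma pB_diff_eq: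
  assumes "X \<in> C.CS" "Y \<in> C.CS" "Z \<in> C.CS" "C.pB (X - Y) = 0"
  shows "C.pB (X - Z) = C.pB (Y - Z)"
  using C.pBD(9)[OF assms(1,2,3)] C.pBD(9)[OF assms(2,1,3)] C.pBD(6)[OF assms(1,2)] assms(4) by simp

lemma code_eqD:
  assumes X: "X \<in> C.CS" and Y: "Y \<in> C.CS" and eq: "code X = code Y"
  shows "C.pB (X - Y) = 0"
proof -
  have "{n. C.pB (X - C.cst (from_nat_into D (fst (prod_decode n)))) < 1 / real (Suc (snd (prod_decode n)))}
      = {n. C.pB (Y - C.cst (from_nat_into D (fst (prod_decode n)))) < 1 / real (Suc (snd (prod_decode n)))}"
    using eq inj_set_code unfolding code_def by (simp add: inj_def)
  then have iff: "C.pB (X - C.cst (from_nat_into D i)) < 1 / real (Suc k) \<longleftrightarrow>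
      C.pB (Y - C.cst (from_nat_into D i)) < 1 / real (Suc k)" for i k
    by (auto simp: set_eq_iff dest: spec[of _ "prod_encode (i, k)"])
  have "C.pB (X - Y) \<le> 0 + e" if e: "0 < e" for e
  proof -
    obtain k where k: "1 / real (Suc k) < e / 2"
      using nat_approx_posE[OF half_gt_zero[OF e]] by blast
    obtain d where d: "d \<in> D" "C.pB (X - C.cst d) < 1 / real (Suc k)"
      using D_dense_CS[OF X, of "1 / real (Suc k)"] by auto
    obtain i where i: "d = from_nat_into D i"
      using d(1) countable_D by (metis from_nat_into_surj)
    have "C.pB (Y - C.cst d) < 1 / real (Suc k)"
      using d(2) iff[of i k] by (simp only: i)
    moreover have "C.pB (X - Y) \<le> C.pB (X - C.cst d) + C.pB (C.cst d - Y)"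
      by (rule C.pBD(9)) (simp_all add: X Y)
    moreover have "C.pB (C.cst d - Y) = C.pB (Y - C.cst d)"
      by (rule C.pBD(6)) (simp_all add: Y)
    ultimately show ?thesis
      using d(2) k by linarith
  qed
  then have "C.pB (X - Y) \<le> 0"
    by (rule field_le_epsilon)
  then show ?thesis
    using C.pBD(5)[OF C.CSD(4)[OF X Y]] by linarith
qed

lemma \<pi>_eq:
  assumes X: "X \<in> C.CS" and Y: "Y \<in> C.CS"
  shows "\<pi> X = \<pi> Y \<longleftrightarrow> C.pB (X - Y) = 0"
proof
  assume "C.pB (X - Y) = 0"
  then have "C.pB (X - Z) = C.pB (Y - Z)" if "Z \<in> C.CS" for Z
    by (rule pB_diff_eq[OF X Y that])
  then show "\<pi> X = \<pi> Y"
    by (simp only: \<pi>_def code_def emb_CS C.cst_CS)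
next
  assume eq: "\<pi> X = \<pi> Y"
  show "C.pB (X - Y) = 0"
  proof (cases "\<exists>g\<in>G. C.pB (X - emb g) = 0")
    case True
    then have Y': "\<exists>g\<in>G. C.pB (Y - emb g) = 0"
      using eq by (auto simp: \<pi>_def split: if_splits)
    define g where "g = (SOME g. g \<in> G \<and> C.pB (X - emb g) = 0)"
    have "g = (SOME g. g \<in> G \<and> C.pB (Y - emb g) = 0)"
      using eq True Y' by (simp add: \<pi>_def g_def)
    then have "C.pB (X - emb g) = 0" "C.pB (Y - emb g) = 0"
      using someI_ex[of "\<lambda>g. g \<in> G \<and> C.pB (X - emb g) = 0"] someI_ex[of "\<lambda>g. g \<in> G \<and> C.pB (Y - emb g) = 0"] True Y'
      unfolding g_def[symmetric] by auto
    then show ?thesis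
      using C.pBD(9)[OF X emb_CS Y, of g] C.pBD(6)[OF emb_CS Y, of g] C.pBD(5)[OF C.CSD(4)[OF X Y]] by linarith
  next
    case False
    then have "code X = code Y"
      using eq by (auto simp: \<pi>_def split: if_splits)
    then show ?thesis
      by (rule code_eqD[OF X Y])
  qed
qed

end

sublocale base_group \<subseteq> Q: quotient_model sub cap N C.VB C.CS C.pB \<pi>
  by unfold_locales (use C.flow_VB C.flow_subgroup_CS C.good_pB \<pi>_eq in auto)

section \<open>The quotient enlarges the given group and satisfies (G1) to (G3)\<close>

context base_group
begin

lemma pB_base: "C.pB (C.cst (x, 0)) = nrm (ev x)"
  by (simp add: limit_base p0_def)

lemma \<pi>_emb:
  assumes "g \<in> G"
  shows "\<pi> (emb g) = Inl g"
proof -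
  have iff: "C.pB (emb g - emb g') = 0 \<longleftrightarrow> g' = g" if "g' \<in> G" for g'
  proof -
    have "C.pB (emb g - emb g') = nrm (gsub G f g g')"
      unfolding emb_def additive.diff[OF C.additive_cst, symmetric]
      using assms that by (simp add: limit_base p0_def ev_hom ev)
    then show ?thesis
      using assms that gsub_eq_gzero[OF G] gsub_self[OF G] by (auto simp: nrm gsub_closed[OF G])
  qed
  then have "(SOME g'. g' \<in> G \<and> C.pB (emb g - emb g') = 0) = g"
    by (intro some_equality conjI) (use assms iff in blast)+
  moreover have "\<exists>g'\<in>G. C.pB (emb g - emb g') = 0"
    using iff[OF assms] assms by blast
  ultimately show ?thesis
    by (simp only: \<pi>_def if_True)
qed

lemma plusT_emb:
  assumes "x \<in> G" "y \<in> G"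
  shows "Q.plusT (Inl x) (Inl y) = Inl (f x y)"
proof -
  have "C.pB (emb x + emb y - emb (f x y)) = C.pB (C.cst (frag_of x + frag_of y - frag_of (f x y), 0))"
    unfolding emb_def
    by (simp only: additive.diff[OF C.additive_cst, symmetric] additive.add[OF C.additive_cst, symmetric]) simp
  also have "\<dots> = 0"
    unfolding pB_base using assms GD(1) G0(1) by (simp add: ev_hom ev gsub_self[OF G] nrm)
  finally have "\<pi> (emb x + emb y) = \<pi> (emb (f x y))"
    by (intro \<pi>_eq[THEN iffD2] C.CSD emb_CS)
  then show ?thesis
    using Q.plusT_\<pi>[of "emb x" "emb y"] assms GD(1) by (simp only: \<pi>_emb emb_CS)
qed

lemma \<pi>_0: "\<pi> 0 = Inl (gzero G f)"
proof -
  have "C.pB (emb (gzero G f) - 0) = nrm (gzero G f)"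
    using G0(1) by (simp only: diff_zero emb_def pB_base ev if_True)
  also have "\<dots> = 0"
    using G0(1) nrm(2) by blast
  finally have "\<pi> (emb (gzero G f)) = \<pi> 0"
    by (intro \<pi>_eq[THEN iffD2] C.CSD emb_CS)
  then show ?thesis
    using \<pi>_emb[OF G0(1)] by simp
qed

lemma actT_emb:
  assumes "0 \<le> t" "x \<in> G"
  shows "Q.actT t (Inl x) = Inl (act t x)"
proof (cases "t = 0")
  case True
  then show ?thesis
    using assms by (simp add: Q.actT_0 \<pi>_0 act)
next
  case False
  then have t: "0 < t"
    using assms by simp
  have "C.VB (ln t) (emb x) = emb (act t x)"
    using t assms by (simp add: emb_def C.VB_cst VA_def V0_frag_of flowD(5)[OF flow_shift]
        additive.zero[OF additive_pm_map[OF flowD(1)[OF flow_shift]]])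
  then show ?thesis
    using Q.actT_\<pi>[OF emb_CS t, of x] assms by (simp add: \<pi>_emb act)
qed

lemma nrmT_emb: "x \<in> G \<Longrightarrow> Q.nrmT (Inl x) = nrm x"
  using Q.nrmT_\<pi>[OF emb_CS, of x] pB_base[of "frag_of x"]
  by (simp only: \<pi>_emb emb_def[symmetric] ev if_True)

lemma prop_G3_T: "prop_G3 N Q.T Q.plusT Q.nrmT"
  unfolding prop_G3_def Q.ball_T
proof (intro impI ballI allI)
  fix X and \<epsilon> :: real
  assume N: "N = 0" and X: "X \<in> C.CS" and \<epsilon>: "0 < \<epsilon>"
  obtain k y where k: "0 < k" "limit (mul k y) = 0" "C.pB (X - C.cst y) < \<epsilon>"
    using torsion_dense[OF N X \<epsilon>] by blast
  have "gmult Q.T Q.plusT k (\<pi> (C.cst y)) = gzero Q.T Q.plusT"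
    using k(2) by (simp add: Q.\<pi>_hom(4)[symmetric] Q.p_zero_iff[symmetric] C.CSD mul_additive[OF C.additive_cst, symmetric])
  moreover have "Q.nrmT (gsub Q.T Q.plusT (\<pi> X) (\<pi> (C.cst y))) < \<epsilon>"
    using k(3) X by (simp only: Q.nrmT_gsub C.cst_CS)
  ultimately show "\<exists>y\<in>Q.T. (\<exists>n>0. gmult Q.T Q.plusT n y = gzero Q.T Q.plusT) \<and> Q.nrmT (gsub Q.T Q.plusT (\<pi> X) y) < \<epsilon>"
    using k(1) Q.T_I[OF C.cst_CS] by blast
qed

lemma prop_G2_T: "prop_G2 r N Q.T Q.plusT Q.nrmT"
  unfolding prop_G2_def
proof (intro allI impI, elim conjE)
  fix H :: "nat set" and h q K \<phi> and \<epsilon> :: real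
  assume finH: "finite H" and vg: "valued_grp H h q" and exp: "N \<noteq> 0 \<longrightarrow> has_exponent H h N"
    and qr: "\<forall>x\<in>H. ereal (q x) \<le> r" and K: "subgrp K H h" and hom: "grp_hom K h Q.T Q.plusT \<phi>"
    and iso: "\<forall>x\<in>K. Q.nrmT (\<phi> x) = q x" and \<epsilon>: "0 < \<epsilon>" "\<epsilon> < 1"
  have H: "ab_grp H h" and q: "is_value H h q"
    using vg by (auto simp: valued_grp_def)
  note H0 = gzero[OF H] and HD = ab_grpD[OF H]
  have qD: "\<And>x. x \<in> H \<Longrightarrow> 0 \<le> q x" "q (gzero H h) = 0" "\<And>x. x \<in> H \<Longrightarrow> q (gneg H h x) = q x"
    "\<And>x y. x \<in> H \<Longrightarrow> y \<in> H \<Longrightarrow> q (h x y) \<le> q x + q y"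
    using q H0(1) by (auto simp: is_value_def)
  have KH: "K \<subseteq> H" and Ksub: "\<And>x y. x \<in> K \<Longrightarrow> y \<in> K \<Longrightarrow> gsub H h x y \<in> K"
    using K by (auto simp: subgrp_def)
  obtain k0 where "k0 \<in> K"
    using K by (auto simp: subgrp_def)
  then have K0: "gzero H h \<in> K"
    using Ksub[of k0 k0] gsub_self[OF H, of k0] KH by auto
  have \<phi>: "\<And>x. x \<in> K \<Longrightarrow> \<phi> x \<in> Q.T" "\<And>x y. x \<in> K \<Longrightarrow> y \<in> K \<Longrightarrow> \<phi> (h x y) = Q.plusT (\<phi> x) (\<phi> y)"
    using hom by (auto simp: grp_hom_def)
  have "\<exists>g :: frag \<Rightarrow> nat. (\<forall>x. g x \<in> H) \<and> (\<forall>x y. g (x + y) = h (g x) (g y)) \<and>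
     (\<forall>i. g (frag_of i) = (if i \<in> H then i else gzero H h))"
    by (rule ex_free_hom[OF H]) (use H0 in auto)
  then obtain eH :: "frag \<Rightarrow> nat" where eH: "\<And>x. eH x \<in> H" "\<And>x y. eH (x + y) = h (eH x) (eH y)"
    "\<And>i. eH (frag_of i) = (if i \<in> H then i else gzero H h)"
    by blast
  note eH_hom = hom_into_grp_UNIV[OF H eH(1,2)]
  have CS: "ab_grp C.CS (+)"
    by (rule ab_grp_flow_subgroup[OF C.flow_subgroup_CS])
  have "\<exists>g :: frag \<Rightarrow> _. (\<forall>x. g x \<in> C.CS) \<and> (\<forall>x y. g (x + y) = g x + g y) \<and>
     (\<forall>i. g (frag_of i) = (if i \<in> K then Q.rep (\<phi> i) else 0))"
    by (rule ex_free_hom[OF CS]) (use \<phi>(1) Q.rep C.CSD(1) in auto)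
  then obtain e :: "frag \<Rightarrow> _" where e: "\<And>x. e x \<in> C.CS" "\<And>x y. e (x + y) = e x + e y"
    "\<And>i. e (frag_of i) = (if i \<in> K then Q.rep (\<phi> i) else 0)"
    by blast
  have add_e: "additive e"
    by standard (rule e(2))
  \<comment> \<open>\<open>e\<close> and \<open>\<theta>\<close> both kill the generators outside
    \<open>K\<close>; so both see only the part of a formal sum supported in \<open>K\<close>, and
    all of \<open>frag\<close> can parametrise the subgroup.\<close>
  define \<theta> :: "frag \<Rightarrow> frag" where "\<theta> = frag_extend (\<lambda>i. if i \<in> K then frag_of i else 0)"
  have add_\<theta>: "additive \<theta>"
    by standard (simp add: \<theta>_def frag_extend_add)
  have \<theta>_of: "\<theta> (frag_of i) = (if i \<in> K then frag_of i else 0)" for i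
    by (simp add: \<theta>_def)
  define Q where "Q m = q (eH m)" for m
  have semi: "seminorm_on UNIV Q"
    by (simp add: seminorm_on_def Q_def eH_hom eH qD)
  have eH_\<theta>: "eH (\<theta> w) \<in> K" for w
  proof (rule frag_induction[OF subset_UNIV, where P = "\<lambda>w. eH (\<theta> w) \<in> K"])
    show "eH (\<theta> 0) \<in> K"
      by (simp add: additive.zero[OF add_\<theta>] eH_hom K0)
    show "eH (\<theta> (frag_of i)) \<in> K" for i
      using KH by (auto simp: \<theta>_of eH eH_hom K0)
    show "eH (\<theta> (a - b)) \<in> K" if "eH (\<theta> a) \<in> K" "eH (\<theta> b) \<in> K" for a b
      using that by (simp add: additive.diff[OF add_\<theta>] eH_hom Ksub)
  qed
  have \<phi>0: "\<phi> (gzero H h) = gzero Q.T Q.plusT"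
    by (rule idem_gzero[OF Q.ab_grp_T]) (use \<phi> K0 H0 in \<open>auto simp flip: \<phi>(2)\<close>)
  have \<pi>e: "\<pi> (e w) = \<phi> (eH (\<theta> w))" for w
  proof (rule free_hom_eqI[where g = "\<lambda>w. \<pi> (e w)" and g' = "\<lambda>w. \<phi> (eH (\<theta> w))", OF Q.ab_grp_T])
    show "\<pi> (e (frag_of i)) = \<phi> (eH (\<theta> (frag_of i)))" for i
    proof (cases "i \<in> K")
      case True
      then show ?thesis
        using KH Q.rep(2)[OF \<phi>(1)] by (auto simp: e \<theta>_of eH)
    next
      case False
      then show ?thesis
        using Q.\<pi>_hom(1) by (simp add: e \<theta>_of eH_hom \<phi>0)
    qed
  qed (simp_all add: e Q.T_I Q.plusT_\<pi> additive.add[OF add_\<theta>] eH \<phi> eH_\<theta>)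
  have isoQ: "C.pB (e w) = Q (\<theta> w)" for w
    using Q.nrmT_\<pi>[OF e(1), of w] iso eH_\<theta>[of w] by (simp add: \<pi>e Q_def)
  \<comment> \<open>These elements encode the operation table of \<open>H\<close>. Their
    \<open>Q\<close> is 0, so the multiplicative bounds force them to be null in the tower, which
    makes the map on generators a homomorphism.\<close>
  let ?rel = "\<lambda>(x, y). frag_of x + frag_of y - frag_of (h x y)"
  have "\<exists>n. (\<forall>m\<in>frag_of ` H \<union> ?rel ` (H \<times> H). (1 - \<epsilon>) * Q m \<le> limit (inst n m) \<and> limit (inst n m) \<le> (1 + \<epsilon>) * Q m) \<and>
    (\<forall>w\<in>frag_of ` K. C.pB (e w - C.cst (inst n (\<theta> w))) \<le> \<epsilon>)"
  proof (rule approximate_extension[OF add_e e(1) semi add_\<theta> isoQ, where R = "frag_of ` K" and K = "sum q H"])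
    show "\<exists>w'\<in>frag_of ` K. C.pB (e (w - w')) = 0" for w
    \<comment> \<open>A formal sum and the single generator named by its value in \<open>K\<close>
      have the same image up to a null element, so finitely many representatives are enough.\<close>
    proof (rule bexI[of _ "frag_of (eH (\<theta> w))"])
      have "eH (\<theta> (w - frag_of (eH (\<theta> w)))) = gzero H h"
        using eH_\<theta>[of w] KH eH(1) by (auto simp: additive.diff[OF add_\<theta>] \<theta>_of eH_hom eH gsub_self[OF H])
      then show "C.pB (e (w - frag_of (eH (\<theta> w)))) = 0"
        by (simp only: isoQ Q_def qD)
    qed (use eH_\<theta> in auto)
    show "Q m \<le> sum q H" for m
      unfolding Q_def using member_le_sum[of "eH m" H q] eH(1) qD(1) finH by simp
    show "Q m \<le> 1" if cap for m
      using qr eH(1)[of m] that by (auto simp: Q_def r one_ereal_def)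
    show "Q (mul N m) = 0" if "N \<noteq> 0" for m
      using exp that eH(1) qD(2) by (simp add: Q_def eH_hom has_exponent_def)
    show "finite (frag_of ` K)" "finite (frag_of ` K)"
      using finH KH by (auto intro: finite_subset)
    show "finite (frag_of ` H \<union> ?rel ` (H \<times> H))"
      using finH by auto
  qed (use \<epsilon> in auto)
  then obtain n where n0: "\<forall>m\<in>frag_of ` H \<union> ?rel ` (H \<times> H). (1 - \<epsilon>) * Q m \<le> limit (inst n m) \<and> limit (inst n m) \<le> (1 + \<epsilon>) * Q m"
    "\<forall>w\<in>frag_of ` K. C.pB (e w - C.cst (inst n (\<theta> w))) \<le> \<epsilon>"
    by (elim exE conjE)
  note n = bspec[OF n0(1)] bspec[OF n0(2)]
  define I where "I x = C.cst (inst n (frag_of x))" for x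
  have I: "I x \<in> C.CS" for x
    by (simp add: I_def)
  show "\<exists>\<psi>. grp_hom H h Q.T Q.plusT \<psi> \<and> (\<forall>x\<in>K. Q.nrmT (gsub Q.T Q.plusT (\<phi> x) (\<psi> x)) \<le> \<epsilon>) \<and>
     (\<forall>x\<in>H. (1 - \<epsilon>) * q x \<le> Q.nrmT (\<psi> x) \<and> Q.nrmT (\<psi> x) \<le> (1 + \<epsilon>) * q x)"
  proof (intro exI[of _ "\<lambda>x. \<pi> (I x)"] conjI ballI)
    show "grp_hom H h Q.T Q.plusT (\<lambda>x. \<pi> (I x))"
      unfolding grp_hom_def
    proof (intro conjI ballI)
      fix x y assume xy: "x \<in> H" "y \<in> H"
      have "Q (?rel (x, y)) = 0"
        using xy HD(1) qD(2) by (simp add: Q_def eH_hom eH gsub_self[OF H])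
      then have "limit (inst n (?rel (x, y))) = 0"
        using n(1)[of "?rel (x, y)"] xy by force
      then have "C.pB (I x + I y - I (h x y)) = 0"
        unfolding I_def
        by (simp only: additive.diff[OF C.additive_cst, symmetric] additive.add[OF C.additive_cst, symmetric]
            additive.diff[OF additive_inst, symmetric] additive.add[OF additive_inst, symmetric] C.pB_cst case_prod_conv)
      then have "\<pi> (I x + I y) = \<pi> (I (h x y))"
        by (intro \<pi>_eq[THEN iffD2] C.CSD I)
      then show "\<pi> (I (h x y)) = Q.plusT (\<pi> (I x)) (\<pi> (I y))"
        by (simp only: Q.plusT_\<pi> I)
    qed (simp add: Q.T_I I)
  next
    fix x assume x: "x \<in> K"
    have "\<phi> x = \<pi> (e (frag_of x))"
      using x KH by (auto simp: \<pi>e \<theta>_of eH)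
    then have "Q.nrmT (gsub Q.T Q.plusT (\<phi> x) (\<pi> (I x))) = C.pB (e (frag_of x) - I x)"
      by (simp only: Q.nrmT_gsub e(1) I)
    then show "Q.nrmT (gsub Q.T Q.plusT (\<phi> x) (\<pi> (I x))) \<le> \<epsilon>"
      using n(2)[of "frag_of x"] x by (simp only: I_def \<theta>_of if_True) simp
  next
    fix x assume x: "x \<in> H"
    have "Q.nrmT (\<pi> (I x)) = limit (inst n (frag_of x))"
      using Q.nrmT_\<pi>[OF I] by (simp add: I_def)
    then show "(1 - \<epsilon>) * q x \<le> Q.nrmT (\<pi> (I x))" "Q.nrmT (\<pi> (I x)) \<le> (1 + \<epsilon>) * q x"
      using n(1)[of "frag_of x"] x by (simp_all add: Q_def eH)
  qed
qed

lemma is_GrN_T: "is_GrN r N Q.T Q.plusT Q.nrmT"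
  unfolding is_GrN_def
proof (intro conjI prop_G2_T prop_G3_T)
  show "vg_complete Q.T Q.plusT Q.nrmT"
    by (rule Q.vg_complete_T) (rule C.complete)
  show "frakG r N Q.T Q.plusT Q.nrmT"
    by (rule Q.frakG_T[OF r, of "C.cst ` D"]) (use countable_D D_dense_CS in auto)
qed

end

theorem theorem1p3:
  fixes r :: ereal and N :: nat and sub :: bool
    and G :: "'a set" and f :: "'a \<Rightarrow> 'a \<Rightarrow> 'a"
    and act :: "real \<Rightarrow> 'a \<Rightarrow> 'a" and nrm :: "'a \<Rightarrow> real"
  assumes "r \<in> {1, \<infinity>}"
    and "N \<noteq> 1"
    and "top_pvg sub G f act nrm"
    and "G \<noteq> {gzero G f}"
    and "frakG r N G f nrm"
  shows "\<exists>(T :: ('a + real) set) f' act' nrm'.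
           top_pvg sub T f' act' nrm' \<and>
           Inl ` G \<subseteq> T \<and>
           (\<forall>x\<in>G. \<forall>y\<in>G. f' (Inl x) (Inl y) = Inl (f x y)) \<and>
           (\<forall>t\<ge>0. \<forall>x\<in>G. act' t (Inl x) = Inl (act t x)) \<and>
           (\<forall>x\<in>G. nrm' (Inl x) = nrm x) \<and>
           is_GrN r N T f' nrm'"
proof -
  \<comment> \<open>In the normed case a nonzero \<open>x\<close> scaled by 2 / nrm x has norm 2,
    against the bound 1.\<close>
  have sub: sub if "r = 1"
  proof (rule ccontr)
    assume "\<not> sub"
    then have norm: "\<And>t x. 0 \<le> t \<Longrightarrow> x \<in> G \<Longrightarrow> nrm (act t x) = t * nrm x"
      and act: "\<And>t x. 0 \<le> t \<Longrightarrow> x \<in> G \<Longrightarrow> act t x \<in> G"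
      using assms(3) by (auto simp: top_pvg_def is_pv_norm_def pvg_def)
    have G: "ab_grp G f" and val: "is_value G f nrm"
      using assms(5) by (auto simp: frakG_def valued_grp_def)
    obtain x where x: "x \<in> G" "x \<noteq> gzero G f"
      using gzero(1)[OF G] assms(4) by blast
    then have pos: "0 < nrm x"
      using val by (auto simp: is_value_def order_less_le)
    have "ereal (nrm (act (2 / nrm x) x)) \<le> 1"
      using assms(5) that act[of "2 / nrm x" x] x pos by (auto simp: frakG_def)
    then show False
      using norm[of "2 / nrm x" x] x pos by (simp add: one_ereal_def)
  qed
  interpret base_group sub "r = 1" N G f act nrm r
    by unfold_locales (use sub assms in auto)
  show ?thesis
  proof (intro exI conjI)
    show "top_pvg sub Q.T Q.plusT Q.actT Q.nrmT"
      by (rule Q.top_pvg_T)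
    show "Inl ` G \<subseteq> Q.T"
      by (metis \<pi>_emb Q.T_I emb_CS image_subsetI)
    show "is_GrN r N Q.T Q.plusT Q.nrmT"
      by (rule is_GrN_T)
  qed (use plusT_emb actT_emb nrmT_emb in auto)
qed

end
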